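(* Let $\Gamma$ be a countably infinite discrete group, let $S \subset \Gamma$ be a finite set, and let $\mathscr{H} = \{H_{D_i,n_i}\}_{i=0}^\infty$ be the countable family of finite $S$-labeled graphs defined in the context (for any choice of the sequences $(F_i)$ and $(n_i)$ there). Let $k \in \mathbb{N}^+$ and let $\mathscr{P}$ be a finite set of $S$-connected $k$-patterns. The following statements are equivalent. (1) There is a continuous $\mathscr{P}$-avoiding $k$-coloring of $\mathrm{Free}(2^\Gamma)$. (2) Every free zero-dimensional Polish $\Gamma$-space admits a continuous $\mathscr{P}$-avoiding $k$-coloring. (3) There is a graph in $\mathscr{H}$ that admits a $\mathscr{P}$-avoiding $k$-coloring. (4) All but finitely many graphs in $\mathscr{H}$ admit $\mathscr{P}$-avoiding $k$-colorings.
   Context: Conventions. $\mathbf{1}$ is the identity of $\Gamma$. Each integer $n \in \mathbb{N}^+$ is identified with the discrete set $\{0,\ldots,n-1\}$; a $k$-coloring of a set is a function from it to $k$. For $F \subseteq \Gamma$ and $m \in \mathbb{N}$, $F^m = \{f_1 \cdots f_m : f_i \in F\}$. $\log^\ast n$ is the number of times the (base $2$) logarithm must be iteratively applied to $n$ before the result becomes at most $1$. $\Gamma$-spaces. A $\Gamma$-space is a topological space with a continuous left action of $\Gamma$. It is free if the action is free, and zero-dimensional Polish if the underlying space is Polish with a base of clopen sets. $2^\Gamma$ is a $\Gamma$-space under $(\gamma\cdot x)(\delta) = x(\delta\gamma)$, and $\mathrm{Free}(2^\Gamma)$ is the set of its points with trivial stabilizer, with the subspace topology and induced action. Patterns on $\Gamma$-spaces.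 A $k$-pattern is a partial map $p \colon \Gamma \rightharpoonup k$ with finite domain. It occurs in $f \colon X \to k$, where $X$ is a $\Gamma$-space, if there is $x \in X$ with $f(\gamma \cdot x) = p(\gamma)$ for all $\gamma \in \mathrm{dom}(p)$. A coloring $f$ is $\mathscr{P}$-avoiding if no $p \in \mathscr{P}$ occurs in $f$. $S$-labeled graphs. An $S$-labeled graph is a simple undirected graph $G$ with a labeling map $\lambda$ assigning to each ordered pair $(x,y)$ of adjacent vertices an element $\lambda(x,y) \in S \cup S^{-1}$ so that $\lambda(y,x) = \lambda(x,y)^{-1}$. The Cayley graph $G(\Gamma,S)$ has vertex set $\Gamma$, with distinct $x,y$ adjacent iff $y = \sigma x$ for some $\sigma \in S \cup S^{-1}$, and then $\lambda(x,y) = \sigma$. For $F \subseteq \Gamma$, $G(F,S)$ is the subgraph of $G(\Gamma,S)$ induced by $F$ (with inherited labels). A homomorphism of $S$-labeled graphs $G \to H$ is a map $\varphi \colon V(G) \to V(H)$ such that if $x,y$ are adjacent in $G$, then $\varphi(x),\varphi(y)$ are adjacent in $H$ and $\lambda(\varphi(x),\varphi(y)) = \lambda(x,y)$. A $k$-pattern $p \colon F \to k$ is $S$-connected if the graph $G(F,S)$ is connected. An $S$-connected $k$-pattern $p \colon F \to k$ occurs in a coloring $f \colon V(G) \to k$ of an $S$-labeled graph $G$ if there is a homomorphism $\varphi \colon F \to V(G)$ from $G(F,S)$ to $G$ with $f \circ \varphi = p$. The coloring $f$ is $\mathscr{P}$-avoiding if no $p \in \mathscr{P}$ occurs in $f$.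 The family $\mathscr{H}$. For a finite $D \subset \Gamma$ with $S \cup S^{-1} \cup \{\mathbf{1}\} \subseteq D$ and $n \in \mathbb{N}^+$, the $S$-labeled graph $H_{D,n}$ has vertex set $\mathrm{Inj}(D,n)$, the set of all injective maps $D \to n$, and there is an edge labeled $\sigma \in S \cup S^{-1}$ from $q$ to $q'$ (i.e., distinct $q,q'$ are adjacent and $\lambda(q,q') = \sigma$) if and only if for all $\delta,\delta' \in D$, $\delta = \delta'\sigma$ implies $q(\delta) = q'(\delta')$. (Such $\sigma$ is unique if it exists.) Fix an arbitrary strictly increasing sequence $S \cup S^{-1} \cup \{\mathbf{1}\} \subseteq F_0 \subset F_1 \subset \cdots$ of finite subsets of $\Gamma$ with $\bigcup_i F_i = \Gamma$. For each $i$, let $n_i \geq 2$ be any integer with $n_i \geq |F_i|^{2\log^\ast n_i}$, and let $D_i = F_i^{\log^\ast n_i}$. Then $\mathscr{H} = \{H_{D_i,n_i}\}_{i=0}^\infty$. *)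

theory Defs
  imports "HOL-Analysis.Analysis" "HOL-Algebra.Group_Action"
begin

section \<open>Topological group actions and continuous colorings\<close>

text \<open>
  \<open>\<Gamma>\<close> carries the discrete topology. Note that the library's \<^const>\<open>group_action\<close> asks every
  \<open>\<phi> g\<close> to be an extensional function, i.e. to be \<^const>\<open>undefined\<close> off the space.
\<close>

definition Gamma_space :: "('g, 'm) monoid_scheme \<Rightarrow> 'x topology \<Rightarrow> ('g \<Rightarrow> 'x \<Rightarrow> 'x) \<Rightarrow> bool" where
  "Gamma_space \<Gamma> X \<phi> \<longleftrightarrow>
     group_action \<Gamma> (topspace X) \<phi> \<and>
     continuous_map (prod_topology (discrete_topology (carrier \<Gamma>)) X) X (\<lambda>(g, x). \<phi> g x)"

definition free_Gamma_space :: "('g, 'm) monoid_scheme \<Rightarrow> 'x topology \<Rightarrow> ('g \<Rightarrow> 'x \<Rightarrow> 'x) \<Rightarrow> bool" where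
  "free_Gamma_space \<Gamma> X \<phi> \<longleftrightarrow>
     Gamma_space \<Gamma> X \<phi> \<and> (\<forall>x \<in> topspace X. stabilizer \<Gamma> \<phi> x = {\<one>\<^bsub>\<Gamma>\<^esub>})"

definition polish :: "'x topology \<Rightarrow> bool" where
  "polish X \<longleftrightarrow> completely_metrizable_space X \<and> separable_space X"

definition zero_dimensional :: "'x topology \<Rightarrow> bool" where
  "zero_dimensional X \<longleftrightarrow>
     (\<exists>\<B>. (\<forall>B \<in> \<B>. openin X B \<and> closedin X B) \<and>
          (\<forall>U x. openin X U \<and> x \<in> U \<longrightarrow> (\<exists>B \<in> \<B>. x \<in> B \<and> B \<subseteq> U)))"

text \<open>The integer \<open>k\<close>, viewed as a discrete set, is \<open>{..<k}\<close>; in particular \<open>2 = {..<2::nat}\<close>.\<close>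

definition two_pow :: "('g, 'm) monoid_scheme \<Rightarrow> ('g \<Rightarrow> nat) topology" where
  "two_pow \<Gamma> = product_topology (\<lambda>_. discrete_topology {..<2}) (carrier \<Gamma>)"

definition shift :: "('g, 'm) monoid_scheme \<Rightarrow> 'g \<Rightarrow> ('g \<Rightarrow> nat) \<Rightarrow> ('g \<Rightarrow> nat)" where
  "shift \<Gamma> g = (\<lambda>x \<in> topspace (two_pow \<Gamma>). \<lambda>d \<in> carrier \<Gamma>. x (d \<otimes>\<^bsub>\<Gamma>\<^esub> g))"

definition free_points :: "('g, 'm) monoid_scheme \<Rightarrow> ('g \<Rightarrow> nat) set" where
  "free_points \<Gamma> = {x \<in> topspace (two_pow \<Gamma>). stabilizer \<Gamma> (shift \<Gamma>) x = {\<one>\<^bsub>\<Gamma>\<^esub>}}"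

definition Free_two_pow :: "('g, 'm) monoid_scheme \<Rightarrow> ('g \<Rightarrow> nat) topology" where
  "Free_two_pow \<Gamma> = subtopology (two_pow \<Gamma>) (free_points \<Gamma>)"

definition free_shift :: "('g, 'm) monoid_scheme \<Rightarrow> 'g \<Rightarrow> ('g \<Rightarrow> nat) \<Rightarrow> ('g \<Rightarrow> nat)" where
  "free_shift \<Gamma> g = restrict (shift \<Gamma> g) (free_points \<Gamma>)"

definition is_pattern :: "('g, 'm) monoid_scheme \<Rightarrow> nat \<Rightarrow> ('g \<rightharpoonup> nat) \<Rightarrow> bool" where
  "is_pattern \<Gamma> k p \<longleftrightarrow> finite (dom p) \<and> dom p \<subseteq> carrier \<Gamma> \<and> ran p \<subseteq> {..<k}"

definition occurs_in_space ::
    "'x topology \<Rightarrow> ('g \<Rightarrow> 'x \<Rightarrow> 'x) \<Rightarrow> ('g \<rightharpoonup> nat) \<Rightarrow> ('x \<Rightarrow> nat) \<Rightarrow> bool" where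
  "occurs_in_space X \<phi> p f \<longleftrightarrow> (\<exists>x \<in> topspace X. \<forall>g \<in> dom p. p g = Some (f (\<phi> g x)))"

definition admits_continuous_avoiding_coloring ::
    "'x topology \<Rightarrow> ('g \<Rightarrow> 'x \<Rightarrow> 'x) \<Rightarrow> nat \<Rightarrow> ('g \<rightharpoonup> nat) set \<Rightarrow> bool" where
  "admits_continuous_avoiding_coloring X \<phi> k P \<longleftrightarrow>
     (\<exists>f. continuous_map X (discrete_topology {..<k}) f \<and> (\<forall>p \<in> P. \<not> occurs_in_space X \<phi> p f))"


section \<open>Labeled graphs\<close>

record ('v, 'g) lgraph =
  vertices :: "'v set"
  adj :: "'v \<Rightarrow> 'v \<Rightarrow> bool"
  label :: "'v \<Rightarrow> 'v \<Rightarrow> 'g"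

text \<open>Only the labels of adjacent pairs are meaningful.\<close>

definition S_labeled_graph ::
    "('g, 'm) monoid_scheme \<Rightarrow> 'g set \<Rightarrow> ('v, 'g) lgraph \<Rightarrow> bool" where
  "S_labeled_graph \<Gamma> S G \<longleftrightarrow>
     (\<forall>x y. adj G x y \<longrightarrow>
        x \<in> vertices G \<and> y \<in> vertices G \<and> x \<noteq> y \<and> adj G y x \<and>
        label G x y \<in> S \<union> set_inv\<^bsub>\<Gamma>\<^esub> S \<and> label G y x = inv\<^bsub>\<Gamma>\<^esub> (label G x y))"

definition cayley_graph :: "('g, 'm) monoid_scheme \<Rightarrow> 'g set \<Rightarrow> ('g, 'g) lgraph" where
  "cayley_graph \<Gamma> S =
     \<lparr>vertices = carrier \<Gamma>,
      adj = (\<lambda>x y. x \<in> carrier \<Gamma> \<and> y \<in> carrier \<Gamma> \<and> x \<noteq> y \<and>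
                   (\<exists>\<sigma> \<in> S \<union> set_inv\<^bsub>\<Gamma>\<^esub> S. y = \<sigma> \<otimes>\<^bsub>\<Gamma>\<^esub> x)),
      label = (\<lambda>x y. THE \<sigma>. \<sigma> \<in> S \<union> set_inv\<^bsub>\<Gamma>\<^esub> S \<and> y = \<sigma> \<otimes>\<^bsub>\<Gamma>\<^esub> x)\<rparr>"

definition induced_lgraph :: "('v, 'g) lgraph \<Rightarrow> 'v set \<Rightarrow> ('v, 'g) lgraph" where
  "induced_lgraph G F =
     \<lparr>vertices = F, adj = (\<lambda>x y. x \<in> F \<and> y \<in> F \<and> adj G x y), label = label G\<rparr>"

definition lgraph_hom :: "('v, 'g) lgraph \<Rightarrow> ('w, 'g) lgraph \<Rightarrow> ('v \<Rightarrow> 'w) \<Rightarrow> bool" where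
  "lgraph_hom G H h \<longleftrightarrow>
     h \<in> vertices G \<rightarrow> vertices H \<and>
     (\<forall>x y. adj G x y \<longrightarrow> adj H (h x) (h y) \<and> label H (h x) (h y) = label G x y)"

text \<open>The empty graph counts as connected.\<close>

definition lgraph_connected :: "('v, 'g) lgraph \<Rightarrow> bool" where
  "lgraph_connected G \<longleftrightarrow> (\<forall>x \<in> vertices G. \<forall>y \<in> vertices G. (adj G)\<^sup>*\<^sup>* x y)"

definition S_connected :: "('g, 'm) monoid_scheme \<Rightarrow> 'g set \<Rightarrow> ('g \<rightharpoonup> nat) \<Rightarrow> bool" where
  "S_connected \<Gamma> S p \<longleftrightarrow> lgraph_connected (induced_lgraph (cayley_graph \<Gamma> S) (dom p))"

definition occurs_in_graph ::
    "('g, 'm) monoid_scheme \<Rightarrow> 'g set \<Rightarrow> ('v, 'g) lgraph \<Rightarrow> ('g \<rightharpoonup> nat) \<Rightarrow> ('v \<Rightarrow> nat) \<Rightarrow> bool" where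
  "occurs_in_graph \<Gamma> S G p f \<longleftrightarrow>
     (\<exists>h. lgraph_hom (induced_lgraph (cayley_graph \<Gamma> S) (dom p)) G h \<and>
          (\<forall>g \<in> dom p. p g = Some (f (h g))))"

definition admits_avoiding_coloring ::
    "('g, 'm) monoid_scheme \<Rightarrow> 'g set \<Rightarrow> ('v, 'g) lgraph \<Rightarrow> nat \<Rightarrow> ('g \<rightharpoonup> nat) set \<Rightarrow> bool" where
  "admits_avoiding_coloring \<Gamma> S G k P \<longleftrightarrow>
     (\<exists>f \<in> vertices G \<rightarrow> {..<k}. \<forall>p \<in> P. \<not> occurs_in_graph \<Gamma> S G p f)"


section \<open>The graphs \<open>H\<^sub>D\<^sub>,\<^sub>n\<close>\<close>

definition Inj :: "'g set \<Rightarrow> nat \<Rightarrow> ('g \<Rightarrow> nat) set" where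
  "Inj D n = {q \<in> D \<rightarrow>\<^sub>E {..<n}. inj_on q D}"

definition H_edge ::
    "('g, 'm) monoid_scheme \<Rightarrow> 'g set \<Rightarrow> 'g set \<Rightarrow> 'g \<Rightarrow> ('g \<Rightarrow> nat) \<Rightarrow> ('g \<Rightarrow> nat) \<Rightarrow> bool" where
  "H_edge \<Gamma> S D \<sigma> q q' \<longleftrightarrow>
     \<sigma> \<in> S \<union> set_inv\<^bsub>\<Gamma>\<^esub> S \<and> (\<forall>d \<in> D. \<forall>d' \<in> D. d = d' \<otimes>\<^bsub>\<Gamma>\<^esub> \<sigma> \<longrightarrow> q d = q' d')"

definition H_graph ::
    "('g, 'm) monoid_scheme \<Rightarrow> 'g set \<Rightarrow> 'g set \<Rightarrow> nat \<Rightarrow> ('g \<Rightarrow> nat, 'g) lgraph" where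
  "H_graph \<Gamma> S D n =
     \<lparr>vertices = Inj D n,
      adj = (\<lambda>q q'. q \<in> Inj D n \<and> q' \<in> Inj D n \<and> q \<noteq> q' \<and> (\<exists>\<sigma>. H_edge \<Gamma> S D \<sigma> q q')),
      label = (\<lambda>q q'. THE \<sigma>. H_edge \<Gamma> S D \<sigma> q q')\<rparr>"

primrec set_pow :: "('g, 'm) monoid_scheme \<Rightarrow> 'g set \<Rightarrow> nat \<Rightarrow> 'g set" where
  "set_pow \<Gamma> F 0 = {\<one>\<^bsub>\<Gamma>\<^esub>}"
| "set_pow \<Gamma> F (Suc m) = F <#>\<^bsub>\<Gamma>\<^esub> set_pow \<Gamma> F m"

definition log_star :: "nat \<Rightarrow> nat" where
  "log_star n = (LEAST m. (log 2 ^^ m) (real n) \<le> 1)"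


section \<open>Well-definedness\<close>

context group
begin

lemma set_inv_closed: "S \<subseteq> carrier G \<Longrightarrow> S \<union> set_inv S \<subseteq> carrier G"
  by (auto simp: SET_INV_def)

lemma set_inv_sym: "S \<subseteq> carrier G \<Longrightarrow> \<sigma> \<in> S \<union> set_inv S \<Longrightarrow> inv \<sigma> \<in> S \<union> set_inv S"
proof -
  assume S: "S \<subseteq> carrier G" and "\<sigma> \<in> S \<union> set_inv S"
  then consider "\<sigma> \<in> S" | s where "s \<in> S" "\<sigma> = inv s"
    by (auto simp: SET_INV_def)
  then show ?thesis
    using S by cases (auto simp: SET_INV_def subset_iff)
qed

lemma cayley_label:
  assumes "S \<subseteq> carrier G" "x \<in> carrier G" "\<sigma> \<in> S \<union> set_inv S" "y = \<sigma> \<otimes> x"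
  shows "label (cayley_graph G S) x y = \<sigma>"
proof -
  have "\<tau> = \<sigma>" if "\<tau> \<in> S \<union> set_inv S" "y = \<tau> \<otimes> x" for \<tau>
  proof -
    have "\<tau> \<in> carrier G" "\<sigma> \<in> carrier G"
      using that(1) assms(3) set_inv_closed[OF assms(1)] by blast+
    then show ?thesis
      using right_cancel[of x \<tau> \<sigma>] assms(2) that(2)[unfolded assms(4)] by simp
  qed
  then show ?thesis
    unfolding cayley_graph_def lgraph.simps
    using assms(3,4) by (blast intro: the_equality)
qed

lemma S_labeled_graph_cayley:
  assumes S: "S \<subseteq> carrier G"
  shows "S_labeled_graph G S (cayley_graph G S)"
proof -
  have "adj (cayley_graph G S) y x \<and> label (cayley_graph G S) x y \<in> S \<union> set_inv S \<and>
        label (cayley_graph G S) y x = inv (label (cayley_graph G S) x y)"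
    if xy: "adj (cayley_graph G S) x y" for x y
  proof -
    from xy obtain \<sigma> where \<sigma>: "\<sigma> \<in> S \<union> set_inv S" "y = \<sigma> \<otimes> x"
      and c: "x \<in> carrier G" "y \<in> carrier G" "x \<noteq> y"
      by (auto simp: cayley_graph_def)
    have \<sigma>c: "\<sigma> \<in> carrier G" using \<sigma> set_inv_closed[OF S] by blast
    have i: "inv \<sigma> \<in> S \<union> set_inv S" using set_inv_sym[OF S \<sigma>(1)] .
    have x: "x = inv \<sigma> \<otimes> y" unfolding \<sigma>(2) using \<sigma>c c(1) by (simp flip: m_assoc)
    have "adj (cayley_graph G S) y x"
      unfolding cayley_graph_def lgraph.simps using i x c by blast
    then show ?thesis
      using cayley_label[OF S c(1) \<sigma>] cayley_label[OF S c(2) i x] \<sigma>(1) by simp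
  qed
  moreover have "x \<in> vertices (cayley_graph G S) \<and> y \<in> vertices (cayley_graph G S) \<and> x \<noteq> y"
    if "adj (cayley_graph G S) x y" for x y
    using that by (simp add: cayley_graph_def)
  ultimately show ?thesis
    unfolding S_labeled_graph_def by blast
qed

lemma H_edge_unique:
  assumes "S \<subseteq> carrier G" "S \<union> set_inv S \<union> {\<one>} \<subseteq> D" "q \<in> Inj D n"
    and "H_edge G S D \<sigma> q q'" "H_edge G S D \<tau> q q'"
  shows "\<sigma> = \<tau>"
proof -
  have *: "q \<rho> = q' \<one>" "\<rho> \<in> D" if "H_edge G S D \<rho> q q'" for \<rho>
  proof -
    have \<rho>: "\<rho> \<in> S \<union> set_inv S" using that unfolding H_edge_def by blast
    then show "\<rho> \<in> D" using assms(2) by blast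
    moreover have "\<rho> \<in> carrier G" using \<rho> set_inv_closed[OF assms(1)] by blast
    then have "\<rho> = \<one> \<otimes> \<rho>" by simp
    moreover have "\<one> \<in> D" using assms(2) by blast
    ultimately show "q \<rho> = q' \<one>" using that unfolding H_edge_def by blast
  qed
  have "inj_on q D" using assms(3) by (simp add: Inj_def)
  then show ?thesis
    using *[OF assms(4)] *[OF assms(5)] by (metis inj_onD)
qed

lemma H_edge_sym:
  assumes "S \<subseteq> carrier G" "D \<subseteq> carrier G" "H_edge G S D \<sigma> q q'"
  shows "H_edge G S D (inv \<sigma>) q' q"
proof -
  have s: "\<sigma> \<in> S \<union> set_inv S" "\<sigma> \<in> carrier G"
    using assms set_inv_closed[OF assms(1)] unfolding H_edge_def by blast+
  have "q' d = q d'" if "d \<in> D" "d' \<in> D" "d = d' \<otimes> inv \<sigma>" for d d'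
  proof -
    have "d' \<in> carrier G" using that assms(2) by blast
    then have "d' = d \<otimes> \<sigma>" using that(3) s(2) by (simp add: m_assoc)
    then show ?thesis using assms(3) that unfolding H_edge_def by metis
  qed
  then show ?thesis using set_inv_sym[OF assms(1) s(1)] unfolding H_edge_def by blast
qed

lemma S_labeled_graph_H:
  assumes S: "S \<subseteq> carrier G" and D: "D \<subseteq> carrier G" "S \<union> set_inv S \<union> {\<one>} \<subseteq> D"
  shows "S_labeled_graph G S (H_graph G S D n)"
proof -
  have lab: "label (H_graph G S D n) q q' = \<sigma>" if "q \<in> Inj D n" "H_edge G S D \<sigma> q q'" for q q' \<sigma>
    unfolding H_graph_def lgraph.simps
    using that(2) by (rule the_equality) (rule H_edge_unique[OF S D(2) that(1) _ that(2)])
  have "adj (H_graph G S D n) q' q \<and> label (H_graph G S D n) q q' \<in> S \<union> set_inv S \<and>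
        label (H_graph G S D n) q' q = inv (label (H_graph G S D n) q q')"
    if "adj (H_graph G S D n) q q'" for q q'
  proof -
    from that obtain \<sigma> where \<sigma>: "H_edge G S D \<sigma> q q'"
      and q: "q \<in> Inj D n" "q' \<in> Inj D n" "q \<noteq> q'"
      by (auto simp: H_graph_def)
    have \<sigma>': "H_edge G S D (inv \<sigma>) q' q" using H_edge_sym[OF S D(1) \<sigma>] .
    show ?thesis
    proof (intro conjI)
      show "adj (H_graph G S D n) q' q" unfolding H_graph_def lgraph.simps using q \<sigma>' by blast
      show "label (H_graph G S D n) q q' \<in> S \<union> set_inv S"
        using lab[OF q(1) \<sigma>] \<sigma> unfolding H_edge_def by simp
      show "label (H_graph G S D n) q' q = inv (label (H_graph G S D n) q q')"
        using lab[OF q(1) \<sigma>] lab[OF q(2) \<sigma>'] by simp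
    qed
  qed
  moreover have "q \<in> vertices (H_graph G S D n) \<and> q' \<in> vertices (H_graph G S D n) \<and> q \<noteq> q'"
    if "adj (H_graph G S D n) q q'" for q q'
    using that by (simp add: H_graph_def)
  ultimately show ?thesis
    unfolding S_labeled_graph_def by blast
qed

end

end

theory Submission
  imports Defs "HOL-Real_Asymp.Real_Asymp"
begin

text \<open>
  The step from (1) to (4) carries the weight. A continuous coloring of \<open>Free(2\<^sup>\<Gamma>)\<close> restricted to a
  compact subshift depends only on a finite window, so it suffices to find a compact subshift
  \<open>\<Omega> \<subseteq> Free(2\<^sup>\<Gamma>)\<close> whose points can be produced by a local rule from any coloring that is injective on
  translates of a large finite set. We take for \<open>\<Omega>\<close> the points \<open>x\<close> such that for every \<open>\<gamma> \<noteq> \<one>\<close> in an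
  enumeration of \<open>\<Gamma>\<close> a finite set \<open>T\<^sub>\<gamma>\<close>, fixed in advance, satisfies
  \<open>\<forall>g. \<exists>t \<in> T\<^sub>\<gamma>. x (t g) \<noteq> x (t \<gamma> g)\<close>; finitely many of these conditions determine \<open>x\<close> well
  enough on any given window.

  One value of \<open>\<gamma>\<close> is treated at a time, on the syndetic set \<open>R\<close> of positions still free. A maximal
  sparse subset \<open>M\<close> of \<open>R\<close> is kept for later stages, and each \<open>m \<in> M\<close> receives the positions of \<open>R - M\<close>
  in a window \<open>Z m\<close> as its bundle. The string written in the bundle of \<open>m\<close> has to differ, for
  polynomially many \<open>\<beta>\<close>, from what is seen around \<open>\<beta> m\<close>; since the number of strings is
  exponential in the size of the bundle, this is achieved greedily along a proper coloring. Such a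
  coloring with a bounded number of colors comes from the color reduction of Cole and Vishkin in
  \<open>O(log\<^sup>* n)\<close> rounds, which is why the windows \<open>F\<^sub>i\<^bsup>log\<^sup>* n\<^sub>i\<^esup>\<close> are large enough.

  From (3) to (2) one colors the space greedily along a countable clopen cover, with \<open>n \<ge> |D|\<^sup>2\<close>
  colors and injectively on all \<open>D\<close>-translates; this is a homomorphism to \<open>H\<^sub>D\<^sub>,\<^sub>n\<close>. From (2) to (1),
  \<open>Free(2\<^sup>\<Gamma>)\<close> is Polish and can be copied onto a set of reals.
\<close>

section \<open>Finitary rules\<close>

context group
begin

text \<open>Two orders of quantification shape the proof. Compactness needs the sets
  \<open>T\<close> for all \<gamma> to be fixed first, and only then yields the number
  \<open>m\<close> of conditions that matter. So a stage must choose its sets uniformly in the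
  number \<open>N\<close> of colors, in the free positions and in the values already written; and
  the \<open>N\<close> reached by color reduction may depend only on the size of the conflict set,
  never on \<open>n i\<close>. All dependence of the final window on \<open>n i\<close> then sits in
  one exponent, \<open>2 * log_star (n i)\<close>, over a fixed finite set. Each \<gamma> has to be
  witnessed at every \<open>g\<close>, but only sparse markers write strings. Moving from
  \<open>g\<close> to a marker \<open>\<alpha> \<otimes> g\<close> replaces \<gamma> by its
  conjugate by \<alpha>; the elements \<beta> are these conjugates. Since later stages may write
  anything at the markers, both positions of a witness have to avoid \<open>M\<close>. The factor 2
  in the exponent bounding \<open>n i\<close> pays for greedy coloring with the quotients of
  \<open>D\<close> as conflicts.\<close>

definition local_rule :: "'a set \<Rightarrow> (('a \<Rightarrow> 'x) \<Rightarrow> 'a \<Rightarrow> 'y) \<Rightarrow> bool" where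
  "local_rule U \<Psi> \<longleftrightarrow>
     (\<forall>c c'. \<forall>g\<in>carrier G. \<forall>g'\<in>carrier G. (\<forall>u\<in>U. c (u \<otimes> g) = c' (u \<otimes> g')) \<longrightarrow> \<Psi> c g = \<Psi> c' g')"

text \<open>Comparing two colorings at two positions makes \<open>local_rule\<close> express
  locality and equivariance under right translation in one clause. \<open>finitary\<close> forgets
  the window: inside a stage only its finiteness matters, and explicit windows are followed where
  the number of reduction rounds enters.\<close>

definition finitary :: "(('a \<Rightarrow> 'x) \<Rightarrow> 'a \<Rightarrow> 'y) \<Rightarrow> bool" where
  "finitary \<Psi> \<longleftrightarrow> (\<exists>U. finite U \<and> U \<subseteq> carrier G \<and> local_rule U \<Psi>)"

lemma local_ruleD:
  "local_rule U \<Psi> \<Longrightarrow> g \<in> carrier G \<Longrightarrow> g' \<in> carrier G \<Longrightarrow>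
    (\<And>u. u \<in> U \<Longrightarrow> c (u \<otimes> g) = c' (u \<otimes> g')) \<Longrightarrow> \<Psi> c g = \<Psi> c' g'"
  unfolding local_rule_def by blast

lemma local_rule_mono: "local_rule U \<Psi> \<Longrightarrow> U \<subseteq> U' \<Longrightarrow> local_rule U' \<Psi>"
  unfolding local_rule_def by (meson subset_eq)

section \<open>Closure properties of finitary rules\<close>

lemma finitary_self: "finitary (\<lambda>c g. c g)"
  unfolding finitary_def local_rule_def by (intro exI[of _ "{\<one>}"]) auto

lemma finitary_const: "finitary (\<lambda>c g. k)"
  unfolding finitary_def local_rule_def by (intro exI[of _ "{}"]) auto

lemma finitary_app1: "finitary A \<Longrightarrow> finitary (\<lambda>c g. f (A c g))"
  unfolding finitary_def local_rule_def by metis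

lemma finitary_app2:
  assumes "finitary A" "finitary B"
  shows "finitary (\<lambda>c g. f (A c g) (B c g))"
proof -
  obtain U V where "finite U" "U \<subseteq> carrier G" "local_rule U A"
    and "finite V" "V \<subseteq> carrier G" "local_rule V B"
    using assms unfolding finitary_def by blast
  moreover have "local_rule (U \<union> V) A" "local_rule (U \<union> V) B"
    using calculation by (blast intro: local_rule_mono)+
  then have "local_rule (U \<union> V) (\<lambda>c g. f (A c g) (B c g))"
    unfolding local_rule_def by metis
  ultimately show ?thesis
    unfolding finitary_def by (metis Un_subset_iff finite_UnI)
qed

text \<open>The outer rule at \<open>g\<close> asks for the inner one at
  \<open>v \<otimes> g\<close>, which reads \<open>u \<otimes> v \<otimes> g\<close>; hence the
  window of the inner rule is the left factor.\<close>

lemma local_rule_comp: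
  fixes \<Phi> :: "('a \<Rightarrow> 'x) \<Rightarrow> 'a \<Rightarrow> 'y" and \<Psi> :: "('a \<Rightarrow> 'y) \<Rightarrow> 'a \<Rightarrow> 'z"
  assumes "local_rule U \<Phi>" "local_rule V \<Psi>" "U \<subseteq> carrier G" "V \<subseteq> carrier G"
  shows "local_rule (U <#> V) (\<lambda>c. \<Psi> (\<Phi> c))"
  unfolding local_rule_def
proof (intro allI ballI impI)
  fix c c' :: "'a \<Rightarrow> 'x" and g g'
  assume g: "g \<in> carrier G" "g' \<in> carrier G"
    and eq: "\<forall>w\<in>U <#> V. c (w \<otimes> g) = c' (w \<otimes> g')"
  show "\<Psi> (\<Phi> c) g = \<Psi> (\<Phi> c') g'"
  proof (rule local_ruleD[OF assms(2) g])
    fix v assume v: "v \<in> V"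
    have vc: "v \<in> carrier G" using assms(4) v by blast
    show "\<Phi> c (v \<otimes> g) = \<Phi> c' (v \<otimes> g')"
    proof (rule local_ruleD[OF assms(1)])
      fix u assume u: "u \<in> U"
      then have "u \<otimes> v \<in> U <#> V" "u \<in> carrier G" using v assms(3) by (auto simp: set_mult_def)
      then show "c (u \<otimes> (v \<otimes> g)) = c' (u \<otimes> (v \<otimes> g'))"
        using eq vc g by (metis m_assoc)
    qed (use vc g in auto)
  qed
qed

lemma finite_set_mult: "finite U \<Longrightarrow> finite V \<Longrightarrow> finite (U <#> V)"
  unfolding set_mult_def by auto

lemma finitary_comp:
  assumes "finitary \<Phi>" "finitary \<Psi>"
  shows "finitary (\<lambda>c. \<Psi> (\<Phi> c))"
proof -
  obtain U V where "finite U" "U \<subseteq> carrier G" "local_rule U \<Phi>"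
    and "finite V" "V \<subseteq> carrier G" "local_rule V \<Psi>"
    using assms unfolding finitary_def by blast
  then show ?thesis
    unfolding finitary_def
    by (intro exI[of _ "U <#> V"]) (simp add: local_rule_comp finite_set_mult set_mult_closed)
qed

lemma finitary_translate:
  assumes "finitary A" "e \<in> carrier G"
  shows "finitary (\<lambda>c g. A c (e \<otimes> g))"
proof -
  have "finitary (\<lambda>c g. c (e \<otimes> g))"
    unfolding finitary_def local_rule_def using assms(2) by (intro exI[of _ "{e}"]) auto
  from finitary_comp[OF assms(1) this] show ?thesis .
qed

text \<open>Packing finitely many rules into one rule with function values reduces every quantifier
  or filter over \<open>E\<close> to a pointwise operation, hence to
  \<open>finitary_app1\<close>.\<close>

lemma finitary_family:
  assumes "finite E" "\<And>e. e \<in> E \<Longrightarrow> finitary (A e)"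
  shows "finitary (\<lambda>c g. \<lambda>e\<in>E. A e c g)"
  using assms
proof (induction E)
  case empty
  show ?case by (simp add: finitary_const)
next
  case (insert x E)
  have "(\<lambda>e\<in>insert x E. A e c g) = (\<lambda>e\<in>E. A e c g)(x := A x c g)" for c g
    by (auto simp: fun_eq_iff)
  moreover have "finitary (\<lambda>c g. (\<lambda>e\<in>E. A e c g)(x := A x c g))"
    by (rule finitary_app2[where f = "\<lambda>f v. f(x := v)"]) (use insert.IH insert.prems in blast)+
  ultimately show ?case by (simp only:)
qed

lemma finitary_Bex:
  assumes "finite E" "\<And>e. e \<in> E \<Longrightarrow> finitary (A e)"
  shows "finitary (\<lambda>c g. \<exists>e\<in>E. A e c g)"
  using finitary_app1[OF finitary_family[OF assms], where f = "\<lambda>f. \<exists>e\<in>E. f e"] by simp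

lemma finitary_Ball:
  assumes "finite E" "\<And>e. e \<in> E \<Longrightarrow> finitary (A e)"
  shows "finitary (\<lambda>c g. \<forall>e\<in>E. A e c g)"
  using finitary_app1[OF finitary_family[OF assms], where f = "\<lambda>f. \<forall>e\<in>E. f e"] by simp

lemma finitary_filter:
  assumes "finite E" "\<And>e. e \<in> E \<Longrightarrow> finitary (A e)"
  shows "finitary (\<lambda>c g. {e \<in> E. A e c g})"
proof -
  have "finitary (\<lambda>c g. {e \<in> E. (\<lambda>e\<in>E. A e c g) e})"
    by (rule finitary_app1[where f = "\<lambda>f. {e \<in> E. f e}"]) (rule finitary_family[OF assms])
  moreover have "{e \<in> E. (\<lambda>e\<in>E. A e c g) e} = {e \<in> E. A e c g}" for c g
    by auto
  ultimately show ?thesis by (simp only:)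
qed

text \<open>Values are chosen in increasing order of the color \<open>z g < N\<close>; the number of colors bounds
  the depth of the recursion, which keeps the resulting rule finitary.\<close>

lemma finitary_greedy:
  fixes S :: "('a \<Rightarrow> nat) \<Rightarrow> 'a \<Rightarrow> 's" and OK :: "('a \<Rightarrow> nat \<times> 's \<times> 'v) \<Rightarrow> 'a \<Rightarrow> 'v set"
  assumes S: "finitary S" and OK: "finitary OK"
    and mask: "\<And>z s a a' g. g \<in> carrier G \<Longrightarrow> (\<And>h. h \<in> carrier G \<Longrightarrow> z h < z g \<Longrightarrow> a h = a' h) \<Longrightarrow>
      OK (\<lambda>h. (z h, s h, a h)) g = OK (\<lambda>h. (z h, s h, a' h)) g"
  shows "\<exists>A :: ('a \<Rightarrow> nat) \<Rightarrow> 'a \<Rightarrow> 'v. finitary A \<and>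
    (\<forall>z. (\<forall>h\<in>carrier G. z h < N) \<longrightarrow> (\<forall>g\<in>carrier G.
       OK (\<lambda>h. (z h, S z h, A z h)) g \<noteq> {} \<longrightarrow> A z g \<in> OK (\<lambda>h. (z h, S z h, A z h)) g))"
proof -
  \<comment> \<open>\<open>A t\<close> is the \<open>t\<close>-th round of simultaneous updating,
    started from junk values. It is final at \<open>g\<close> as soon as \<open>t > z g\<close>,
    since \<open>OK\<close> reads only values at smaller colors.\<close>
  define A :: "nat \<Rightarrow> ('a \<Rightarrow> nat) \<Rightarrow> 'a \<Rightarrow> 'v" where
    "A = rec_nat (\<lambda>z g. undefined) (\<lambda>t a z g. SOME v. v \<in> OK (\<lambda>h. (z h, S z h, a z h)) g)"
  have A_Suc: "A (Suc t) z g = (SOME v. v \<in> OK (\<lambda>h. (z h, S z h, A t z h)) g)" for t z g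
    by (simp add: A_def)
  have fin: "finitary (A t)" for t
  proof (induction t)
    case 0
    show ?case by (simp add: A_def finitary_const)
  next
    case (Suc t)
    have "finitary (\<lambda>z h. (z h, S z h, A t z h))"
      by (rule finitary_app2[OF finitary_self finitary_app2[OF S Suc]])
    from finitary_app1[OF finitary_comp[OF this OK], of "\<lambda>s. SOME v. v \<in> s"]
    show ?case by (simp add: A_Suc[abs_def])
  qed
  have stable: "A t z g = A t' z g" if "g \<in> carrier G" "z g < t" "z g < t'" for t t' z g
    using that
  proof (induction "z g" arbitrary: g t t' rule: less_induct)
    case less
    obtain r r' where r: "t = Suc r" "t' = Suc r'" using less.prems by (metis less_nat_zero_code not0_implies_Suc)
    have "A r z h = A r' z h" if "h \<in> carrier G" "z h < z g" for h
      using less.hyps[of h r r'] that less.prems r by simp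
    from mask[OF less.prems(1) this] show ?case by (simp add: A_Suc r)
  qed
  have "A N z g \<in> OK (\<lambda>h. (z h, S z h, A N z h)) g"
    if "\<forall>h\<in>carrier G. z h < N" "g \<in> carrier G" "OK (\<lambda>h. (z h, S z h, A N z h)) g \<noteq> {}" for z g
  proof -
    \<comment> \<open>One further round changes nothing at colors below \<open>N\<close>, so round
      \<open>N\<close> satisfies its own defining condition.\<close>
    have "A N z g = A (Suc N) z g" using stable that by (simp add: less_SucI)
    also have "\<dots> \<in> OK (\<lambda>h. (z h, S z h, A N z h)) g"
      using that(3) by (simp add: A_Suc some_in_eq)
    finally show ?thesis .
  qed
  with fin show ?thesis by blast
qed

end

section \<open>Color reduction\<close>

lemma poly_less_power_two: "\<forall>\<^sub>F s in sequentially. c * (s + 1) ^ d < 2 ^ (s::nat)"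
proof -
  have "((\<lambda>s. real c * (real s + 1) ^ d / 2 ^ s) \<longlongrightarrow> 0) sequentially"
    by real_asymp
  then have "\<forall>\<^sub>F s in sequentially. real c * (real s + 1) ^ d / 2 ^ s < 1"
    by (rule order_tendstoD) simp
  then show ?thesis
  proof eventually_elim
    case (elim s)
    then have "real (c * (s + 1) ^ d) < real (2 ^ s)"
      by (simp add: field_simps)
    then show ?case by linarith
  qed
qed

context group
begin

section \<open>Proper colorings and powers of finite sets\<close>

definition proper :: "'a set \<Rightarrow> nat \<Rightarrow> ('a \<Rightarrow> nat) \<Rightarrow> bool" where
  "proper K n c \<longleftrightarrow> (\<forall>g\<in>carrier G. c g < n \<and> (\<forall>\<kappa>\<in>K. \<kappa> \<noteq> \<one> \<longrightarrow> c (\<kappa> \<otimes> g) \<noteq> c g))"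

lemma proper_mono: "proper K n c \<Longrightarrow> K' \<subseteq> K \<Longrightarrow> n \<le> n' \<Longrightarrow> proper K' n' c"
  unfolding proper_def by (meson less_le_trans subsetD)

lemma set_pow_closed: "K \<subseteq> carrier G \<Longrightarrow> set_pow G K m \<subseteq> carrier G"
  by (induction m) (auto simp: set_mult_closed)

lemma one_in_set_pow: "\<one> \<in> K \<Longrightarrow> \<one> \<in> set_pow G K m"
  by (induction m) (auto simp: set_mult_def intro!: bexI[of _ \<one>])

lemma finite_set_pow: "finite K \<Longrightarrow> finite (set_pow G K m)"
  by (induction m) (auto simp: finite_set_mult)

lemma set_pow_add:
  "K \<subseteq> carrier G \<Longrightarrow> set_pow G K (m + l) = set_pow G K m <#> set_pow G K l"
proof (induction m)
  case 0
  have "{\<one>} <#> set_pow G K l = set_pow G K l"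
    using set_pow_closed[OF 0, of l] by (auto simp: set_mult_def subset_iff)
  then show ?case by simp
next
  case (Suc m)
  then show ?case by (simp add: set_mult_assoc set_pow_closed)
qed

lemma set_pow_mult: "K \<subseteq> carrier G \<Longrightarrow> set_pow G (set_pow G K m) l = set_pow G K (m * l)"
  by (induction l) (simp_all add: set_pow_add)

lemma set_pow_mono: "K \<subseteq> K' \<Longrightarrow> set_pow G K m \<subseteq> set_pow G K' m"
  by (induction m) (auto simp: set_mult_def)

lemma set_pow_mono_exp:
  assumes "K \<subseteq> carrier G" "\<one> \<in> K" "m \<le> l"
  shows "set_pow G K m \<subseteq> set_pow G K l"
proof -
  have "\<one> \<in> set_pow G K (l - m)" using assms(2) by (rule one_in_set_pow)
  moreover have "set_pow G K l = set_pow G K m <#> set_pow G K (l - m)"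
    using set_pow_add[OF assms(1), of m "l - m"] assms(3) by simp
  moreover have "x = x \<otimes> \<one>" if "x \<in> set_pow G K m" for x
    using set_pow_closed[OF assms(1), of m] that by (simp add: subset_iff)
  ultimately show ?thesis unfolding set_mult_def by blast
qed

lemma set_pow_in_mult:
  "K \<subseteq> carrier G \<Longrightarrow> x \<in> set_pow G K m \<Longrightarrow> y \<in> set_pow G K l \<Longrightarrow> x \<otimes> y \<in> set_pow G K (m + l)"
  by (auto simp: set_pow_add set_mult_def)

lemma set_pow_one: "K \<subseteq> carrier G \<Longrightarrow> set_pow G K 1 = K"
  by (auto simp: set_mult_def subset_iff)

lemma card_set_mult_le: "finite A \<Longrightarrow> finite B \<Longrightarrow> card (A <#> B) \<le> card A * card B"
proof -
  assume f: "finite A" "finite B"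
  have "A <#> B = (\<lambda>(a, b). a \<otimes> b) ` (A \<times> B)" by (auto simp: set_mult_def)
  then show ?thesis by (metis card_cartesian_product card_image_le f finite_cartesian_product)
qed

lemma card_set_pow_le: "finite K \<Longrightarrow> card (set_pow G K m) \<le> card K ^ m"
proof (induction m)
  case (Suc m)
  then show ?case
    using card_set_mult_le[OF Suc.prems finite_set_pow[OF Suc.prems, of m]]
    by (simp add: le_trans)
qed simp

text \<open>One round of Cole and Vishkin's color reduction: \<open>g\<close> records, for every \<open>\<kappa> \<in> K\<close>, an index at
  which the binary expansions of the colors of \<open>g\<close> and \<open>\<kappa> g\<close> differ, along with its own bit there.\<close>

lemma color_reduction_round:
  assumes K: "finite K" "K \<subseteq> carrier G" and b: "n \<le> 2 ^ b" "b \<ge> 1"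
  obtains \<Psi> :: "('a \<Rightarrow> nat) \<Rightarrow> 'a \<Rightarrow> nat" where "local_rule (insert \<one> K) \<Psi>"
    "\<And>c. proper K n c \<Longrightarrow> proper K ((2 * b) ^ card K) (\<Psi> c)"
proof -
  define K' where "K' = K - {\<one>}"
  define ix where "ix x y = (LEAST i. bit x i \<noteq> bit y i)" for x y :: nat
  have ix: "bit x (ix x y) \<noteq> bit y (ix x y) \<and> ix x y < b" if "x < n" "y < n" "x \<noteq> y" for x y
  proof -
    have lt: "x < 2 ^ b" "y < 2 ^ b" using that b by auto
    obtain i where i: "bit x i \<noteq> bit y i" using \<open>x \<noteq> y\<close> by (auto simp: bit_eq_iff)
    then have d: "bit x (ix x y) \<noteq> bit y (ix x y)" unfolding ix_def by (rule LeastI)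
    have "ix x y < b"
    proof (rule ccontr)
      assume "\<not> ix x y < b"
      then have "(2::nat) ^ b \<le> 2 ^ ix x y" by simp
      then have "x < 2 ^ ix x y" "y < 2 ^ ix x y" using lt by (meson less_le_trans)+
      then show False using d by (simp add: bit_iff_odd)
    qed
    with d show ?thesis by blast
  qed
  have fin: "finite (K' \<rightarrow>\<^sub>E {..<2 * b})" using K by (simp add: K'_def finite_PiE)
  have card: "card (K' \<rightarrow>\<^sub>E {..<2 * b}) \<le> (2 * b) ^ card K"
  proof -
    have "card K' \<le> card K" using K by (simp add: K'_def card_mono)
    then have "(2 * b) ^ card K' \<le> (2 * b) ^ card K" using b by (intro power_increasing) auto
    then show ?thesis using K by (simp add: K'_def card_PiE)
  qed
  obtain e where e: "bij_betw e (K' \<rightarrow>\<^sub>E {..<2 * b}) {0..<card (K' \<rightarrow>\<^sub>E {..<2 * b})}"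
    using ex_bij_betw_finite_nat[OF fin] by blast
  \<comment> \<open>\<open>2 * index + bit\<close> codes the pair by a number below
    \<open>2 * b\<close>. The identity is left out of \<open>K'\<close>, because a color does not
    differ from itself at any bit.\<close>
  define \<tau> where "\<tau> c g = (\<lambda>\<kappa>\<in>K'. 2 * ix (c g) (c (\<kappa> \<otimes> g)) + of_bool (bit (c g) (ix (c g) (c (\<kappa> \<otimes> g)))))"
    for c :: "'a \<Rightarrow> nat" and g
  define \<Psi> where "\<Psi> c g = e (\<tau> c g)" for c g
  have "local_rule (insert \<one> K) \<Psi>"
    unfolding local_rule_def
  proof (intro allI ballI impI)
    fix c c' :: "'a \<Rightarrow> nat" and g g'
    assume g: "g \<in> carrier G" "g' \<in> carrier G" and eq: "\<forall>u\<in>insert \<one> K. c (u \<otimes> g) = c' (u \<otimes> g')"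
    have "c g = c' g'" using eq g by auto
    then have "\<tau> c g = \<tau> c' g'" using eq by (auto simp: \<tau>_def K'_def fun_eq_iff)
    then show "\<Psi> c g = \<Psi> c' g'" by (simp add: \<Psi>_def)
  qed
  moreover have "proper K ((2 * b) ^ card K) (\<Psi> c)" if c: "proper K n c" for c
  proof -
    have cn: "c g < n" if "g \<in> carrier G" for g using c that by (simp add: proper_def)
    have cne: "c (\<kappa> \<otimes> g) \<noteq> c g" if "\<kappa> \<in> K'" "g \<in> carrier G" for \<kappa> g
      using c that by (simp add: proper_def K'_def)
    have K'c: "\<kappa> \<otimes> g \<in> carrier G" if "\<kappa> \<in> K'" "g \<in> carrier G" for \<kappa> g
      using that K by (auto simp: K'_def)
    have ixb: "bit (c g) (ix (c g) (c (\<kappa> \<otimes> g))) \<noteq> bit (c (\<kappa> \<otimes> g)) (ix (c g) (c (\<kappa> \<otimes> g)))"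
      "ix (c g) (c (\<kappa> \<otimes> g)) < b" if "\<kappa> \<in> K'" "g \<in> carrier G" for \<kappa> g
      using ix[of "c g" "c (\<kappa> \<otimes> g)"] cn cne[OF that] K'c[OF that] that by auto
    have \<tau>: "\<tau> c g \<in> K' \<rightarrow>\<^sub>E {..<2 * b}" if "g \<in> carrier G" for g
    proof -
      have "2 * ix (c g) (c (\<kappa> \<otimes> g)) + of_bool (bit (c g) (ix (c g) (c (\<kappa> \<otimes> g)))) < 2 * b"
        if "\<kappa> \<in> K'" for \<kappa>
        using ixb(2)[OF that \<open>g \<in> carrier G\<close>] by (simp add: of_bool_def)
      then show ?thesis by (simp add: \<tau>_def)
    qed
    have "\<Psi> c g < (2 * b) ^ card K" if "g \<in> carrier G" for g
      using bij_betwE[OF e] \<tau>[OF that] card unfolding \<Psi>_def by fastforce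
    moreover have "\<Psi> c (\<kappa> \<otimes> g) \<noteq> \<Psi> c g" if \<kappa>: "\<kappa> \<in> K" "\<kappa> \<noteq> \<one>" and g: "g \<in> carrier G" for \<kappa> g
    proof
      have \<kappa>': "\<kappa> \<in> K'" using \<kappa> by (simp add: K'_def)
      note h = K'c[OF \<kappa>' g]
      assume "\<Psi> c (\<kappa> \<otimes> g) = \<Psi> c g"
      then have "\<tau> c (\<kappa> \<otimes> g) = \<tau> c g"
        using e \<tau>[OF g] \<tau>[OF h] unfolding \<Psi>_def by (metis bij_betw_def inj_onD)
      \<comment> \<open>Coordinate \<kappa> alone gives the contradiction: index and bit agree for
        \<open>g\<close> and \<open>\<kappa> \<otimes> g\<close>, but the index recorded by
        \<open>g\<close> is one where exactly these two colors differ.\<close>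
      then have "\<tau> c (\<kappa> \<otimes> g) \<kappa> = \<tau> c g \<kappa>" by simp
      moreover have "x = y \<and> p = q" if "2 * x + of_bool p = 2 * y + (of_bool q :: nat)" for x y p q
        using that by (cases p; cases q; simp; presburger)
      ultimately show False
        using \<kappa>' ixb(1)[OF \<kappa>' g] unfolding \<tau>_def restrict_apply if_P[OF \<kappa>'] by metis
    qed
    ultimately show ?thesis by (simp add: proper_def)
  qed
  ultimately show ?thesis using that by blast
qed

abbreviation log_reduces :: "'a set \<Rightarrow> nat \<Rightarrow> bool" where
  "log_reduces K n \<equiv> \<exists>\<Psi> n'. local_rule (insert \<one> K <#> insert \<one> K) \<Psi> \<and> real n' \<le> log 2 (real n) \<and>
     (\<forall>c. proper K n c \<longrightarrow> proper K n' (\<Psi> c))"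

text \<open>One round leaves about \<open>(2 * log n) ^ d\<close> colors, which need not be below
  \<open>log n\<close>; a second one leaves a power of \<open>log log n\<close>. So two rounds pay
  for one logarithm, beyond a threshold that depends on \<open>d\<close> only.\<close>

lemma color_reduction_two_rounds:
  fixes d :: nat
  obtains N where
    "\<And>K n. finite K \<Longrightarrow> K \<subseteq> carrier G \<Longrightarrow> card K = d \<Longrightarrow> n > N \<Longrightarrow>
       log_reduces K n"
proof -
  obtain a0 where a0: "\<And>a. a \<ge> a0 \<Longrightarrow> (2 * (2 * (d + 1)) ^ d) * (a + 1) ^ d < 2 ^ (a::nat)"
    using poly_less_power_two[of "2 * (2 * (d + 1)) ^ d" d] unfolding eventually_sequentially by blast
  \<comment> \<open>Two exponentials, so that \<open>n > N\<close> forces \<open>a > a0 + 1\<close>,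
    where \<open>b\<close> and \<open>a\<close> will be the rounded-up logarithms of
    \<open>n\<close> and of \<open>b\<close>.\<close>
  define N :: nat where "N = 2 ^ 2 ^ (a0 + 1)"
  have "log_reduces K n"
    if K: "finite K" "K \<subseteq> carrier G" "card K = d" and n: "n > N" for K n
  proof -
    have ex: "\<exists>b. m \<le> 2 ^ b" for m :: nat by (meson less_exp less_imp_le)
    define b where "b = (LEAST b. n \<le> 2 ^ b)"
    define a where "a = (LEAST a. b \<le> 2 ^ a)"
    have b: "n \<le> 2 ^ b" unfolding b_def by (rule LeastI_ex[OF ex])
    have a: "b \<le> 2 ^ a" unfolding a_def by (rule LeastI_ex[OF ex])
    have "(2::nat) ^ 2 ^ (a0 + 1) < 2 ^ b" using n b unfolding N_def by linarith
    then have bgt: "2 ^ (a0 + 1) < b" by (metis one_less_numeral_iff power_strict_increasing_iff semiring_norm(76))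
    then have "(2::nat) ^ (a0 + 1) < 2 ^ a" using a by linarith
    then have agt: "a0 + 1 < a" by (metis one_less_numeral_iff power_strict_increasing_iff semiring_norm(76))
    have b1: "2 ^ (b - 1) < n"
      using not_less_Least[of "b - 1" "\<lambda>b. n \<le> 2 ^ b"] bgt unfolding b_def[symmetric] by linarith
    have a1: "2 ^ (a - 1) < b"
      using not_less_Least[of "a - 1" "\<lambda>a. b \<le> 2 ^ a"] agt unfolding a_def[symmetric] by linarith
    \<comment> \<open>\<open>d + 1\<close> instead of \<open>d\<close> keeps \<open>b'\<close>
      positive for empty \<open>K\<close>, as a round requires.\<close>
    define b' where "b' = (a + 1) * (d + 1)"
    have "(2 * b) ^ d \<le> (2 ^ (a + 1)) ^ d" using a by (intro power_mono) auto
    also have "\<dots> \<le> 2 ^ b'" unfolding b'_def power_mult[symmetric] by (intro power_increasing) auto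
    finally have b': "(2 * b) ^ d \<le> 2 ^ b'" .
    have "2 * (2 * b') ^ d = (2 * (2 * (d + 1)) ^ d) * (a + 1) ^ d"
      unfolding b'_def by (simp add: power_mult_distrib[symmetric] algebra_simps)
    also have "\<dots> < 2 ^ a" using a0 agt by simp
    also have "\<dots> = 2 * 2 ^ (a - 1)" using agt by (metis Suc_diff_1 less_nat_zero_code power_Suc zero_less_iff_neq_zero)
    \<comment> \<open>The target is \<open>b - 1\<close>, which lies below the logarithm of
      \<open>n\<close> by minimality of \<open>b\<close>, whereas \<open>b\<close> itself is rounded
      up.\<close>
    finally have le: "(2 * b') ^ d \<le> b - 1" using a1 by linarith
    obtain \<Phi> where \<Phi>: "local_rule (insert \<one> K) \<Phi>"
      "\<And>c. proper K n c \<Longrightarrow> proper K ((2 * b) ^ card K) (\<Phi> c)"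
      using color_reduction_round[OF K(1,2) b] bgt by (metis One_nat_def Suc_leI less_nat_zero_code neq0_conv)
    obtain \<Psi> where \<Psi>: "local_rule (insert \<one> K) \<Psi>"
      "\<And>c. proper K ((2 * b) ^ d) c \<Longrightarrow> proper K ((2 * b') ^ card K) (\<Psi> c)"
      using color_reduction_round[OF K(1,2) b'] by (auto simp: b'_def)
    have "real (b - 1) \<le> log 2 (real n)"
    proof -
      have "2 powr real (b - 1) \<le> real n"
        using b1 by (simp add: powr_realpow)
      moreover have "n > 0" using n by simp
      ultimately show ?thesis by (simp add: le_log_iff)
    qed
    moreover have "local_rule (insert \<one> K <#> insert \<one> K) (\<lambda>c. \<Psi> (\<Phi> c))"
      using local_rule_comp[OF \<Phi>(1) \<Psi>(1)] K by simp
    moreover have "proper K (b - 1) (\<Psi> (\<Phi> c))" if "proper K n c" for c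
      using proper_mono[OF \<Psi>(2)[OF \<Phi>(2)[OF that, unfolded K(3)]] order_refl] le K(3) by simp
    ultimately show ?thesis by blast
  qed
  with that show ?thesis by blast
qed

text \<open>\<open>log 2\<close> is monotone on positive arguments only, so the two sequences of
  iterates cannot be compared to the end; the one with the smaller start stops once it is at most 1,
  possibly before \<open>m\<close>.\<close>

lemma iterated_log_mono:
  assumes "(log 2 ^^ m) b \<le> 1" "a \<le> b"
  shows "\<exists>m'\<le>m. (log 2 ^^ m') a \<le> 1"
  using assms
proof (induction m arbitrary: a b)
  case 0
  then show ?case by auto
next
  case (Suc m)
  show ?case
  proof (cases "a \<le> 1")
    case True
    then show ?thesis by (intro exI[of _ 0]) simp
  next
    case False
    then have "log 2 a \<le> log 2 b" using Suc.prems by simp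
    moreover have "(log 2 ^^ m) (log 2 b) \<le> 1" using Suc.prems by (simp add: funpow_swap1)
    ultimately obtain m' where "m' \<le> m" "(log 2 ^^ m') (log 2 a) \<le> 1" using Suc.IH by blast
    then show ?thesis by (intro exI[of _ "Suc m'"]) (simp add: funpow_swap1)
  qed
qed

abbreviation reduces :: "'a set \<Rightarrow> nat \<Rightarrow> nat \<Rightarrow> nat \<Rightarrow> bool" where
  "reduces K m n N \<equiv> \<exists>\<Psi>. local_rule (set_pow G (insert \<one> K) (2 * m)) \<Psi> \<and>
     (\<forall>c. proper K n c \<longrightarrow> proper K N (\<Psi> c))"

text \<open>Each logarithm costs two rounds, whence the exponent \<open>2 * m\<close> of the window.
  The final number of colors depends on the size of \<open>K\<close> alone; thus the greedy rules,
  whose windows grow with the number of colors, can be fixed before \<open>n\<close>.\<close>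

lemma color_reduction:
  fixes d :: nat
  obtains N where
    "\<And>K n m. finite K \<Longrightarrow> K \<subseteq> carrier G \<Longrightarrow> card K = d \<Longrightarrow> (log 2 ^^ m) (real n) \<le> 1 \<Longrightarrow>
       reduces K m n N"
proof -
  obtain N where N: "\<And>K n. finite K \<Longrightarrow> K \<subseteq> carrier G \<Longrightarrow> card K = d \<Longrightarrow> n > N \<Longrightarrow>
       log_reduces K n"
    using color_reduction_two_rounds[of d] by blast
  \<comment> \<open>At least 1, so that the base case \<open>n \<le> 1\<close> is covered and
    \<open>n > N'\<close> leaves a logarithm to spend.\<close>
  define N' where "N' = max N 1"
  have main: "reduces K m n N'"
    if K: "finite K" "K \<subseteq> carrier G" "card K = d" and "\<exists>m'\<le>m. (log 2 ^^ m') (real n) \<le> 1" for K n m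
    using that(4)
  proof (induction m arbitrary: n)
    case 0
    then have "n \<le> N'" by (simp add: N'_def)
    then have "\<forall>c. proper K n c \<longrightarrow> proper K N' c" using proper_mono by blast
    moreover have "local_rule (set_pow G (insert \<one> K) (2 * 0)) (\<lambda>c g. c g)"
      by (auto simp: local_rule_def)
    ultimately show ?case by blast
  next
    case (Suc m)
    have Kc: "insert \<one> K \<subseteq> carrier G" using K by simp
    show ?case
    proof (cases "n \<le> N'")
      case True
      \<comment> \<open>With few colors the identity rule does it; it is local because the window
        contains \<one>.\<close>
      have "local_rule (set_pow G (insert \<one> K) (2 * Suc m)) (\<lambda>c g. c g)"
        using one_in_set_pow[of "insert \<one> K" "2 * Suc m"]
        by (auto simp: local_rule_def simp del: set_pow.simps mult_Suc_right dest: bspec[of _ _ \<one>])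
      moreover have "\<forall>c. proper K n c \<longrightarrow> proper K N' c" using proper_mono True by blast
      ultimately show ?thesis by blast
    next
      case False
      then have n: "n > N" "n > 1" by (simp_all add: N'_def)
      obtain m' where m': "m' \<le> Suc m" "(log 2 ^^ m') (real n) \<le> 1" using Suc.prems by blast
      then obtain l where l: "m' = Suc l" using n(2) by (cases m') auto
      obtain \<Phi> n' where \<Phi>: "local_rule (insert \<one> K <#> insert \<one> K) \<Phi>" "real n' \<le> log 2 (real n)"
        "\<And>c. proper K n c \<Longrightarrow> proper K n' (\<Phi> c)"
        using N[OF K n(1)] by blast
      have "(log 2 ^^ l) (log 2 (real n)) \<le> 1" using m'(2) l by (simp add: funpow_swap1)
      from iterated_log_mono[OF this \<Phi>(2)]
      have "\<exists>m'\<le>m. (log 2 ^^ m') (real n') \<le> 1" using m'(1) l by (metis Suc_le_mono le_trans)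
      from Suc.IH[OF this] obtain \<Psi> where \<Psi>: "local_rule (set_pow G (insert \<one> K) (2 * m)) \<Psi>"
        "\<And>c. proper K n' c \<Longrightarrow> proper K N' (\<Psi> c)" by blast
      have "local_rule ((insert \<one> K <#> insert \<one> K) <#> set_pow G (insert \<one> K) (2 * m)) (\<lambda>c. \<Psi> (\<Phi> c))"
        by (rule local_rule_comp[OF \<Phi>(1) \<Psi>(1)]) (use Kc in \<open>auto simp: set_mult_closed set_pow_closed\<close>)
      moreover have "(insert \<one> K <#> insert \<one> K) <#> set_pow G (insert \<one> K) (2 * m)
          = set_pow G (insert \<one> K) (2 * Suc m)"
        using Kc by (simp add: set_mult_assoc set_pow_closed)
      ultimately show ?thesis using \<Psi>(2) \<Phi>(3) by metis
    qed
  qed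
  show ?thesis
  proof (rule that[of N'])
    fix K and n m :: nat
    assume "finite K" "K \<subseteq> carrier G" "card K = d" "(log 2 ^^ m) (real n) \<le> 1"
    then show "reduces K m n N'"
      using main by blast
  qed
qed

end

text \<open>For \<open>x > 2\<close> the logarithm is at most \<open>x - 1\<close>, so an integer
  bound on \<open>x\<close> drops by one at each step; hence the \<open>LEAST\<close> in
  \<open>log_star\<close> is attained.\<close>

lemma log_star_exists: "\<exists>m. (log 2 ^^ m) x \<le> 1"
proof -
  have *: "\<exists>m. (log 2 ^^ m) x \<le> 1" if "x \<le> real t" for t x
    using that
  proof (induction t arbitrary: x)
    case 0
    then show ?case by (intro exI[of _ 0]) simp
  next
    case (Suc t)
    show ?case
    proof (cases "x \<le> 1")
      case True
      then show ?thesis by (intro exI[of _ 0]) simp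
    next
      case False
      have "log 2 x \<le> real t \<or> log 2 x \<le> 1"
      proof (cases "x \<le> 2")
        case True
        then show ?thesis using False by simp
      next
        case f: False
        have "log 2 x = 1 + log 2 (x / 2)" using f by (simp add: log_divide)
        also have "log 2 (x / 2) = ln (x / 2) / ln 2" by (simp add: log_def)
        \<comment> \<open>The estimate \<open>ln y \<le> y - 1\<close> bounds the numerator at
          \<open>y = x / 2\<close> and gives \<open>ln 2 \<ge> 1 / 2\<close> at
          \<open>y = 1 / 2\<close>.\<close>
        also have "ln (x / 2) / ln 2 \<le> (x / 2 - 1) / (1 / 2)"
          using f ln_le_minus_one[of "x / 2"] ln_le_minus_one[of "1 / 2"]
          by (intro frac_le) (auto simp: ln_div)
        finally show ?thesis using Suc.prems by simp
      qed
      then obtain m where "(log 2 ^^ m) (log 2 x) \<le> 1"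
        using Suc.IH by (metis funpow_0)
      then show ?thesis by (intro exI[of _ "Suc m"]) (simp add: funpow_swap1)
    qed
  qed
  obtain t where "x \<le> real t" using real_arch_simple by blast
  then show ?thesis by (rule *)
qed

lemma log_star: "(log 2 ^^ log_star n) (real n) \<le> 1"
  unfolding log_star_def by (rule LeastI_ex[OF log_star_exists])

text \<open>With exponent at least 1 the power of \<open>F i\<close> contains \<open>F i\<close>,
  and with it all labels.\<close>

lemma log_star_pos: "n \<ge> 2 \<Longrightarrow> log_star n \<ge> 1"
  using log_star[of n] by (cases "log_star n") auto

section \<open>Markers and bundles\<close>

text \<open>Joining \<open>x\<close> to \<open>f x\<close> gives a graph of degree at most two, by
  injectivity; picking a point and discarding it with its neighbours costs at most three. The map
  will be right multiplication by \<beta>, so that bits in the chosen set are compared with bits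
  outside it.\<close>

lemma independent_subset:
  assumes "finite I" "inj_on f I" "\<And>x. x \<in> I \<Longrightarrow> f x \<noteq> x"
  shows "\<exists>J\<subseteq>I. J \<inter> f ` J = {} \<and> card I \<le> 3 * card J"
  using assms
proof (induction "card I" arbitrary: I rule: less_induct)
  case less
  show ?case
  proof (cases "I = {}")
    case True
    then show ?thesis by auto
  next
    case False
    then obtain x where x: "x \<in> I" by blast
    define P where "P = {y \<in> I. f y = x}"
    define I' where "I' = I - ({x, f x} \<union> P)"
    have "card P \<le> 1"
      using card_le_Suc0_iff_eq[of P] less.prems(1,2) by (auto simp: P_def inj_on_def)
    moreover have "card {x, f x} \<le> 2" by (simp add: card_insert_if)
    ultimately have "card ({x, f x} \<union> P) \<le> 3"
      using card_Un_le[of "{x, f x}" P] by linarith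
    then have c: "card I \<le> card I' + 3"
      using diff_card_le_card_Diff[of "{x, f x} \<union> P" I] less.prems(1) by (simp add: I'_def P_def)
    have "I' \<subset> I" using x by (auto simp: I'_def)
    then have "card I' < card I" by (rule psubset_card_mono[OF less.prems(1)])
    have fin': "finite I'" and inj': "inj_on f I'" and fp': "\<And>x. x \<in> I' \<Longrightarrow> f x \<noteq> x"
      using less.prems \<open>I' \<subset> I\<close> by (auto intro: finite_subset inj_on_subset)
    from less.hyps[OF \<open>card I' < card I\<close> this]
    obtain J where J: "J \<subseteq> I'" "J \<inter> f ` J = {}" "card I' \<le> 3 * card J" by blast
    have "x \<notin> J" using J(1) by (auto simp: I'_def)
    then have "card (insert x J) = Suc (card J)"
      using J(1) \<open>I' \<subset> I\<close> less.prems(1) by (meson card_insert_disjoint finite_subset psubset_imp_subset)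
    moreover have "insert x J \<inter> f ` insert x J = {}"
      using J less.prems(3)[OF x] by (auto simp: I'_def P_def)
    moreover have "insert x J \<subseteq> I" using J(1) x by (auto simp: I'_def)
    ultimately show ?thesis using c J(3) by (intro exI[of _ "insert x J"]) auto
  qed
qed

text \<open>Bits in \<open>I\<close> are forced by the others, so bad strings are counted by their
  restriction to \<open>B - I\<close>.\<close>

lemma card_determined_le:
  assumes "finite B" "I \<subseteq> B" "s \<le> card I"
    and "\<And>v v'. v \<subseteq> B \<Longrightarrow> v' \<subseteq> B \<Longrightarrow> bad v \<Longrightarrow> bad v' \<Longrightarrow> v - I = v' - I \<Longrightarrow> v \<inter> I = v' \<inter> I"
  shows "card {v \<in> Pow B. bad v} \<le> 2 ^ (card B - s)"
proof -
  have "inj_on (\<lambda>v. v - I) {v \<in> Pow B. bad v}"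
  proof (rule inj_onI)
    fix v v' assume "v \<in> {v \<in> Pow B. bad v}" "v' \<in> {v \<in> Pow B. bad v}" "v - I = v' - I"
    then have "v \<inter> I = v' \<inter> I" using assms(4)[of v v'] by simp
    then show "v = v'" using \<open>v - I = v' - I\<close> by blast
  qed
  moreover have "(\<lambda>v. v - I) ` {v \<in> Pow B. bad v} \<subseteq> Pow (B - I)" by auto
  ultimately have "card {v \<in> Pow B. bad v} \<le> card (Pow (B - I))"
    by (rule card_inj_on_le) (use assms(1) in simp)
  also have "\<dots> = 2 ^ (card B - card I)"
    using assms by (simp add: card_Pow card_Diff_subset finite_subset)
  also have "\<dots> \<le> 2 ^ (card B - s)" using assms(3) by (intro power_increasing) auto
  finally show ?thesis .
qed

text \<open>A union bound: each constraint excludes at most one string in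
  \<open>2 ^ s\<close>.\<close>

lemma avoid_bad_subsets:
  assumes "finite B" "finite C" "s \<le> card B" "card C < 2 ^ s"
    and "\<And>c. c \<in> C \<Longrightarrow> card {v \<in> Pow B. bad c v} \<le> 2 ^ (card B - s)"
  shows "\<exists>v\<subseteq>B. \<forall>c\<in>C. \<not> bad c v"
proof (rule ccontr)
  assume "\<not> ?thesis"
  then have "Pow B \<subseteq> (\<Union>c\<in>C. {v \<in> Pow B. bad c v})" by auto
  then have "card (Pow B) \<le> card (\<Union>c\<in>C. {v \<in> Pow B. bad c v})"
    using assms(1,2) by (intro card_mono) auto
  also have "\<dots> \<le> (\<Sum>c\<in>C. card {v \<in> Pow B. bad c v})" by (rule card_UN_le[OF assms(2)])
  also have "\<dots> \<le> card C * 2 ^ (card B - s)" using sum_bounded_above[of C, OF assms(5)] by simp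
  also have "\<dots> < 2 ^ s * 2 ^ (card B - s)" using assms(4) by simp
  also have "\<dots> = 2 ^ card B" using assms(3) by (simp flip: power_add)
  finally show False using assms(1) by (simp add: card_Pow)
qed

context group
begin

section \<open>Syndetic sets and the choice of markers\<close>

definition syndetic :: "'a set \<Rightarrow> ('a \<Rightarrow> bool) \<Rightarrow> bool" where
  "syndetic V R \<longleftrightarrow> (\<forall>g\<in>carrier G. \<exists>v\<in>V. R (v \<otimes> g))"

text \<open>Every translate \<open>V h\<close> contributes a return to \<open>R\<close>, and
  infinitude of the group provides an \<open>h\<close> for which \<open>V h\<close> is disjoint from
  the set built so far. \<open>Y\<close> serves all \<open>V\<close>-syndetic sets at once and grows
  linearly in \<open>L\<close>, which keeps the number of constraints polynomial in
  \<open>s\<close>.\<close>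

lemma many_returns:
  assumes "infinite (carrier G)" "finite V" "V \<subseteq> carrier G"
  shows "\<exists>Y. finite Y \<and> Y \<subseteq> carrier G \<and> card Y \<le> card V * L \<and>
    (\<forall>R. syndetic V R \<longrightarrow> (\<forall>g\<in>carrier G. L \<le> card {\<zeta>\<in>Y. R (\<zeta> \<otimes> g)}))"
proof (induction L)
  case 0
  show ?case by (intro exI[of _ "{}"]) simp
next
  case (Suc L)
  then obtain Y where Y: "finite Y" "Y \<subseteq> carrier G" "card Y \<le> card V * L"
    "\<And>R g. syndetic V R \<Longrightarrow> g \<in> carrier G \<Longrightarrow> L \<le> card {\<zeta>\<in>Y. R (\<zeta> \<otimes> g)}" by blast
  have "finite ((\<lambda>v. inv v) ` V <#> Y)" using assms Y by (simp add: finite_set_mult)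
  then obtain h where h: "h \<in> carrier G" "h \<notin> (\<lambda>v. inv v) ` V <#> Y"
    using assms(1) by (meson finite_subset subsetI)
  have disj: "v \<otimes> h \<notin> Y" if "v \<in> V" for v
  proof
    assume "v \<otimes> h \<in> Y"
    then have "inv v \<otimes> (v \<otimes> h) \<in> (\<lambda>v. inv v) ` V <#> Y" using that by (auto simp: set_mult_def)
    moreover have "inv v \<otimes> (v \<otimes> h) = h"
      using that assms(3) h by (simp flip: m_assoc add: subset_iff)
    ultimately show False using h(2) by simp
  qed
  define Y' where "Y' = Y \<union> (\<lambda>v. v \<otimes> h) ` V"
  have "card Y' \<le> card Y + card V"
    unfolding Y'_def by (meson add_left_mono assms(2) card_Un_le card_image_le le_trans)
  moreover have "Suc L \<le> card {\<zeta>\<in>Y'. R (\<zeta> \<otimes> g)}" if R: "syndetic V R" and g: "g \<in> carrier G" for R g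
  proof -
    obtain v where v: "v \<in> V" "R (v \<otimes> (h \<otimes> g))"
      using R g h unfolding syndetic_def by (meson m_closed)
    have "insert (v \<otimes> h) {\<zeta>\<in>Y. R (\<zeta> \<otimes> g)} \<subseteq> {\<zeta>\<in>Y'. R (\<zeta> \<otimes> g)}"
      using v h g assms(3) by (auto simp: Y'_def m_assoc subset_iff)
    then have "card (insert (v \<otimes> h) {\<zeta>\<in>Y. R (\<zeta> \<otimes> g)}) \<le> card {\<zeta>\<in>Y'. R (\<zeta> \<otimes> g)}"
      using Y(1) assms(2) by (intro card_mono) (auto simp: Y'_def)
    then show ?thesis using Y(4)[OF R g] disj[OF v(1)] Y(1) by simp
  qed
  ultimately show ?case
    using Y h assms by (intro exI[of _ Y']) (auto simp: Y'_def)
qed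

lemma finitary_conj: "finitary A \<Longrightarrow> finitary B \<Longrightarrow> finitary (\<lambda>c g. A c g \<and> B c g)"
  by (rule finitary_app2)
lemma finitary_imp: "finitary A \<Longrightarrow> finitary B \<Longrightarrow> finitary (\<lambda>c g. A c g \<longrightarrow> B c g)"
  by (rule finitary_app2)
lemma finitary_eq: "finitary A \<Longrightarrow> finitary B \<Longrightarrow> finitary (\<lambda>c g. A c g = B c g)"
  by (rule finitary_app2)
lemma finitary_not: "finitary A \<Longrightarrow> finitary (\<lambda>c g. \<not> A c g)"
  by (rule finitary_app1)
text \<open>For tests on group elements alone, such as \<open>\<xi> \<otimes> u = \<one>\<close>:
  each branch has to be finitary only in its own case.\<close>

lemma finitary_if_const:
  "(b \<Longrightarrow> finitary A) \<Longrightarrow> (\<not> b \<Longrightarrow> finitary B) \<Longrightarrow> finitary (\<lambda>c g. if b then A c g else B c g)"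
  by (cases b) auto
lemma finitary_if:
  assumes "finitary P" "finitary A" "finitary B"
  shows "finitary (\<lambda>c g. if P c g then A c g else B c g)"
proof -
  have "finitary (\<lambda>c g. (P c g, A c g))" by (rule finitary_app2[OF assms(1,2)])
  from finitary_app2[OF this assms(3), where f = "\<lambda>p b. if fst p then snd p else b"]
  show ?thesis by (simp only: fst_conv snd_conv)
qed
lemma finitary_less: "finitary A \<Longrightarrow> finitary B \<Longrightarrow> finitary (\<lambda>c g. A c g < (B c g :: nat))"
  by (rule finitary_app2)
lemma finitary_le: "finitary A \<Longrightarrow> finitary B \<Longrightarrow> finitary (\<lambda>c g. A c g \<le> (B c g :: nat))"
  by (rule finitary_app2)
lemma finitary_card: "finitary A \<Longrightarrow> finitary (\<lambda>c g. card (A c g))"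
  by (rule finitary_app1)
lemma finitary_times: "finitary A \<Longrightarrow> finitary (\<lambda>c g. k * (A c g :: nat))"
  by (rule finitary_app1)
lemma finitary_mem: "finitary A \<Longrightarrow> finitary (\<lambda>c g. x \<in> A c g)"
  by (rule finitary_app1)

lemma finitary_at: "finitary (\<lambda>c g. f (c g))"
  by (rule finitary_app1[OF finitary_self])
lemma finitary_at1: "e \<in> carrier G \<Longrightarrow> finitary (\<lambda>c g. f (c (e \<otimes> g)))"
  by (rule finitary_translate[OF finitary_at])
lemma finitary_at2: "e \<in> carrier G \<Longrightarrow> e' \<in> carrier G \<Longrightarrow> finitary (\<lambda>c g. f (c (e \<otimes> (e' \<otimes> g))))"
  by (rule finitary_translate[OF finitary_at1])

text \<open>\<open>g\<close> becomes a marker if \<open>R\<close> holds there and no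
  \<open>E\<close>-neighbour of smaller color is one. Neighbours have different colors, so symmetry
  of \<open>E\<close> yields sparseness in both directions, and a rejected point of \<open>R\<close>
  has a marker next to it.\<close>

lemma maximal_discrete_rule:
  assumes E: "finite E" "E \<subseteq> carrier G" "\<And>e. e \<in> E \<Longrightarrow> inv e \<in> E" and R: "finitary R"
  obtains M :: "('a \<Rightarrow> nat) \<Rightarrow> 'a \<Rightarrow> bool" where "finitary M"
    "\<And>z g. proper E N z \<Longrightarrow> g \<in> carrier G \<Longrightarrow> M z g \<Longrightarrow> R z g"
    "\<And>z g e. proper E N z \<Longrightarrow> g \<in> carrier G \<Longrightarrow> M z g \<Longrightarrow> e \<in> E \<Longrightarrow> e \<noteq> \<one> \<Longrightarrow> \<not> M z (e \<otimes> g)"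
    "\<And>z g. proper E N z \<Longrightarrow> g \<in> carrier G \<Longrightarrow> R z g \<Longrightarrow> \<exists>e\<in>insert \<one> E. M z (e \<otimes> g)"
proof -
  define W :: "('a \<Rightarrow> nat \<times> bool \<times> bool) \<Rightarrow> 'a \<Rightarrow> bool" where
    "W = (\<lambda>s g. fst (snd (s g)) \<and> (\<forall>e\<in>E. fst (s (e \<otimes> g)) < fst (s g) \<longrightarrow> \<not> snd (snd (s (e \<otimes> g)))))"
  have at: "finitary (\<lambda>s g. f (s (e \<otimes> g)))" if "e \<in> E" for e and f :: "nat \<times> bool \<times> bool \<Rightarrow> 'y"
    using that E by (auto intro: finitary_at1)
  have "finitary W"
    unfolding W_def
    apply (intro finitary_conj finitary_Ball finitary_imp finitary_less finitary_not E)
    using at[of _ fst] at[of _ "\<lambda>x. snd (snd x)"] finitary_at[of fst] finitary_at[of "\<lambda>x. fst (snd x)"]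
    by auto
  \<comment> \<open>A singleton of admissible values makes the greedy choice return the truth value
    of \<open>W\<close> itself.\<close>
  then have fin: "finitary (\<lambda>s g. {W s g})" by (rule finitary_app1)
  have mask: "{W (\<lambda>h. (z h, s h, a h)) g} = {W (\<lambda>h. (z h, s h, a' h)) g}"
    if "g \<in> carrier G" "\<And>h. h \<in> carrier G \<Longrightarrow> z h < z g \<Longrightarrow> a h = a' h" for z s a a' g
  proof -
    have "e \<otimes> g \<in> carrier G" if "e \<in> E" for e using that E \<open>g \<in> carrier G\<close> by blast
    then show ?thesis using that by (auto simp: W_def)
  qed
  from finitary_greedy[where N = N, OF R fin mask]
  obtain M where M: "finitary M \<and> (\<forall>z. (\<forall>h\<in>carrier G. z h < N) \<longrightarrow> (\<forall>g\<in>carrier G.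
       {W (\<lambda>h. (z h, R z h, M z h)) g} \<noteq> {} \<longrightarrow> M z g \<in> {W (\<lambda>h. (z h, R z h, M z h)) g}))"
    by (rule exE)
  have MW: "M z g \<longleftrightarrow> R z g \<and> (\<forall>e\<in>E. z (e \<otimes> g) < z g \<longrightarrow> \<not> M z (e \<otimes> g))"
    if "proper E N z" "g \<in> carrier G" for z g
    using M that by (auto simp: proper_def W_def)
  show ?thesis
  proof (rule that[OF conjunct1[OF M]])
    fix z g assume z: "proper E N z" and g: "g \<in> carrier G"
    show "M z g \<Longrightarrow> R z g" using MW[OF z g] by blast
    show "\<exists>e\<in>insert \<one> E. M z (e \<otimes> g)" if "R z g"
      using MW[OF z g] that g by (cases "M z g") auto
    fix e assume Mg: "M z g" and e: "e \<in> E" "e \<noteq> \<one>"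
    have ec: "e \<in> carrier G" using e E by blast
    have "z (e \<otimes> g) \<noteq> z g" using z g e by (simp add: proper_def)
    then consider "z (e \<otimes> g) < z g" | "z g < z (e \<otimes> g)" by linarith
    then show "\<not> M z (e \<otimes> g)"
    proof cases
      case 1
      then show ?thesis using MW[OF z g] Mg e by blast
    next
      case 2
      have "inv e \<otimes> (e \<otimes> g) = g" using ec g by (simp flip: m_assoc)
      then show ?thesis using MW[OF z, of "e \<otimes> g"] 2 Mg E(3)[OF e(1)] ec g by (metis m_closed)
    qed
  qed
qed


text \<open>
  Around a marker \<open>m \<in> M\<close>, the position \<open>\<zeta> m\<close> with \<open>\<zeta> \<in> Z\<close> belongs to the bundle of \<open>m\<close> if it lies in
  \<open>R - M\<close>; its value is \<open>\<zeta> \<in> a m\<close>, so bit strings are subsets of \<open>Z\<close>. The constraint \<open>(m, \<beta>)\<close> asks that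
  the values at \<open>\<zeta> m\<close> and \<open>\<zeta> \<beta> m\<close> differ for some \<open>\<zeta> \<in> bundle_index Z R M m \<beta>\<close>. The indices in
  \<open>late_index\<close> are those for which \<open>\<zeta> \<beta> m\<close> lies in the bundle of a marker with a larger color, which is
  unique by sparseness. If they make up at least half of all indices, that later marker takes care of
  the constraint; otherwise \<open>m\<close> does, using only the other indices.
\<close>

definition bundle_index :: "'a set \<Rightarrow> ('a \<Rightarrow> bool) \<Rightarrow> ('a \<Rightarrow> bool) \<Rightarrow> 'a \<Rightarrow> 'a \<Rightarrow> 'a set" where
  "bundle_index Z R M m \<beta> =
     {\<zeta> \<in> Z. R (\<zeta> \<otimes> m) \<and> \<not> M (\<zeta> \<otimes> m) \<and> \<not> M (\<zeta> \<otimes> (\<beta> \<otimes> m))}"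

definition late_index ::
    "'a set \<Rightarrow> ('a \<Rightarrow> nat) \<Rightarrow> ('a \<Rightarrow> bool) \<Rightarrow> ('a \<Rightarrow> bool) \<Rightarrow> 'a \<Rightarrow> 'a \<Rightarrow> 'a set" where
  "late_index Z z R M m \<beta> =
     {\<zeta> \<in> Z. R (\<zeta> \<otimes> m) \<and> \<not> M (\<zeta> \<otimes> m) \<and> \<not> M (\<zeta> \<otimes> (\<beta> \<otimes> m)) \<and> R (\<zeta> \<otimes> (\<beta> \<otimes> m)) \<and>
        (\<exists>\<xi>\<in>Z. M (\<xi> \<otimes> (\<zeta> \<otimes> (\<beta> \<otimes> m))) \<and> z m < z (\<xi> \<otimes> (\<zeta> \<otimes> (\<beta> \<otimes> m))))}"

text \<open>A position sees its marker as \<open>\<xi> \<otimes> h\<close>, so its index in that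
  bundle is \<open>inv \<xi>\<close>. Positions of \<open>R\<close> near no marker get
  \<open>False\<close>, and values outside \<open>R\<close> are kept. The value at a marker itself
  is provisional, as markers stay free.\<close>

definition bundle_value ::
    "'a set \<Rightarrow> ('a \<Rightarrow> bool) \<Rightarrow> ('a \<Rightarrow> bool) \<Rightarrow> ('a \<Rightarrow> bool) \<Rightarrow> ('a \<Rightarrow> 'a set) \<Rightarrow> 'a \<Rightarrow> bool" where
  "bundle_value Z R M X a h =
     (if R h then \<exists>\<xi>\<in>Z. M (\<xi> \<otimes> h) \<and> inv \<xi> \<in> a (\<xi> \<otimes> h) else X h)"

text \<open>The value at \<open>u \<otimes> g\<close> as far as \<open>g\<close> can know it while
  trying the string \<open>v\<close>. The case \<open>\<xi> \<otimes> u = \<one>\<close> means that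
  the marker in charge is \<open>g\<close> itself; any other marker whose color is not smaller reads
  as \<open>False\<close>, so that the greedy choice is not circular.\<close>

definition early_value ::
    "'a set \<Rightarrow> ('a \<Rightarrow> nat) \<Rightarrow> ('a \<Rightarrow> bool) \<Rightarrow> ('a \<Rightarrow> bool) \<Rightarrow> ('a \<Rightarrow> bool) \<Rightarrow> ('a \<Rightarrow> 'a set) \<Rightarrow>
       'a \<Rightarrow> 'a set \<Rightarrow> 'a \<Rightarrow> bool" where
  "early_value Z z R M X a g v u =
     (if R (u \<otimes> g) then \<exists>\<xi>\<in>Z. M (\<xi> \<otimes> (u \<otimes> g)) \<and>
        (if \<xi> \<otimes> u = \<one> then inv \<xi> \<in> v
         else z (\<xi> \<otimes> (u \<otimes> g)) < z g \<and> inv \<xi> \<in> a (\<xi> \<otimes> (u \<otimes> g)))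
      else X (u \<otimes> g))"

text \<open>If \<open>g = \<xi> \<otimes> (\<zeta> \<otimes> (\<beta> \<otimes> m))\<close>, then
  \<open>origin \<xi> \<zeta> \<beta> \<otimes> g = m\<close>: the later marker finds the one whose
  constraint it inherits.\<close>

abbreviation origin :: "'a \<Rightarrow> 'a \<Rightarrow> 'a \<Rightarrow> 'a" where
  "origin \<xi> \<zeta> \<beta> \<equiv> inv (\<xi> \<otimes> (\<zeta> \<otimes> \<beta>))"

text \<open>The first clause collects the constraints that \<open>g\<close> settles itself, the
  second those inherited from markers \<open>m\<close> of smaller color, reached through all triples
  of \<beta>, \<zeta>, \<xi>. The element \<open>\<zeta>' \<otimes> \<beta> \<otimes> origin \<xi>
  \<zeta> \<beta>\<close> is the index in the bundle of \<open>g\<close> of the position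
  \<open>\<zeta>' \<otimes> \<beta> \<otimes> m\<close>.\<close>

definition good_strings ::
    "'a set \<Rightarrow> 'a set \<Rightarrow> ('a \<Rightarrow> nat) \<Rightarrow> ('a \<Rightarrow> bool) \<Rightarrow> ('a \<Rightarrow> bool) \<Rightarrow> ('a \<Rightarrow> bool) \<Rightarrow> ('a \<Rightarrow> 'a set) \<Rightarrow>
       'a \<Rightarrow> 'a set set" where
  "good_strings Z Q z R M X a g =
     {v \<in> Pow Z.
       (\<forall>\<beta>\<in>Q. 2 * card (late_index Z z R M g \<beta>) < card (bundle_index Z R M g \<beta>) \<longrightarrow>
          (\<exists>\<zeta>\<in>Z. \<zeta> \<in> bundle_index Z R M g \<beta> \<and> \<zeta> \<notin> late_index Z z R M g \<beta> \<and>
             (\<zeta> \<in> v) \<noteq> early_value Z z R M X a g v (\<zeta> \<otimes> \<beta>))) \<and>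
       (\<forall>\<beta>\<in>Q. \<forall>\<zeta>\<in>Z. \<forall>\<xi>\<in>Z.
          M (origin \<xi> \<zeta> \<beta> \<otimes> g) \<and> z (origin \<xi> \<zeta> \<beta> \<otimes> g) < z g \<and>
          card (bundle_index Z R M (origin \<xi> \<zeta> \<beta> \<otimes> g) \<beta>)
            \<le> 2 * card (late_index Z z R M (origin \<xi> \<zeta> \<beta> \<otimes> g) \<beta>) \<and>
          \<zeta> \<in> late_index Z z R M (origin \<xi> \<zeta> \<beta> \<otimes> g) \<beta> \<longrightarrow>
          (\<exists>\<zeta>'\<in>Z. \<zeta>' \<in> late_index Z z R M (origin \<xi> \<zeta> \<beta> \<otimes> g) \<beta> \<and>
             (\<zeta>' \<in> a (origin \<xi> \<zeta> \<beta> \<otimes> g)) \<noteq> (\<zeta>' \<otimes> \<beta> \<otimes> origin \<xi> \<zeta> \<beta> \<in> v)))}"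

lemma good_strings_mask:
  assumes "Z \<subseteq> carrier G" "Q \<subseteq> carrier G" "g \<in> carrier G"
    and "\<And>h. h \<in> carrier G \<Longrightarrow> z h < z g \<Longrightarrow> a h = a' h"
  shows "good_strings Z Q z R M X a g = good_strings Z Q z R M X a' g"
proof -
  have "early_value Z z R M X a g v (\<zeta> \<otimes> \<beta>) = early_value Z z R M X a' g v (\<zeta> \<otimes> \<beta>)"
    if "\<zeta> \<in> Z" "\<beta> \<in> Q" for v \<zeta> \<beta>
  proof -
    have "a (\<xi> \<otimes> (\<zeta> \<otimes> \<beta> \<otimes> g)) = a' (\<xi> \<otimes> (\<zeta> \<otimes> \<beta> \<otimes> g))"
      if "z (\<xi> \<otimes> (\<zeta> \<otimes> \<beta> \<otimes> g)) < z g" "\<xi> \<in> Z" for \<xi>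
      using assms \<open>\<zeta> \<in> Z\<close> \<open>\<beta> \<in> Q\<close> that by (meson m_closed subsetD)
    then show ?thesis unfolding early_value_def by (auto split: if_splits)
  qed
  moreover have "a (origin \<xi> \<zeta> \<beta> \<otimes> g) = a' (origin \<xi> \<zeta> \<beta> \<otimes> g)"
    if "\<xi> \<in> Z" "\<zeta> \<in> Z" "\<beta> \<in> Q" "z (origin \<xi> \<zeta> \<beta> \<otimes> g) < z g" for \<xi> \<zeta> \<beta>
    using assms that by (meson m_closed inv_closed subsetD)
  ultimately show ?thesis
    unfolding good_strings_def by (simp cong: conj_cong imp_cong)
qed

lemma finitary_good_strings:
  assumes Z: "finite Z" "Z \<subseteq> carrier G" and Q: "finite Q" "Q \<subseteq> carrier G"
  shows "finitary (\<lambda>s :: 'a \<Rightarrow> nat \<times> (bool \<times> bool \<times> bool) \<times> 'a set.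
    good_strings Z Q (\<lambda>h. fst (s h)) (\<lambda>h. fst (fst (snd (s h)))) (\<lambda>h. fst (snd (fst (snd (s h)))))
      (\<lambda>h. snd (snd (fst (snd (s h))))) (\<lambda>h. snd (snd (s h))))"
proof -
  have at2: "finitary (\<lambda>s g. s (e \<otimes> (e' \<otimes> g)) :: nat \<times> (bool \<times> bool \<times> bool) \<times> 'a set)"
    if "e \<in> carrier G" "e' \<in> carrier G" for e e'
    using finitary_at2[OF that, of "\<lambda>x. x"] by simp
  have at1: "finitary (\<lambda>s g. s (e \<otimes> g) :: nat \<times> (bool \<times> bool \<times> bool) \<times> 'a set)" if "e \<in> carrier G" for e
    using finitary_at1[OF that, of "\<lambda>x. x"] by simp
  have at3: "finitary (\<lambda>s g. s (d \<otimes> (e \<otimes> (e' \<otimes> g))) :: nat \<times> (bool \<times> bool \<times> bool) \<times> 'a set)"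
    if "d \<in> carrier G" "e \<in> carrier G" "e' \<in> carrier G" for d e e'
    by (rule finitary_translate[OF at2[OF that(1,2)] that(3)])
  note at = at1 at2 at3 finitary_self
  note proj = finitary_app1[where f = fst] finitary_app1[where f = snd]
  define z :: "_ \<Rightarrow> 'a \<Rightarrow> nat" where "z = (\<lambda>(s :: 'a \<Rightarrow> nat \<times> (bool \<times> bool \<times> bool) \<times> 'a set) h. fst (s h))"
  define R :: "_ \<Rightarrow> 'a \<Rightarrow> bool" where "R = (\<lambda>(s :: 'a \<Rightarrow> nat \<times> (bool \<times> bool \<times> bool) \<times> 'a set) h. fst (fst (snd (s h))))"
  define M :: "_ \<Rightarrow> 'a \<Rightarrow> bool" where "M = (\<lambda>(s :: 'a \<Rightarrow> nat \<times> (bool \<times> bool \<times> bool) \<times> 'a set) h. fst (snd (fst (snd (s h)))))"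
  define X :: "_ \<Rightarrow> 'a \<Rightarrow> bool" where "X = (\<lambda>(s :: 'a \<Rightarrow> nat \<times> (bool \<times> bool \<times> bool) \<times> 'a set) h. snd (snd (fst (snd (s h)))))"
  define a :: "_ \<Rightarrow> 'a \<Rightarrow> 'a set" where "a = (\<lambda>(s :: 'a \<Rightarrow> nat \<times> (bool \<times> bool \<times> bool) \<times> 'a set) h. snd (snd (s h)))"
  have atoms: "finitary (\<lambda>s g. z s g)"
    "\<And>e. e \<in> carrier G \<Longrightarrow> finitary (\<lambda>s g. z s (e \<otimes> g))"
    "\<And>e. e \<in> carrier G \<Longrightarrow> finitary (\<lambda>s g. R s (e \<otimes> g))"
    "\<And>e. e \<in> carrier G \<Longrightarrow> finitary (\<lambda>s g. M s (e \<otimes> g))"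
    "\<And>e. e \<in> carrier G \<Longrightarrow> finitary (\<lambda>s g. X s (e \<otimes> g))"
    "\<And>e. e \<in> carrier G \<Longrightarrow> finitary (\<lambda>s g. a s (e \<otimes> g))"
    "\<And>e e'. e \<in> carrier G \<Longrightarrow> e' \<in> carrier G \<Longrightarrow> finitary (\<lambda>s g. z s (e \<otimes> (e' \<otimes> g)))"
    "\<And>e e'. e \<in> carrier G \<Longrightarrow> e' \<in> carrier G \<Longrightarrow> finitary (\<lambda>s g. R s (e \<otimes> (e' \<otimes> g)))"
    "\<And>e e'. e \<in> carrier G \<Longrightarrow> e' \<in> carrier G \<Longrightarrow> finitary (\<lambda>s g. M s (e \<otimes> (e' \<otimes> g)))"
    "\<And>e e'. e \<in> carrier G \<Longrightarrow> e' \<in> carrier G \<Longrightarrow> finitary (\<lambda>s g. a s (e \<otimes> (e' \<otimes> g)))"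
    "\<And>d e e'. d \<in> carrier G \<Longrightarrow> e \<in> carrier G \<Longrightarrow> e' \<in> carrier G \<Longrightarrow> finitary (\<lambda>s g. z s (d \<otimes> (e \<otimes> (e' \<otimes> g))))"
    "\<And>d e e'. d \<in> carrier G \<Longrightarrow> e \<in> carrier G \<Longrightarrow> e' \<in> carrier G \<Longrightarrow> finitary (\<lambda>s g. M s (d \<otimes> (e \<otimes> (e' \<otimes> g))))"
    unfolding z_def R_def M_def X_def a_def by (intro proj at; assumption)+
  have I: "finitary (\<lambda>s g. bundle_index Z (R s) (M s) g \<beta>)" if "\<beta> \<in> carrier G" for \<beta>
    unfolding bundle_index_def
    by (intro finitary_filter finitary_conj finitary_not atoms Z) (use that Z in auto)
  have J: "finitary (\<lambda>s g. late_index Z (z s) (R s) (M s) g \<beta>)" if "\<beta> \<in> carrier G" for \<beta>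
    unfolding late_index_def
    by (intro finitary_filter finitary_conj finitary_not finitary_Bex finitary_less atoms Z) (use that Z in auto)
  have E: "finitary (\<lambda>s g. early_value Z (z s) (R s) (M s) (X s) (a s) g v u)" if "u \<in> carrier G" for v u
    unfolding early_value_def
    by (intro finitary_if finitary_if_const finitary_conj finitary_Bex finitary_less finitary_mem
        finitary_const atoms Z) (use that Z in auto)
  have IJ: "finitary (\<lambda>s g. bundle_index Z (R s) (M s) (u \<otimes> g) \<beta>)"
    "finitary (\<lambda>s g. late_index Z (z s) (R s) (M s) (u \<otimes> g) \<beta>)"
    if "\<beta> \<in> carrier G" "u \<in> carrier G" for \<beta> u
    using finitary_translate[OF I[OF that(1)] that(2)] finitary_translate[OF J[OF that(1)] that(2)] .
  have "finitary (\<lambda>s. good_strings Z Q (z s) (R s) (M s) (X s) (a s))"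
    unfolding good_strings_def
    by (intro finitary_filter finitary_conj finitary_not finitary_Bex finitary_Ball finitary_less
        finitary_le finitary_imp finitary_mem finitary_eq finitary_times finitary_card finitary_const
        atoms I J E IJ Z Q) (auto simp: Z(1) subsetD[OF Z(2)] subsetD[OF Q(2)])
  then show ?thesis by (simp add: z_def R_def M_def X_def a_def)
qed

end

text \<open>One stage at a fixed coloring \<open>z\<close>. The \<open>6 * s + 2\<close> indices are
  spent as follows: at most two are lost to markers; of the remaining \<open>6 * s\<close>, half are
  late or half are not; a third of a half survives the passage to an independent set.
  \<open>few\<close> counts the own constraints, one for each \<beta>, and the inherited ones, one
  for each triple.\<close>

locale marker_configuration = group G for G (structure) +
  fixes Z Q :: "'a set" and s :: nat and z :: "'a \<Rightarrow> nat" and R M X :: "'a \<Rightarrow> bool"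
  assumes Z: "finite Z" "Z \<subseteq> carrier G" "\<one> \<in> Z" "\<And>\<zeta>. \<zeta> \<in> Z \<Longrightarrow> inv \<zeta> \<in> Z"
    and Q: "finite Q" "Q \<subseteq> carrier G" "\<one> \<notin> Q"
    and M_R: "\<And>g. g \<in> carrier G \<Longrightarrow> M g \<Longrightarrow> R g"
    and disc: "\<And>h \<xi> \<zeta> \<xi>' \<zeta>'. h \<in> carrier G \<Longrightarrow> \<xi> \<in> Z \<Longrightarrow> \<zeta> \<in> Z \<Longrightarrow> \<xi>' \<in> Z \<Longrightarrow> \<zeta>' \<in> Z \<Longrightarrow>
       M (\<xi> \<otimes> \<zeta> \<otimes> h) \<Longrightarrow> M (\<xi>' \<otimes> \<zeta>' \<otimes> h) \<Longrightarrow> \<xi> \<otimes> \<zeta> = \<xi>' \<otimes> \<zeta>'"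
    and proper: "\<And>m \<xi> \<zeta> \<beta>. m \<in> carrier G \<Longrightarrow> \<xi> \<in> Z \<Longrightarrow> \<zeta> \<in> Z \<Longrightarrow> \<beta> \<in> Q \<Longrightarrow> \<xi> \<otimes> (\<zeta> \<otimes> \<beta>) \<noteq> \<one> \<Longrightarrow>
       z (\<xi> \<otimes> (\<zeta> \<otimes> \<beta>) \<otimes> m) \<noteq> z m"
    and many: "\<And>g. g \<in> carrier G \<Longrightarrow> 6 * s + 2 \<le> card {\<zeta> \<in> Z. R (\<zeta> \<otimes> g)}"
    and few: "card Q + card Q * card Z * card Z < 2 ^ s"
begin

abbreviation "I \<equiv> bundle_index Z R M"
abbreviation "J \<equiv> late_index Z z R M"

lemma Zc: "\<zeta> \<in> Z \<Longrightarrow> \<zeta> \<in> carrier G" and Qc: "\<beta> \<in> Q \<Longrightarrow> \<beta> \<in> carrier G"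
  using Z Q by blast+

lemma disc1:
  assumes "h \<in> carrier G" "\<xi> \<in> Z" "\<zeta> \<in> Z" "M (\<xi> \<otimes> h)" "M (\<zeta> \<otimes> h)"
  shows "\<xi> = \<zeta>"
  using disc[OF assms(1,2) Z(3) assms(3) Z(3)] assms Zc by simp

lemma J_subset_I: "J m \<beta> \<subseteq> I m \<beta>" and I_subset_Z: "I m \<beta> \<subseteq> Z"
  unfolding bundle_index_def late_index_def by blast+

lemma finite_I: "finite (I m \<beta>)" and finite_J: "finite (J m \<beta>)"
  using J_subset_I I_subset_Z Z(1) by (meson finite_subset)+

lemma card_I:
  assumes "m \<in> carrier G" "\<beta> \<in> carrier G"
  shows "6 * s \<le> card (I m \<beta>)"
proof -
  have one: "card {\<zeta> \<in> Z. M (\<zeta> \<otimes> h)} \<le> 1" if "h \<in> carrier G" for h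
    using card_le_Suc0_iff_eq[of "{\<zeta> \<in> Z. M (\<zeta> \<otimes> h)}"] disc1[OF that] Z(1) by auto
  have "{\<zeta> \<in> Z. R (\<zeta> \<otimes> m)} \<subseteq> I m \<beta> \<union> ({\<zeta> \<in> Z. M (\<zeta> \<otimes> m)} \<union> {\<zeta> \<in> Z. M (\<zeta> \<otimes> (\<beta> \<otimes> m))})"
    by (auto simp: bundle_index_def)
  then have "card {\<zeta> \<in> Z. R (\<zeta> \<otimes> m)} \<le>
      card (I m \<beta> \<union> ({\<zeta> \<in> Z. M (\<zeta> \<otimes> m)} \<union> {\<zeta> \<in> Z. M (\<zeta> \<otimes> (\<beta> \<otimes> m))}))"
    using Z(1) finite_I by (intro card_mono) auto
  also have "\<dots> \<le> card (I m \<beta>) + (card {\<zeta> \<in> Z. M (\<zeta> \<otimes> m)} + card {\<zeta> \<in> Z. M (\<zeta> \<otimes> (\<beta> \<otimes> m))})"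
    by (meson add_left_mono card_Un_le le_trans)
  finally show ?thesis
    using many[OF assms(1)] one[OF assms(1)] one[of "\<beta> \<otimes> m"] assms by simp
qed

lemma s_pos: "\<beta> \<in> Q \<Longrightarrow> s \<ge> 1"
  using few Q(1) by (cases s) auto

text \<open>By sparseness, the marker seen from \<open>\<zeta> \<otimes> m\<close> can only be
  \<open>m\<close>, so the bit found there is the one that \<open>m\<close> wrote at index
  \<zeta>.\<close>

lemma value_bundle:
  assumes "m \<in> carrier G" "M m" "\<zeta> \<in> Z" "R (\<zeta> \<otimes> m)"
  shows "bundle_value Z R M X a (\<zeta> \<otimes> m) \<longleftrightarrow> \<zeta> \<in> a m"
proof -
  have "(\<exists>\<xi>\<in>Z. M (\<xi> \<otimes> (\<zeta> \<otimes> m)) \<and> inv \<xi> \<in> a (\<xi> \<otimes> (\<zeta> \<otimes> m))) \<longleftrightarrow> \<zeta> \<in> a m"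
  proof
    assume "\<exists>\<xi>\<in>Z. M (\<xi> \<otimes> (\<zeta> \<otimes> m)) \<and> inv \<xi> \<in> a (\<xi> \<otimes> (\<zeta> \<otimes> m))"
    then obtain \<xi> where \<xi>: "\<xi> \<in> Z" "M (\<xi> \<otimes> (\<zeta> \<otimes> m))" "inv \<xi> \<in> a (\<xi> \<otimes> (\<zeta> \<otimes> m))" by blast
    have "\<xi> \<otimes> \<zeta> = \<one> \<otimes> \<one>"
      using disc[OF assms(1) \<xi>(1) assms(3) Z(3) Z(3)] \<xi> assms Zc by (simp add: m_assoc)
    then have "\<xi> \<otimes> \<zeta> = \<one>" by simp
    then have "inv \<xi> = \<zeta>" "\<xi> \<otimes> (\<zeta> \<otimes> m) = m"
      using inv_equality[of \<xi> \<zeta>] inv_inv[of \<zeta>] Zc[OF \<xi>(1)] Zc[OF assms(3)] assms(1)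
      by (simp_all flip: m_assoc)
    then show "\<zeta> \<in> a m" using \<xi>(3) by simp
  next
    assume "\<zeta> \<in> a m"
    moreover have "inv \<zeta> \<otimes> (\<zeta> \<otimes> m) = m" using assms Zc by (simp flip: m_assoc)
    ultimately show "\<exists>\<xi>\<in>Z. M (\<xi> \<otimes> (\<zeta> \<otimes> m)) \<and> inv \<xi> \<in> a (\<xi> \<otimes> (\<zeta> \<otimes> m))"
      using assms Zc Z(4) by (intro bexI[of _ "inv \<zeta>"]) auto
  qed
  then show ?thesis using assms(4) by (simp add: bundle_value_def)
qed

text \<open>Two markers that are both reached from \<open>\<beta> \<otimes> m\<close> by products of
  two elements of \<open>Z\<close> coincide. So all late indices of the constraint fall into the
  bundle of one marker, whichever \<eta> leads to it, and this single marker can take the constraint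
  over.\<close>

lemma late_bundle:
  assumes m: "m \<in> carrier G" and \<beta>: "\<beta> \<in> Q" and \<zeta>: "\<zeta> \<in> J m \<beta>" and \<xi>: "\<xi> \<in> Z"
    and \<eta>: "\<eta> \<in> Z" and M: "M (\<xi> \<otimes> (\<eta> \<otimes> (\<beta> \<otimes> m)))"
  shows "\<zeta> \<otimes> \<beta> \<otimes> origin \<xi> \<eta> \<beta> \<in> Z"
    and "\<zeta> \<otimes> \<beta> \<otimes> origin \<xi> \<eta> \<beta> \<otimes> (\<xi> \<otimes> (\<eta> \<otimes> (\<beta> \<otimes> m))) = \<zeta> \<otimes> (\<beta> \<otimes> m)"
proof -
  have c: "\<zeta> \<in> carrier G" "\<xi> \<in> carrier G" "\<eta> \<in> carrier G" "\<beta> \<in> carrier G" "\<zeta> \<in> Z"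
    using \<zeta> \<xi> \<eta> Qc[OF \<beta>] Zc J_subset_I I_subset_Z by blast+
  obtain \<xi>' where \<xi>': "\<xi>' \<in> Z" "M (\<xi>' \<otimes> (\<zeta> \<otimes> (\<beta> \<otimes> m)))"
    using \<zeta> unfolding late_index_def by blast
  have eq: "\<xi>' \<otimes> \<zeta> = \<xi> \<otimes> \<eta>"
    using disc[of "\<beta> \<otimes> m", OF _ \<xi>'(1) c(5) \<xi> \<eta>] \<xi>'(2) M c m Zc[OF \<xi>'(1)] by (simp add: m_assoc)
  have "\<zeta> \<otimes> \<beta> \<otimes> origin \<xi> \<eta> \<beta> = \<zeta> \<otimes> inv (\<xi> \<otimes> \<eta>)"
    using c by (simp add: inv_mult_group m_assoc) (simp flip: m_assoc)
  also have "\<dots> = inv \<xi>'"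
    unfolding eq[symmetric] using c(1) Zc[OF \<xi>'(1)] by (simp add: inv_mult_group flip: m_assoc)
  finally have "\<zeta> \<otimes> \<beta> \<otimes> origin \<xi> \<eta> \<beta> = inv \<xi>'"
    .
  then show "\<zeta> \<otimes> \<beta> \<otimes> origin \<xi> \<eta> \<beta> \<in> Z" using Z(4) \<xi>'(1) by simp
  have "\<xi> \<otimes> (\<eta> \<otimes> (\<beta> \<otimes> m)) = (\<xi> \<otimes> (\<eta> \<otimes> \<beta>)) \<otimes> m" using c m by (simp add: m_assoc)
  then show "\<zeta> \<otimes> \<beta> \<otimes> origin \<xi> \<eta> \<beta> \<otimes> (\<xi> \<otimes> (\<eta> \<otimes> (\<beta> \<otimes> m))) = \<zeta> \<otimes> (\<beta> \<otimes> m)"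
    using c m inv_solve_right by (simp add: m_assoc) (simp add: inv_mult_group m_assoc, simp flip: m_assoc)
qed

text \<open>The marker that settles a constraint compares only with strings chosen before its own,
  or with its own, so what it compared is what is finally written.\<close>

lemma separated:
  assumes good: "\<And>g. g \<in> carrier G \<Longrightarrow> M g \<Longrightarrow> a g \<in> good_strings Z Q z R M X a g"
    and m: "m \<in> carrier G" "M m" and \<beta>: "\<beta> \<in> Q"
  shows "\<exists>\<zeta>\<in>Z. \<not> M (\<zeta> \<otimes> m) \<and> \<not> M (\<zeta> \<otimes> (\<beta> \<otimes> m)) \<and>
    bundle_value Z R M X a (\<zeta> \<otimes> m) \<noteq> bundle_value Z R M X a (\<zeta> \<otimes> (\<beta> \<otimes> m))"
proof (cases "2 * card (J m \<beta>) < card (I m \<beta>)")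
  case True
  then obtain \<zeta> where \<zeta>: "\<zeta> \<in> Z" "\<zeta> \<in> I m \<beta>" "\<zeta> \<notin> J m \<beta>"
    and neq: "(\<zeta> \<in> a m) \<noteq> early_value Z z R M X a m (a m) (\<zeta> \<otimes> \<beta>)"
    using good[OF m] \<beta> unfolding good_strings_def by blast
  have c: "\<zeta> \<in> carrier G" "\<beta> \<in> carrier G" using \<zeta>(1) \<beta> Zc Qc by auto
  have I: "R (\<zeta> \<otimes> m)" "\<not> M (\<zeta> \<otimes> m)" "\<not> M (\<zeta> \<otimes> (\<beta> \<otimes> m))"
    using \<zeta>(2) by (auto simp: bundle_index_def)
  \<comment> \<open>The provisional value is the final one: \<zeta> is not late, so the marker in
    charge has no larger color, and \<open>proper\<close> excludes an equal color unless that marker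
    is \<open>m\<close>.\<close>
  have "early_value Z z R M X a m (a m) (\<zeta> \<otimes> \<beta>) = bundle_value Z R M X a (\<zeta> \<otimes> (\<beta> \<otimes> m))"
  proof (cases "R (\<zeta> \<otimes> (\<beta> \<otimes> m))")
    case R: True
    have "(if \<xi> \<otimes> (\<zeta> \<otimes> \<beta>) = \<one> then inv \<xi> \<in> a m
         else z (\<xi> \<otimes> (\<zeta> \<otimes> (\<beta> \<otimes> m))) < z m \<and> inv \<xi> \<in> a (\<xi> \<otimes> (\<zeta> \<otimes> (\<beta> \<otimes> m))))
      \<longleftrightarrow> inv \<xi> \<in> a (\<xi> \<otimes> (\<zeta> \<otimes> (\<beta> \<otimes> m)))"
      if \<xi>: "\<xi> \<in> Z" "M (\<xi> \<otimes> (\<zeta> \<otimes> (\<beta> \<otimes> m)))" for \<xi>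
    proof -
      have eq: "\<xi> \<otimes> (\<zeta> \<otimes> (\<beta> \<otimes> m)) = \<xi> \<otimes> (\<zeta> \<otimes> \<beta>) \<otimes> m" using Zc[OF \<xi>(1)] c m by (simp add: m_assoc)
      have "\<not> z m < z (\<xi> \<otimes> (\<zeta> \<otimes> (\<beta> \<otimes> m)))"
        using \<zeta>(1,3) I R \<xi> by (auto simp: late_index_def)
      moreover have "z (\<xi> \<otimes> (\<zeta> \<otimes> (\<beta> \<otimes> m))) \<noteq> z m" if "\<xi> \<otimes> (\<zeta> \<otimes> \<beta>) \<noteq> \<one>"
        using proper[OF m(1) \<xi>(1) \<zeta>(1) \<beta> that] eq by simp
      ultimately show ?thesis using eq m(1) by auto
    qed
    then have "(\<exists>\<xi>\<in>Z. M (\<xi> \<otimes> (\<zeta> \<otimes> (\<beta> \<otimes> m))) \<and> (if \<xi> \<otimes> (\<zeta> \<otimes> \<beta>) = \<one> then inv \<xi> \<in> a m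
         else z (\<xi> \<otimes> (\<zeta> \<otimes> (\<beta> \<otimes> m))) < z m \<and> inv \<xi> \<in> a (\<xi> \<otimes> (\<zeta> \<otimes> (\<beta> \<otimes> m)))))
      \<longleftrightarrow> (\<exists>\<xi>\<in>Z. M (\<xi> \<otimes> (\<zeta> \<otimes> (\<beta> \<otimes> m))) \<and> inv \<xi> \<in> a (\<xi> \<otimes> (\<zeta> \<otimes> (\<beta> \<otimes> m))))"
      by blast
    moreover have "\<zeta> \<otimes> \<beta> \<otimes> m = \<zeta> \<otimes> (\<beta> \<otimes> m)" using c m(1) by (simp add: m_assoc)
    ultimately show ?thesis
      using R by (simp only: early_value_def bundle_value_def if_True)
  next
    case False
    then show ?thesis using c m(1) by (simp add: early_value_def bundle_value_def m_assoc)
  qed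
  then show ?thesis using value_bundle[OF m \<zeta>(1) I(1)] neq I \<zeta>(1) by blast
next
  case False
  \<comment> \<open>At least half of a nonempty index set is late, so there is a late index; any
    such index identifies the marker \<open>g\<close> in charge.\<close>
  then have "card (J m \<beta>) \<noteq> 0" using card_I[OF m(1) Qc[OF \<beta>]] s_pos[OF \<beta>] by linarith
  then obtain \<eta> where \<eta>: "\<eta> \<in> J m \<beta>" by fastforce
  then obtain \<xi> where \<xi>: "\<xi> \<in> Z" "M (\<xi> \<otimes> (\<eta> \<otimes> (\<beta> \<otimes> m)))" "z m < z (\<xi> \<otimes> (\<eta> \<otimes> (\<beta> \<otimes> m)))"
    by (auto simp: late_index_def)
  have \<eta>Z: "\<eta> \<in> Z" using \<eta> J_subset_I I_subset_Z by blast
  have c: "\<xi> \<in> carrier G" "\<eta> \<in> carrier G" "\<beta> \<in> carrier G" using \<xi>(1) \<eta>Z \<beta> Zc Qc by auto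
  define g where "g = \<xi> \<otimes> (\<eta> \<otimes> (\<beta> \<otimes> m))"
  define u where "u = origin \<xi> \<eta> \<beta>"
  have g: "g \<in> carrier G" "M g" "z m < z g" using c m \<xi> by (auto simp: g_def)
  have ug: "u \<otimes> g = m" using c m(1) by (simp add: u_def g_def inv_mult_group m_assoc) (simp flip: m_assoc)
  from good[OF g(1,2)] have foreign: "\<forall>\<beta>\<in>Q. \<forall>\<zeta>\<in>Z. \<forall>\<xi>\<in>Z.
      M (origin \<xi> \<zeta> \<beta> \<otimes> g) \<and> z (origin \<xi> \<zeta> \<beta> \<otimes> g) < z g \<and>
      card (I (origin \<xi> \<zeta> \<beta> \<otimes> g) \<beta>) \<le> 2 * card (J (origin \<xi> \<zeta> \<beta> \<otimes> g) \<beta>) \<and>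
      \<zeta> \<in> J (origin \<xi> \<zeta> \<beta> \<otimes> g) \<beta> \<longrightarrow>
      (\<exists>\<zeta>'\<in>Z. \<zeta>' \<in> J (origin \<xi> \<zeta> \<beta> \<otimes> g) \<beta> \<and>
         (\<zeta>' \<in> a (origin \<xi> \<zeta> \<beta> \<otimes> g)) \<noteq> (\<zeta>' \<otimes> \<beta> \<otimes> origin \<xi> \<zeta> \<beta> \<in> a g))"
    unfolding good_strings_def mem_Collect_eq by (elim conjE)
  have "\<exists>\<zeta>\<in>Z. \<zeta> \<in> J (u \<otimes> g) \<beta> \<and> (\<zeta> \<in> a (u \<otimes> g)) \<noteq> (\<zeta> \<otimes> \<beta> \<otimes> u \<in> a g)"
    using foreign[rule_format, OF \<beta> \<eta>Z \<xi>(1), folded u_def] False \<eta> m(2) g(3) ug by simp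
  then obtain \<zeta> where \<zeta>: "\<zeta> \<in> Z" "\<zeta> \<in> J m \<beta>" "(\<zeta> \<in> a m) \<noteq> (\<zeta> \<otimes> \<beta> \<otimes> u \<in> a g)" using ug by auto
  have J: "R (\<zeta> \<otimes> m)" "\<not> M (\<zeta> \<otimes> m)" "\<not> M (\<zeta> \<otimes> (\<beta> \<otimes> m))" "R (\<zeta> \<otimes> (\<beta> \<otimes> m))"
    using \<zeta>(2) by (auto simp: late_index_def)
  note lb = late_bundle[OF m(1) \<beta> \<zeta>(2) \<xi>(1) \<eta>Z \<xi>(2), folded u_def g_def]
  have "bundle_value Z R M X a (\<zeta> \<otimes> (\<beta> \<otimes> m)) \<longleftrightarrow> \<zeta> \<otimes> \<beta> \<otimes> u \<in> a g"
    using value_bundle[OF g(1,2) lb(1)] J(4) lb(2) by simp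
  then show ?thesis using value_bundle[OF m \<zeta>(1) J(1)] \<zeta>(1,3) J by blast
qed

text \<open>A string violating an own or inherited constraint has at least \<open>s\<close> bits
  forced by the others, and there are fewer than \<open>2 ^ s\<close> constraints. The strings
  \<open>a\<close> of the other markers are arbitrary, so the greedy choice never gets
  stuck.\<close>

lemma good_strings_nonempty:
  assumes g: "g \<in> carrier G" "M g"
  shows "good_strings Z Q z R M X a g \<noteq> {}"
proof -
  define B where "B = {\<zeta> \<in> Z. R (\<zeta> \<otimes> g) \<and> \<not> M (\<zeta> \<otimes> g)}"
  have B: "finite B" "B \<subseteq> Z" using Z(1) by (auto simp: B_def)
  have IB: "I g \<beta> \<subseteq> B" for \<beta> by (auto simp: B_def bundle_index_def)
  have sB: "s \<le> card B"
    using card_I[OF g(1) one_closed] card_mono[OF B(1) IB[of \<one>]] by linarith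
  define own where "own \<beta> v \<longleftrightarrow> 2 * card (J g \<beta>) < card (I g \<beta>) \<and>
    (\<forall>\<zeta>\<in>Z. \<zeta> \<in> I g \<beta> \<longrightarrow> \<zeta> \<notin> J g \<beta> \<longrightarrow> (\<zeta> \<in> v) = early_value Z z R M X a g v (\<zeta> \<otimes> \<beta>))" for \<beta> v
  define pos where "pos = (\<lambda>(\<beta>, \<eta>, \<xi>). origin \<xi> \<eta> \<beta>)"
  define foreign where "foreign = (\<lambda>(\<beta>, \<eta>, \<xi>) v. let u = origin \<xi> \<eta> \<beta> in
     M (u \<otimes> g) \<and> z (u \<otimes> g) < z g \<and> card (I (u \<otimes> g) \<beta>) \<le> 2 * card (J (u \<otimes> g) \<beta>) \<and> \<eta> \<in> J (u \<otimes> g) \<beta> \<and>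
     (\<forall>\<zeta>\<in>Z. \<zeta> \<in> J (u \<otimes> g) \<beta> \<longrightarrow> (\<zeta> \<in> a (u \<otimes> g)) = (\<zeta> \<otimes> \<beta> \<otimes> u \<in> v)))"
  have own_le: "card {v \<in> Pow B. own \<beta> v} \<le> 2 ^ (card B - s)" if \<beta>: "\<beta> \<in> Q" for \<beta>
  proof (cases "2 * card (J g \<beta>) < card (I g \<beta>)")
    case True
    have c: "\<beta> \<in> carrier G" using Qc[OF \<beta>] .
    define D where "D = I g \<beta> - J g \<beta>"
    have DZ: "D \<subseteq> Z" using I_subset_Z by (auto simp: D_def)
    have "card D = card (I g \<beta>) - card (J g \<beta>)"
      unfolding D_def by (rule card_Diff_subset[OF finite_J J_subset_I])
    then have cD: "3 * s \<le> card D" using True card_I[OF g(1) c] by linarith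
    have "inj_on (\<lambda>\<zeta>. \<zeta> \<otimes> \<beta>) D"
      using DZ Zc c by (intro inj_onI) (simp add: subset_iff)
    moreover have "\<zeta> \<otimes> \<beta> \<noteq> \<zeta>" if "\<zeta> \<in> D" for \<zeta>
      using that DZ Zc c Q(3) \<beta> by (metis l_cancel_one subsetD)
    moreover have "finite D" using finite_I by (simp add: D_def)
    \<comment> \<open>No comparison has both sides in \<open>D0\<close>, so a violating string has
      each bit at an index in \<open>D0\<close> expressed by bits outside \<open>D0\<close>.\<close>
    ultimately obtain D0 where D0: "D0 \<subseteq> D" "D0 \<inter> (\<lambda>\<zeta>. \<zeta> \<otimes> \<beta>) ` D0 = {}" "card D \<le> 3 * card D0"
      using independent_subset[of D "\<lambda>\<zeta>. \<zeta> \<otimes> \<beta>"] by blast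
    show ?thesis
    proof (rule card_determined_le[OF B(1)])
      show "D0 \<subseteq> B" using D0(1) IB by (auto simp: D_def)
      show "s \<le> card D0" using D0(3) cD by linarith
      fix v v' assume "own \<beta> v" "own \<beta> v'" and eq: "v - D0 = v' - D0"
      have "\<zeta> \<in> v \<longleftrightarrow> \<zeta> \<in> v'" if "\<zeta> \<in> D0" for \<zeta>
      proof -
        have \<zeta>: "\<zeta> \<in> Z" "\<zeta> \<in> I g \<beta>" "\<zeta> \<notin> J g \<beta>" using that D0(1) DZ by (auto simp: D_def)
        have nin: "\<zeta> \<otimes> \<beta> \<notin> D0" using that D0(2) by blast
        have "inv \<xi> \<in> v \<longleftrightarrow> inv \<xi> \<in> v'" if "\<xi> \<otimes> (\<zeta> \<otimes> \<beta>) = \<one>" "\<xi> \<in> Z" for \<xi>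
        proof -
          have "inv \<xi> = \<zeta> \<otimes> \<beta>"
            using inv_equality[OF that(1)] Zc[OF that(2)] Zc[OF \<zeta>(1)] c inv_inv[of "\<zeta> \<otimes> \<beta>"] by simp
          then show ?thesis using nin eq by (metis DiffD1 DiffI)
        qed
        then have "early_value Z z R M X a g v (\<zeta> \<otimes> \<beta>) = early_value Z z R M X a g v' (\<zeta> \<otimes> \<beta>)"
          unfolding early_value_def by (auto split: if_splits)
        then show ?thesis using \<open>own \<beta> v\<close> \<open>own \<beta> v'\<close> \<zeta> unfolding own_def by blast
      qed
      then show "v \<inter> D0 = v' \<inter> D0" by blast
    qed
  next
    case False
    then show ?thesis by (simp add: own_def)
  qed
  have foreign_le: "card {v \<in> Pow B. foreign (\<beta>, \<eta>, \<xi>) v} \<le> 2 ^ (card B - s)"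
    if \<beta>: "\<beta> \<in> Q" and \<eta>: "\<eta> \<in> Z" and \<xi>: "\<xi> \<in> Z" for \<beta> \<eta> \<xi>
  proof -
    have c: "\<xi> \<in> carrier G" "\<eta> \<in> carrier G" "\<beta> \<in> carrier G" using \<xi> \<eta> \<beta> Zc Qc by auto
    define u where "u = origin \<xi> \<eta> \<beta>"
    define m where "m = u \<otimes> g"
    have uc: "u \<in> carrier G" using c by (simp add: u_def)
    have mc: "m \<in> carrier G" using uc g by (simp add: m_def)
    have gm: "\<xi> \<otimes> (\<eta> \<otimes> (\<beta> \<otimes> m)) = g"
      using c g(1) by (simp add: m_def u_def inv_mult_group m_assoc) (simp flip: m_assoc)
    show ?thesis
    proof (cases "M m \<and> z m < z g \<and> card (I m \<beta>) \<le> 2 * card (J m \<beta>) \<and> \<eta> \<in> J m \<beta>")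
      case True
      have lb: "\<zeta> \<otimes> \<beta> \<otimes> u \<in> Z" "\<zeta> \<otimes> \<beta> \<otimes> u \<otimes> g = \<zeta> \<otimes> (\<beta> \<otimes> m)" if "\<zeta> \<in> J m \<beta>" for \<zeta>
        using late_bundle[OF mc \<beta> that \<xi> \<eta>] gm g(2) by (simp_all add: u_def)
      have JZ: "J m \<beta> \<subseteq> Z" using J_subset_I I_subset_Z by blast
      show ?thesis
      \<comment> \<open>Here the forced bits are dictated by the earlier string \<open>a m\<close>
        outright, one for each late index of \<open>m\<close>, hence at least \<open>3 * s\<close>
        of them.\<close>
      proof (rule card_determined_le[OF B(1), where I = "(\<lambda>\<zeta>. \<zeta> \<otimes> \<beta> \<otimes> u) ` J m \<beta>"])
        show "(\<lambda>\<zeta>. \<zeta> \<otimes> \<beta> \<otimes> u) ` J m \<beta> \<subseteq> B"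
        proof (rule image_subsetI)
          fix \<zeta> assume \<zeta>: "\<zeta> \<in> J m \<beta>"
          then have "R (\<zeta> \<otimes> (\<beta> \<otimes> m)) \<and> \<not> M (\<zeta> \<otimes> (\<beta> \<otimes> m))" by (simp add: late_index_def)
          then show "\<zeta> \<otimes> \<beta> \<otimes> u \<in> B" using lb[OF \<zeta>] by (simp add: B_def)
        qed
        have "inj_on (\<lambda>\<zeta>. \<zeta> \<otimes> \<beta> \<otimes> u) (J m \<beta>)"
        proof (rule inj_onI)
          fix \<zeta> \<zeta>' assume "\<zeta> \<in> J m \<beta>" "\<zeta>' \<in> J m \<beta>" and eq: "\<zeta> \<otimes> \<beta> \<otimes> u = \<zeta>' \<otimes> \<beta> \<otimes> u"
          then have "\<zeta> \<in> carrier G" "\<zeta>' \<in> carrier G" using JZ Zc by blast+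
          then show "\<zeta> = \<zeta>'" using eq c(3) uc by simp
        qed
        then have "card ((\<lambda>\<zeta>. \<zeta> \<otimes> \<beta> \<otimes> u) ` J m \<beta>) = card (J m \<beta>)" by (rule card_image)
        then show "s \<le> card ((\<lambda>\<zeta>. \<zeta> \<otimes> \<beta> \<otimes> u) ` J m \<beta>)" using True card_I[OF mc c(3)] by linarith
        fix v v' assume f: "foreign (\<beta>, \<eta>, \<xi>) v" "foreign (\<beta>, \<eta>, \<xi>) v'"
        have "\<zeta> \<otimes> \<beta> \<otimes> u \<in> v \<longleftrightarrow> \<zeta> \<otimes> \<beta> \<otimes> u \<in> v'" if "\<zeta> \<in> J m \<beta>" for \<zeta>
          using f that JZ unfolding foreign_def Let_def prod.case u_def[symmetric] m_def[symmetric] by blast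
        then show "v \<inter> (\<lambda>\<zeta>. \<zeta> \<otimes> \<beta> \<otimes> u) ` J m \<beta> = v' \<inter> (\<lambda>\<zeta>. \<zeta> \<otimes> \<beta> \<otimes> u) ` J m \<beta>" by blast
      qed
    next
      case False
      then have "\<not> foreign (\<beta>, \<eta>, \<xi>) v" for v
        unfolding foreign_def Let_def prod.case u_def[symmetric] m_def[symmetric] by blast
      then show ?thesis by simp
    qed
  qed
  have "\<exists>v\<subseteq>B. \<forall>c\<in>Q <+> Q \<times> Z \<times> Z. \<not> case_sum own foreign c v"
  proof (rule avoid_bad_subsets[OF B(1) _ sB])
    show "finite (Q <+> Q \<times> Z \<times> Z)" using Q Z by simp
    show "card (Q <+> Q \<times> Z \<times> Z) < 2 ^ s"
      using few Q Z by (simp add: card_Plus card_cartesian_product mult.assoc)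
    fix c assume "c \<in> Q <+> Q \<times> Z \<times> Z"
    then show "card {v \<in> Pow B. case_sum own foreign c v} \<le> 2 ^ (card B - s)"
      using own_le foreign_le by auto
  qed
  then obtain v where vB: "v \<subseteq> B" and v: "\<forall>c\<in>Q <+> Q \<times> Z \<times> Z. \<not> case_sum own foreign c v"
    by blast
  have v_own: "\<not> own \<beta> v" if "\<beta> \<in> Q" for \<beta>
    using bspec[OF v InlI[OF that]] by simp
  have v_foreign: "\<not> foreign (\<beta>, \<eta>, \<xi>) v" if "\<beta> \<in> Q" "\<eta> \<in> Z" "\<xi> \<in> Z" for \<beta> \<eta> \<xi>
    using bspec[OF v InrI, of "(\<beta>, \<eta>, \<xi>)"] that by simp
  have "v \<in> good_strings Z Q z R M X a g"
    unfolding good_strings_def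
  proof (intro CollectI conjI ballI impI)
    show "v \<in> Pow Z" using vB B(2) by blast
  next
    fix \<beta> assume "\<beta> \<in> Q" "2 * card (J g \<beta>) < card (I g \<beta>)"
    then show "\<exists>\<zeta>\<in>Z. \<zeta> \<in> I g \<beta> \<and> \<zeta> \<notin> J g \<beta> \<and> (\<zeta> \<in> v) \<noteq> early_value Z z R M X a g v (\<zeta> \<otimes> \<beta>)"
      using v_own[of \<beta>] unfolding own_def by blast
  next
    fix \<beta> \<eta> \<xi> assume 1: "\<beta> \<in> Q" "\<eta> \<in> Z" "\<xi> \<in> Z"
    define u where "u = origin \<xi> \<eta> \<beta>"
    assume "M (origin \<xi> \<eta> \<beta> \<otimes> g) \<and> z (origin \<xi> \<eta> \<beta> \<otimes> g) < z g \<and>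
          card (I (origin \<xi> \<eta> \<beta> \<otimes> g) \<beta>) \<le> 2 * card (J (origin \<xi> \<eta> \<beta> \<otimes> g) \<beta>) \<and>
          \<eta> \<in> J (origin \<xi> \<eta> \<beta> \<otimes> g) \<beta>"
    then show "\<exists>\<zeta>'\<in>Z. \<zeta>' \<in> J (origin \<xi> \<eta> \<beta> \<otimes> g) \<beta> \<and>
             (\<zeta>' \<in> a (origin \<xi> \<eta> \<beta> \<otimes> g)) \<noteq> (\<zeta>' \<otimes> \<beta> \<otimes> origin \<xi> \<eta> \<beta> \<in> v)"
      using v_foreign[OF 1] unfolding foreign_def Let_def prod.case u_def[symmetric] by blast
  qed
  then show ?thesis by blast
qed

end

context group
begin

section \<open>One stage and its iteration\<close>

definition separates :: "'a set \<Rightarrow> 'a \<Rightarrow> ('a \<Rightarrow> 'c) \<Rightarrow> bool" where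
  "separates T \<gamma> y \<longleftrightarrow> (\<forall>g\<in>carrier G. \<exists>t\<in>T. y (t \<otimes> g) \<noteq> y (t \<otimes> (\<gamma> \<otimes> g)))"

text \<open>\<open>V'\<close>, \<open>T\<close> and \<open>K\<close> come before \<open>N\<close>
  and the rules, since they must serve all colorings at once. Quantifying over every
  \<open>y\<close> that agrees with \<open>X'\<close> off \<open>R'\<close> protects the separation
  from whatever later stages write.\<close>

definition stage_spec :: "'a set \<Rightarrow> 'a \<Rightarrow> 'a set \<Rightarrow> 'a set \<Rightarrow> 'a set \<Rightarrow> bool" where
  "stage_spec V \<gamma> V' T K \<longleftrightarrow>
    (\<forall>N. \<forall>R X :: ('a \<Rightarrow> nat) \<Rightarrow> 'a \<Rightarrow> bool. finitary R \<and> finitary X \<longrightarrow>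
      (\<exists>R' X' :: ('a \<Rightarrow> nat) \<Rightarrow> 'a \<Rightarrow> bool. finitary R' \<and> finitary X' \<and>
        (\<forall>z. proper K N z \<and> syndetic V (R z) \<longrightarrow>
          syndetic V' (R' z) \<and> (\<forall>g\<in>carrier G. R' z g \<longrightarrow> R z g) \<and>
          (\<forall>g\<in>carrier G. \<not> R z g \<longrightarrow> X' z g = X z g) \<and>
          (\<forall>y. (\<forall>g\<in>carrier G. \<not> R' z g \<longrightarrow> y g = X' z g) \<longrightarrow> separates T \<gamma> y))))"

text \<open>For a marker \<open>m = \<alpha> \<otimes> g\<close> one has \<open>\<alpha> \<otimes>
  (\<gamma> \<otimes> g) = \<beta> \<otimes> m\<close> with
  \<open>\<beta> = \<alpha> \<otimes> \<gamma> \<otimes> inv \<alpha>\<close>. So treating all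
  conjugates of \<gamma> by \<open>A\<close> at the markers treats \<gamma> everywhere.\<close>

lemma stage:
  assumes inf: "infinite (carrier G)" and V: "finite V" "V \<subseteq> carrier G" "V \<noteq> {}"
    and \<gamma>: "\<gamma> \<in> carrier G" "\<gamma> \<noteq> \<one>"
  shows "\<exists>V' T K. finite V' \<and> V' \<subseteq> carrier G \<and> V' \<noteq> {} \<and> finite T \<and> T \<subseteq> carrier G \<and>
    finite K \<and> K \<subseteq> carrier G \<and> stage_spec V \<gamma> V' T K"
proof -
  define \<nu> where "\<nu> = card V"
  have \<nu>: "\<nu> \<ge> 1" using V by (simp add: \<nu>_def card_gt_0_iff Suc_leI)
  \<comment> \<open>The number of constraints will be at most \<open>2 * \<nu> * w ^ 6\<close> with
    \<open>w = (12 * \<nu> + 1) * (s + 1)\<close>; this is the polynomial compared with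
    \<open>2 ^ s\<close>.\<close>
  obtain s where s: "(2 * \<nu> * (12 * \<nu> + 1) ^ 6) * (s + 1) ^ 6 < 2 ^ s"
    using poly_less_power_two[of "2 * \<nu> * (12 * \<nu> + 1) ^ 6" 6] unfolding eventually_sequentially by blast
  obtain Y where Y: "finite Y" "Y \<subseteq> carrier G" "card Y \<le> card V * (6 * s + 2)"
    "\<And>R g. syndetic V R \<Longrightarrow> g \<in> carrier G \<Longrightarrow> 6 * s + 2 \<le> card {\<zeta>\<in>Y. R (\<zeta> \<otimes> g)}"
    using many_returns[OF inf V(1,2), of "6 * s + 2"] by blast
  define Z where "Z = insert \<one> (Y \<union> (\<lambda>y. inv y) ` Y)"
  have Z: "finite Z" "Z \<subseteq> carrier G" "\<one> \<in> Z" "\<And>\<zeta>. \<zeta> \<in> Z \<Longrightarrow> inv \<zeta> \<in> Z"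
    using Y(1,2) by (auto simp: Z_def subset_iff)
  define w where "w = (12 * \<nu> + 1) * (s + 1)"
  have "card ((\<lambda>y. inv y) ` Y) \<le> card Y" using Y(1) by (rule card_image_le)
  moreover have "card Z \<le> Suc (card (Y \<union> (\<lambda>y. inv y) ` Y))" unfolding Z_def by (rule card_insert_le_m1) simp_all
  moreover have "card (Y \<union> (\<lambda>y. inv y) ` Y) \<le> card Y + card ((\<lambda>y. inv y) ` Y)" by (rule card_Un_le)
  ultimately have "card Z \<le> 2 * (\<nu> * (6 * s + 2)) + 1" using Y(3) by (simp add: \<nu>_def)
  also have "\<dots> \<le> w" using \<nu> by (simp add: w_def algebra_simps)
  finally have cZ: "card Z \<le> w" .
  \<comment> \<open>Fourth power, because \<open>disc\<close> compares two products of two elements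
    of \<open>Z\<close>, and their quotient is a product of four.\<close>
  define E where "E = set_pow G Z 4"
  have E: "finite E" "E \<subseteq> carrier G" "\<one> \<in> E" "card E \<le> w ^ 4"
    using Z card_set_pow_le[OF Z(1), of 4] cZ
    by (auto simp: E_def finite_set_pow one_in_set_pow intro: le_trans[OF _ power_mono] dest: subsetD[OF set_pow_closed])
  \<comment> \<open>An element of \<open>V\<close> leads from \<open>g\<close> to a free position,
    an element of \<open>E\<close> from there to a marker.\<close>
  define A where "A = E <#> V"
  have A: "finite A" "A \<subseteq> carrier G" "A \<noteq> {}"
    using E V by (auto simp: A_def finite_set_mult set_mult_closed) (auto simp: set_mult_def)
  have cA: "card A \<le> w ^ 4 * \<nu>"
    unfolding A_def \<nu>_def using card_set_mult_le[OF E(1) V(1)] E(4) by (meson le_trans mult_le_mono1)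
  define Q where "Q = (\<lambda>\<alpha>. \<alpha> \<otimes> \<gamma> \<otimes> inv \<alpha>) ` A"
  have Q: "finite Q" "Q \<subseteq> carrier G" using A \<gamma> by (auto simp: Q_def subset_iff)
  have Q1: "\<one> \<notin> Q"
  proof
    assume "\<one> \<in> Q"
    then obtain \<alpha> where "\<alpha> \<in> A" and eq: "\<alpha> \<otimes> \<gamma> \<otimes> inv \<alpha> = \<one>" by (auto simp: Q_def)
    then have \<alpha>: "\<alpha> \<in> carrier G" using A by blast
    have "\<alpha> \<otimes> \<gamma> = \<alpha> \<otimes> \<gamma> \<otimes> inv \<alpha> \<otimes> \<alpha>" using \<alpha> \<gamma> by (simp add: m_assoc)
    then have "\<alpha> \<otimes> \<gamma> = \<alpha> \<otimes> \<one>" using \<alpha> by (simp add: eq)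
    then show False using \<alpha> \<gamma> by (simp del: r_one)
  qed
  have cQ: "card Q \<le> w ^ 4 * \<nu>" using card_image_le[OF A(1)] cA unfolding Q_def by (meson le_trans)
  have "card Q + card Q * card Z * card Z \<le> w ^ 4 * \<nu> + w ^ 4 * \<nu> * w * w"
    using cQ cZ by (intro add_mono mult_mono) auto
  also have "\<dots> \<le> w ^ 6 * \<nu> + w ^ 6 * \<nu>"
  proof -
    have "w ^ 4 \<le> w ^ 6" by (rule power_increasing) (auto simp: w_def)
    moreover have "w ^ 4 * \<nu> * w * w = w ^ 6 * \<nu>" by (simp add: power_numeral_reduce)
    ultimately show ?thesis by (simp only: add_le_mono mult_le_mono1 order_refl)
  qed
  also have "\<dots> = (2 * \<nu> * (12 * \<nu> + 1) ^ 6) * (s + 1) ^ 6" by (simp only: w_def power_mult_distrib) simp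
  finally have few: "card Q + card Q * card Z * card Z < 2 ^ s" using s by (rule le_less_trans)
  \<comment> \<open>\<open>E\<close> serves the choice of markers; the products with
    \<open>Q\<close> give different colors to markers that interact in the greedy choice.\<close>
  define K where "K = E \<union> (Z <#> (Z <#> Q))"
  have K: "finite K" "K \<subseteq> carrier G"
    using E Z Q by (auto simp: K_def finite_set_mult dest: subsetD[OF set_mult_closed] intro: set_mult_closed[THEN subsetD])
  have mem2: "x \<otimes> y \<in> set_pow G Z 2" if "x \<in> Z" "y \<in> Z" for x y
    using set_pow_in_mult[OF Z(2), of x 1 y 1] that set_pow_one[OF Z(2)] by (simp add: numeral_2_eq_2)
  have inv_pow: "inv x \<in> set_pow G Z m" if "x \<in> set_pow G Z m" for x m
    using that
  proof (induction m arbitrary: x)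
    case (Suc m)
    then obtain a b where ab: "a \<in> Z" "b \<in> set_pow G Z m" "x = a \<otimes> b" by (auto simp: set_mult_def)
    then have c: "a \<in> carrier G" "b \<in> carrier G" using Z(2) set_pow_closed[OF Z(2)] by blast+
    have "inv b \<otimes> inv a \<in> set_pow G Z (m + 1)"
      using set_pow_in_mult[OF Z(2) Suc.IH[OF ab(2)], of "inv a" 1] Z(4)[OF ab(1)] set_pow_one[OF Z(2)] by simp
    then show ?case using c ab(3) by (simp only: inv_mult_group Suc_eq_plus1)
  qed simp
  have invE: "inv e \<in> E" if "e \<in> E" for e using inv_pow that by (simp add: E_def)
  define T where "T = Z <#> A"
  have T: "finite T" "T \<subseteq> carrier G"
    using Z A by (simp_all add: T_def finite_set_mult set_mult_closed)
  have "\<exists>R' X'. finitary R' \<and> finitary X' \<and>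
        (\<forall>z. proper K N z \<and> syndetic V (R z) \<longrightarrow>
          syndetic A (R' z) \<and> (\<forall>g\<in>carrier G. R' z g \<longrightarrow> R z g) \<and>
          (\<forall>g\<in>carrier G. \<not> R z g \<longrightarrow> X' z g = X z g) \<and>
          (\<forall>y. (\<forall>g\<in>carrier G. \<not> R' z g \<longrightarrow> y g = X' z g) \<longrightarrow>
             (\<forall>g\<in>carrier G. \<exists>t\<in>T. y (t \<otimes> g) \<noteq> y (t \<otimes> (\<gamma> \<otimes> g)))))"
    if R: "finitary R" and X: "finitary X" for N and R X :: "('a \<Rightarrow> nat) \<Rightarrow> 'a \<Rightarrow> bool"
  proof -
    obtain M where M: "finitary M"
      "\<And>z g. proper E N z \<Longrightarrow> g \<in> carrier G \<Longrightarrow> M z g \<Longrightarrow> R z g"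
      "\<And>z g e. proper E N z \<Longrightarrow> g \<in> carrier G \<Longrightarrow> M z g \<Longrightarrow> e \<in> E \<Longrightarrow> e \<noteq> \<one> \<Longrightarrow> \<not> M z (e \<otimes> g)"
      "\<And>z g. proper E N z \<Longrightarrow> g \<in> carrier G \<Longrightarrow> R z g \<Longrightarrow> \<exists>e\<in>insert \<one> E. M z (e \<otimes> g)"
      using maximal_discrete_rule[OF E(1,2) invE R, of N] by blast
    define OK where "OK = (\<lambda>s :: 'a \<Rightarrow> nat \<times> (bool \<times> bool \<times> bool) \<times> 'a set.
      good_strings Z Q (\<lambda>h. fst (s h)) (\<lambda>h. fst (fst (snd (s h)))) (\<lambda>h. fst (snd (fst (snd (s h)))))
        (\<lambda>h. snd (snd (fst (snd (s h))))) (\<lambda>h. snd (snd (s h))))"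
    define S where "S = (\<lambda>z g. (R z g, M z g, X z g))"
    have S: "finitary S" unfolding S_def by (rule finitary_app2[OF R finitary_app2[OF M(1) X]])
    have OK: "finitary OK" unfolding OK_def by (rule finitary_good_strings[OF Z(1,2) Q])
    have mask: "OK (\<lambda>h. (z h, s h, a h)) g = OK (\<lambda>h. (z h, s h, a' h)) g"
      if "g \<in> carrier G" "\<And>h. h \<in> carrier G \<Longrightarrow> z h < z g \<Longrightarrow> a h = a' h" for z s a a' g
      unfolding OK_def fst_conv snd_conv by (rule good_strings_mask[OF Z(2) Q(2) that])
    from finitary_greedy[where N = N, OF S OK mask]
    obtain B where B: "finitary B \<and> (\<forall>z. (\<forall>h\<in>carrier G. z h < N) \<longrightarrow> (\<forall>g\<in>carrier G.
        OK (\<lambda>h. (z h, S z h, B z h)) g \<noteq> {} \<longrightarrow> B z g \<in> OK (\<lambda>h. (z h, S z h, B z h)) g))"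
      by (rule exE)
    define X' where "X' z = bundle_value Z (R z) (M z) (X z) (B z)" for z
    have "finitary (\<lambda>z g. M z (\<xi> \<otimes> g) \<and> inv \<xi> \<in> B z (\<xi> \<otimes> g))" if "\<xi> \<in> Z" for \<xi>
      by (intro finitary_conj finitary_mem finitary_translate[OF M(1)] finitary_translate[OF conjunct1[OF B]])
        (use that Z(2) in blast)+
    then have X': "finitary X'"
      unfolding X'_def[abs_def] bundle_value_def by (intro finitary_if finitary_Bex R X Z(1))
    have "syndetic A (M z) \<and> (\<forall>g\<in>carrier G. M z g \<longrightarrow> R z g) \<and>
          (\<forall>g\<in>carrier G. \<not> R z g \<longrightarrow> X' z g = X z g) \<and>
          (\<forall>y. (\<forall>g\<in>carrier G. \<not> M z g \<longrightarrow> y g = X' z g) \<longrightarrow>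
             (\<forall>g\<in>carrier G. \<exists>t\<in>T. y (t \<otimes> g) \<noteq> y (t \<otimes> (\<gamma> \<otimes> g))))"
      if z: "proper K N z" and syn: "syndetic V (R z)" for z
    proof -
      have zE: "proper E N z" using proper_mono[OF z _ order_refl] by (simp add: K_def)
      interpret marker_configuration G Z Q s z "R z" "M z" "X z"
      proof unfold_locales
        fix h \<xi> \<zeta> \<xi>' \<zeta>'
        assume a: "h \<in> carrier G" "\<xi> \<in> Z" "\<zeta> \<in> Z" "\<xi>' \<in> Z" "\<zeta>' \<in> Z"
          and m: "M z (\<xi> \<otimes> \<zeta> \<otimes> h)" "M z (\<xi>' \<otimes> \<zeta>' \<otimes> h)"
        define x y where "x = \<xi> \<otimes> \<zeta>" and "y = \<xi>' \<otimes> \<zeta>'"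
        have c: "x \<in> carrier G" "y \<in> carrier G" using a Z(2) by (auto simp: x_def y_def)
        have "y \<otimes> inv x \<in> E"
          unfolding E_def using set_pow_in_mult[OF Z(2) mem2[OF a(4,5)] inv_pow[OF mem2[OF a(2,3)]]]
          by (simp add: x_def y_def)
        moreover have "y \<otimes> inv x \<otimes> (x \<otimes> h) = y \<otimes> h" using c a(1) by (simp add: m_assoc) (simp flip: m_assoc)
        ultimately have "y \<otimes> inv x = \<one>"
          using M(3)[OF zE _ _, of "x \<otimes> h" "y \<otimes> inv x"] m c a(1) unfolding x_def[symmetric] y_def[symmetric] by auto
        then show "\<xi> \<otimes> \<zeta> = \<xi>' \<otimes> \<zeta>'" unfolding x_def[symmetric] y_def[symmetric]
          using c by (metis inv_solve_right' l_one one_closed)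
      next
        fix m \<xi> \<zeta> \<beta> assume a: "m \<in> carrier G" "\<xi> \<in> Z" "\<zeta> \<in> Z" "\<beta> \<in> Q" "\<xi> \<otimes> (\<zeta> \<otimes> \<beta>) \<noteq> \<one>"
        have "\<xi> \<otimes> (\<zeta> \<otimes> \<beta>) \<in> K" using a unfolding K_def set_mult_def by blast
        then show "z (\<xi> \<otimes> (\<zeta> \<otimes> \<beta>) \<otimes> m) \<noteq> z m" using z a(1,5) unfolding proper_def by blast
      next
        fix g assume g: "g \<in> carrier G"
        have "card {\<zeta>\<in>Y. R z (\<zeta> \<otimes> g)} \<le> card {\<zeta>\<in>Z. R z (\<zeta> \<otimes> g)}"
          using Z(1) by (intro card_mono) (auto simp: Z_def)
        then show "6 * s + 2 \<le> card {\<zeta>\<in>Z. R z (\<zeta> \<otimes> g)}" using Y(4)[OF syn g] by linarith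
      qed (use Z Q Q1 few M(2)[OF zE] in auto)
      have synA: "syndetic A (M z)"
        unfolding syndetic_def
      proof
        fix g assume g: "g \<in> carrier G"
        obtain v where v: "v \<in> V" "R z (v \<otimes> g)" using syn g unfolding syndetic_def by blast
        have vc: "v \<in> carrier G" using v V by blast
        obtain e where e: "e \<in> E" "M z (e \<otimes> (v \<otimes> g))" using M(4)[OF zE _ v(2)] vc g E(3) by auto
        have "e \<otimes> v \<otimes> g = e \<otimes> (v \<otimes> g)" using e E vc g by (intro m_assoc) auto
        moreover have "e \<otimes> v \<in> A" using e v unfolding A_def set_mult_def by blast
        ultimately show "\<exists>v\<in>A. M z (v \<otimes> g)" using e(2) by metis
      qed
      have good: "B z g \<in> good_strings Z Q z (R z) (M z) (X z) (B z) g" if g: "g \<in> carrier G" "M z g" for g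
      proof -
        have eq: "OK (\<lambda>h. (z h, S z h, B z h)) g = good_strings Z Q z (R z) (M z) (X z) (B z) g"
          by (simp add: OK_def S_def)
        have N: "\<forall>h\<in>carrier G. z h < N" using z by (simp add: proper_def)
        have "OK (\<lambda>h. (z h, S z h, B z h)) g \<noteq> {}"
          unfolding eq by (rule good_strings_nonempty[OF g])
        from conjunct2[OF B, rule_format, OF bspec[OF N] g(1) this] show ?thesis unfolding eq .
      qed
      have "\<exists>t\<in>T. y (t \<otimes> g) \<noteq> y (t \<otimes> (\<gamma> \<otimes> g))"
        if y: "\<forall>g\<in>carrier G. \<not> M z g \<longrightarrow> y g = X' z g" and g: "g \<in> carrier G" for y g
      proof -
        obtain \<alpha> where \<alpha>: "\<alpha> \<in> A" "M z (\<alpha> \<otimes> g)" using synA g unfolding syndetic_def by blast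
        have \<alpha>c: "\<alpha> \<in> carrier G" using \<alpha> A by blast
        define m where "m = \<alpha> \<otimes> g"
        define \<beta> where "\<beta> = \<alpha> \<otimes> \<gamma> \<otimes> inv \<alpha>"
        have m: "m \<in> carrier G" "M z m" using \<alpha> \<alpha>c g by (auto simp: m_def)
        have \<beta>: "\<beta> \<in> Q" "\<beta> \<in> carrier G" using \<alpha> \<alpha>c \<gamma> by (auto simp: \<beta>_def Q_def)
        have \<beta>m: "\<beta> \<otimes> m = \<alpha> \<otimes> (\<gamma> \<otimes> g)"
          using \<alpha>c \<gamma> g by (simp add: \<beta>_def m_def m_assoc) (simp flip: m_assoc)
        obtain \<zeta> where \<zeta>: "\<zeta> \<in> Z" "\<not> M z (\<zeta> \<otimes> m)" "\<not> M z (\<zeta> \<otimes> (\<beta> \<otimes> m))"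
          "X' z (\<zeta> \<otimes> m) \<noteq> X' z (\<zeta> \<otimes> (\<beta> \<otimes> m))"
          using separated[of "B z", OF good m \<beta>(1)] unfolding X'_def by blast
        have \<zeta>c: "\<zeta> \<in> carrier G" using \<zeta>(1) Z(2) by blast
        have "y (\<zeta> \<otimes> m) \<noteq> y (\<zeta> \<otimes> (\<beta> \<otimes> m))" using y \<zeta> \<zeta>c m(1) \<beta>(2) by simp
        moreover have "\<zeta> \<otimes> m = \<zeta> \<otimes> \<alpha> \<otimes> g" "\<zeta> \<otimes> (\<beta> \<otimes> m) = \<zeta> \<otimes> \<alpha> \<otimes> (\<gamma> \<otimes> g)"
          using \<zeta>c \<alpha>c g \<gamma>(1) unfolding \<beta>m by (simp_all add: m_def m_assoc)
        moreover have "\<zeta> \<otimes> \<alpha> \<in> T" using \<zeta>(1) \<alpha>(1) unfolding T_def set_mult_def by blast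
        ultimately show ?thesis by metis
      qed
      moreover have "X' z g = X z g" if "\<not> R z g" for g
        using that by (simp add: X'_def bundle_value_def)
      ultimately show ?thesis using synA M(2)[OF zE] by (intro conjI ballI allI impI)
    qed
    note key = this
    \<comment> \<open>The markers are the free positions handed to the next stage.\<close>
    show ?thesis
      by (rule exI[of _ M], rule exI[of _ X'], rule conjI[OF M(1) conjI[OF X']], intro allI impI, elim conjE)
        (rule key)
  qed
  note key = this
  have "stage_spec V \<gamma> A T K"
    unfolding stage_spec_def separates_def by (intro allI impI, elim conjE) (rule key)
  with A T K show ?thesis
    by (intro exI[of _ A] exI[of _ T] exI[of _ K]) simp
qed

end

section \<open>A compact free subshift\<close>

context group
begin

text \<open>Each stage takes the syndeticity window left by the previous one, hence dependent
  choice; \<open>V 0 = {\<one>}\<close> says that at first every position is free.\<close>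

lemma stage_sequence:
  fixes \<gamma> :: "nat \<Rightarrow> 'a"
  assumes inf: "infinite (carrier G)" and \<gamma>: "\<And>j. \<gamma> j \<in> carrier G" "\<And>j. \<gamma> j \<noteq> \<one>"
  shows "\<exists>V T K. V 0 = {\<one>} \<and>
    (\<forall>j. finite (T j) \<and> T j \<subseteq> carrier G \<and> finite (K j) \<and> K j \<subseteq> carrier G) \<and>
    (\<forall>j. stage_spec (V j) (\<gamma> j) (V (Suc j)) (T j) (K j))"
proof -
  define P where "P = (\<lambda>(V, T, K). finite V \<and> V \<subseteq> carrier G \<and> V \<noteq> {} \<and>
    finite T \<and> T \<subseteq> carrier G \<and> finite K \<and> K \<subseteq> carrier G)"
  define Q where "Q j = (\<lambda>(V, T :: 'a set, K :: 'a set) (V', T', K'). stage_spec V (\<gamma> j) V' T' K')" for j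
  have "\<exists>s. \<forall>j. (P (s j) \<and> (j = 0 \<longrightarrow> fst (s j) = {\<one>})) \<and> Q j (s j) (s (Suc j))"
  proof (rule dependent_nat_choice[of "\<lambda>j s. P s \<and> (j = 0 \<longrightarrow> fst s = {\<one>})" Q])
    show "\<exists>x. P x \<and> (0 = (0::nat) \<longrightarrow> fst x = {\<one>})"
      by (intro exI[of _ "({\<one>}, {}, {})"]) (simp add: P_def)
    fix x and j :: nat assume "P x \<and> (j = 0 \<longrightarrow> fst x = {\<one>})"
    moreover obtain V T K where "x = (V, T, K)" by (cases x)
    ultimately have x: "x = (V, T, K)" and V: "finite V" "V \<subseteq> carrier G" "V \<noteq> {}" by (auto simp: P_def)
    from stage[OF inf V \<gamma>[of j]]
    obtain V' T' K' where "P (V', T', K')" "stage_spec V (\<gamma> j) V' T' K'"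
      by (elim exE conjE) (rule that, simp_all add: P_def)
    then show "\<exists>y. (P y \<and> (Suc j = 0 \<longrightarrow> fst y = {\<one>})) \<and> Q j x y"
      by (intro exI[of _ "(V', T', K')"]) (simp add: Q_def x)
  qed
  then obtain s where s: "\<And>j. P (s j)" "fst (s 0) = {\<one>}" "\<And>j. Q j (s j) (s (Suc j))" by blast
  show ?thesis
  \<comment> \<open>The state at \<open>Suc j\<close> holds the sets produced by stage
    \<open>j\<close>, hence the index shift for \<open>T\<close> and \<open>K\<close>.\<close>
  proof (rule exI[of _ "\<lambda>j. fst (s j)"], rule exI[of _ "\<lambda>j. fst (snd (s (Suc j)))"],
      rule exI[of _ "\<lambda>j. snd (snd (s (Suc j)))"], intro conjI allI)
    fix j
    show "finite (fst (snd (s (Suc j))))" "fst (snd (s (Suc j))) \<subseteq> carrier G"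
        "finite (snd (snd (s (Suc j))))" "snd (snd (s (Suc j))) \<subseteq> carrier G"
      using s(1)[of "Suc j"] by (simp_all add: P_def case_prod_beta)
    show "stage_spec (fst (s j)) (\<gamma> j) (fst (s (Suc j))) (fst (snd (s (Suc j)))) (snd (snd (s (Suc j))))"
      using s(3)[of j] by (simp add: Q_def case_prod_beta)
  qed (rule s(2))
qed

text \<open>Earlier separations persist: \<open>X'\<close> equals \<open>X\<close> off
  \<open>R\<close> and \<open>R'\<close> shrinks \<open>R\<close>, so any \<open>y\<close> agreeing
  with \<open>X'\<close> off \<open>R'\<close> agrees with \<open>X\<close> off
  \<open>R\<close>.\<close>

lemma iterated_stages:
  assumes V: "V 0 = {\<one>}" and spec: "\<And>j. stage_spec (V j) (\<gamma> j) (V (Suc j)) (T j) (K j)"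
  shows "\<exists>R X :: ('a \<Rightarrow> nat) \<Rightarrow> 'a \<Rightarrow> bool. finitary R \<and> finitary X \<and>
    (\<forall>z. proper (\<Union>j<m. K j) N z \<longrightarrow> syndetic (V m) (R z) \<and>
      (\<forall>y. (\<forall>g\<in>carrier G. \<not> R z g \<longrightarrow> y g = X z g) \<longrightarrow> (\<forall>j<m. separates (T j) (\<gamma> j) y)))"
proof (induction m)
  case 0
  show ?case
    by (rule exI[of _ "\<lambda>z g. True"], rule exI[of _ "\<lambda>z g. True"])
      (simp add: finitary_const syndetic_def V)
next
  case (Suc m)
  then obtain R X :: "('a \<Rightarrow> nat) \<Rightarrow> 'a \<Rightarrow> bool" where fin: "finitary R" "finitary X" and RX:
    "\<And>z. proper (\<Union>j<m. K j) N z \<Longrightarrow> syndetic (V m) (R z) \<and>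
      (\<forall>y. (\<forall>g\<in>carrier G. \<not> R z g \<longrightarrow> y g = X z g) \<longrightarrow> (\<forall>j<m. separates (T j) (\<gamma> j) y))" by blast
  from spec[of m, unfolded stage_spec_def, rule_format, OF conjI[OF fin], of N]
  obtain R' X' :: "('a \<Rightarrow> nat) \<Rightarrow> 'a \<Rightarrow> bool" where RX': "finitary R' \<and> finitary X' \<and>
     (\<forall>z. proper (K m) N z \<and> syndetic (V m) (R z) \<longrightarrow>
       syndetic (V (Suc m)) (R' z) \<and> (\<forall>g\<in>carrier G. R' z g \<longrightarrow> R z g) \<and>
       (\<forall>g\<in>carrier G. \<not> R z g \<longrightarrow> X' z g = X z g) \<and>
       (\<forall>y. (\<forall>g\<in>carrier G. \<not> R' z g \<longrightarrow> y g = X' z g) \<longrightarrow> separates (T m) (\<gamma> m) y))"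
    by (elim exE) (rule that)
  have "syndetic (V (Suc m)) (R' z) \<and>
      (\<forall>y. (\<forall>g\<in>carrier G. \<not> R' z g \<longrightarrow> y g = X' z g) \<longrightarrow> (\<forall>j<Suc m. separates (T j) (\<gamma> j) y))"
    if z: "proper (\<Union>j<Suc m. K j) N z" for z
  proof -
    have "proper (\<Union>j<m. K j) N z" "proper (K m) N z"
      by (auto intro!: proper_mono[OF z] simp: lessThan_Suc)
    note z = this
    note 1 = RX[OF z(1)]
    note 2 = conjunct2[OF conjunct2[OF RX'], rule_format, OF conjI[OF z(2) conjunct1[OF 1]]]
    have "separates (T j) (\<gamma> j) y"
      if y: "\<forall>g\<in>carrier G. \<not> R' z g \<longrightarrow> y g = X' z g" and j: "j < Suc m" for y j
    proof (cases "j = m")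
      case True
      then show ?thesis using 2 y by blast
    next
      case False
      have "\<forall>g\<in>carrier G. \<not> R z g \<longrightarrow> y g = X z g" using 2 y by metis
      then show ?thesis using 1 j False by (metis less_SucE)
    qed
    then show ?thesis using conjunct1[OF 2] by blast
  qed
  note step = this
  show ?case
    by (rule exI[of _ R'], rule exI[of _ X'], intro conjI allI impI)
      (use RX' step in blast)+
qed

abbreviation separating_rule ::
    "(nat \<Rightarrow> 'a set) \<Rightarrow> (nat \<Rightarrow> 'a) \<Rightarrow> nat \<Rightarrow> 'a set \<Rightarrow> 'a set \<Rightarrow> nat \<Rightarrow> bool" where
  "separating_rule T \<gamma> m U K n \<equiv> \<exists>\<Theta> :: ('a \<Rightarrow> nat) \<Rightarrow> 'a \<Rightarrow> bool.
     local_rule (set_pow G (insert \<one> K) (2 * log_star n) <#> U) \<Theta> \<and>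
     (\<forall>c. proper K n c \<longrightarrow> (\<forall>j<m. separates (T j) (\<gamma> j) (\<Theta> c)))"

abbreviation separating_window :: "(nat \<Rightarrow> 'a set) \<Rightarrow> (nat \<Rightarrow> 'a) \<Rightarrow> nat \<Rightarrow> bool" where
  "separating_window T \<gamma> m \<equiv> \<exists>U K. finite U \<and> U \<subseteq> carrier G \<and> finite K \<and> K \<subseteq> carrier G \<and>
     (\<forall>n. separating_rule T \<gamma> m U K n)"

text \<open>\<open>T\<close> comes before \<open>m\<close>, and \<open>U\<close> and
  \<open>K\<close> before \<open>n\<close>. The number \<open>N\<close> to which colors get reduced
  is known from the size of \<open>L\<close>, so the rule \<open>X\<close> is built for it in
  advance and \<open>n\<close> enters only through the rounds of reduction.\<close>

lemma separating_rules:
  fixes \<gamma> :: "nat \<Rightarrow> 'a"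
  assumes inf: "infinite (carrier G)" and \<gamma>: "\<And>j. \<gamma> j \<in> carrier G" "\<And>j. \<gamma> j \<noteq> \<one>"
  shows "\<exists>T. (\<forall>j. finite (T j) \<and> T j \<subseteq> carrier G) \<and>
    (\<forall>m. separating_window T \<gamma> m)"
proof -
  from stage_sequence[of \<gamma>, OF inf \<gamma>]
  obtain V T K where VTK: "V 0 = {\<one>} \<and>
    (\<forall>j. finite (T j) \<and> T j \<subseteq> carrier G \<and> finite (K j) \<and> K j \<subseteq> carrier G) \<and>
    (\<forall>j. stage_spec (V j) (\<gamma> j) (V (Suc j)) (T j) (K j))"
    by (elim exE) (rule that)
  then have V: "V 0 = {\<one>}"
    and TK: "\<And>j. finite (T j) \<and> T j \<subseteq> carrier G \<and> finite (K j) \<and> K j \<subseteq> carrier G"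
    and spec: "\<And>j. stage_spec (V j) (\<gamma> j) (V (Suc j)) (T j) (K j)"
    by simp_all
  have "separating_window T \<gamma> m" for m
  proof -
    define L where "L = (\<Union>j<m. K j)"
    have L: "finite L" "L \<subseteq> carrier G" using TK by (auto simp: L_def)
    obtain N where N: "\<And>K n m. finite K \<Longrightarrow> K \<subseteq> carrier G \<Longrightarrow> card K = card L \<Longrightarrow> (log 2 ^^ m) (real n) \<le> 1 \<Longrightarrow>
       reduces K m n N"
      using color_reduction[of "card L"] by blast
    from iterated_stages[of V \<gamma> T K, OF V spec, of m N]
    obtain R X :: "('a \<Rightarrow> nat) \<Rightarrow> 'a \<Rightarrow> bool" where RX: "finitary R \<and> finitary X \<and>
      (\<forall>z. proper (\<Union>j<m. K j) N z \<longrightarrow> syndetic (V m) (R z) \<and>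
        (\<forall>y. (\<forall>g\<in>carrier G. \<not> R z g \<longrightarrow> y g = X z g) \<longrightarrow> (\<forall>j<m. separates (T j) (\<gamma> j) y)))"
      by (elim exE) (rule that)
    have X: "\<forall>j<m. separates (T j) (\<gamma> j) (X z)" if "proper L N z" for z
      using conjunct2[OF conjunct2[OF RX], rule_format, OF that[unfolded L_def]] by simp
    have "finitary X" using RX by simp
    then obtain U where U: "finite U" "U \<subseteq> carrier G" "local_rule U X" unfolding finitary_def by blast
    have "separating_rule T \<gamma> m U L n" for n
    proof -
      obtain \<Psi> where \<Psi>: "local_rule (set_pow G (insert \<one> L) (2 * log_star n)) \<Psi>"
        "\<And>c. proper L n c \<Longrightarrow> proper L N (\<Psi> c)"
        using N[OF L refl log_star] by blast
      have "local_rule (set_pow G (insert \<one> L) (2 * log_star n) <#> U) (\<lambda>c. X (\<Psi> c))"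
        using L by (intro local_rule_comp \<Psi>(1) U set_pow_closed) auto
      moreover have "\<forall>j<m. separates (T j) (\<gamma> j) (X (\<Psi> c))" if "proper L n c" for c
        by (rule X[OF \<Psi>(2)[OF that]])
      ultimately show ?thesis by (intro exI[of _ "\<lambda>c. X (\<Psi> c)"]) simp
    qed
    then show ?thesis using U(1,2) L by (intro exI[of _ U] exI[of _ L]) simp
  qed
  note main = this
  show ?thesis by (rule exI[of _ T], intro conjI allI main) (simp_all add: TK)
qed

section \<open>Cylinders, compactness and freeness in the Cantor space\<close>

abbreviation Cantor :: "('a \<Rightarrow> nat) set" where
  "Cantor \<equiv> topspace (two_pow G)"

lemma topspace_two_pow: "Cantor = carrier G \<rightarrow>\<^sub>E {..<2}"
  by (simp add: two_pow_def)

lemma openin_cylinder: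
  assumes "finite B" "B \<subseteq> carrier G"
  shows "openin (two_pow G) {x \<in> Cantor. \<forall>b\<in>B. x b = v b}"
  using assms
proof (induction B)
  case empty
  then show ?case by simp
next
  case (insert b B)
  have "continuous_map (two_pow G) (discrete_topology {..<2}) (\<lambda>x. x b)"
    unfolding two_pow_def using insert.prems by (intro continuous_map_product_projection) auto
  from openin_continuous_map_preimage[OF this, of "{v b} \<inter> {..<2}"]
  have "openin (two_pow G) {x \<in> Cantor. x b \<in> {v b} \<inter> {..<2}}" by simp
  also have "{x \<in> Cantor. x b \<in> {v b} \<inter> {..<2}} = {x \<in> Cantor. x b = v b}"
    using insert.prems by (auto simp: topspace_two_pow PiE_iff)
  finally have "openin (two_pow G) ({x \<in> Cantor. x b = v b} \<inter>
      {x \<in> Cantor. \<forall>b\<in>B. x b = v b})"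
    using insert by (intro openin_Int) auto
  then show ?case by (rule back_subst[of "openin (two_pow G)"]) auto
qed

lemma finite_cylinder_cover:
  assumes B: "\<And>x. x \<in> Cantor \<Longrightarrow> finite (B x) \<and> B x \<subseteq> carrier G"
  obtains D where "finite D" "D \<subseteq> Cantor"
    "\<And>x. x \<in> Cantor \<Longrightarrow> \<exists>d\<in>D. \<forall>b\<in>B d. x b = d b"
proof -
  define C where "C d = {x \<in> Cantor. \<forall>b\<in>B d. x b = d b}" for d
  have "compact_space (two_pow G)"
    unfolding two_pow_def by (simp add: compact_space_product_topology compact_space_discrete_topology)
  moreover have "openin (two_pow G) (C d)" if "d \<in> Cantor" for d
    using openin_cylinder B[OF that] by (simp add: C_def)
  moreover have "Cantor \<subseteq> \<Union>(C ` Cantor)" by (auto simp: C_def)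
  ultimately obtain \<F> where "finite \<F>" "\<F> \<subseteq> C ` Cantor" "Cantor \<subseteq> \<Union>\<F>"
    unfolding compact_space_alt by (metis (no_types, lifting) imageE)
  then obtain D where "finite D" "D \<subseteq> Cantor" "Cantor \<subseteq> \<Union>(C ` D)"
    by (metis finite_subset_image)
  then show ?thesis using that[of D] by (fastforce simp: C_def subset_iff)
qed

lemma cylinder_base:
  assumes "openin (two_pow G) A" "x \<in> A"
  shows "\<exists>B. finite B \<and> B \<subseteq> carrier G \<and> {y \<in> Cantor. \<forall>b\<in>B. y b = x b} \<subseteq> A"
proof -
  obtain U where U: "finite {i \<in> carrier G. U i \<noteq> {..<2}}" "x \<in> Pi\<^sub>E (carrier G) U" "Pi\<^sub>E (carrier G) U \<subseteq> A"
    using assms unfolding two_pow_def openin_product_topology_alt by auto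
  have "y \<in> Pi\<^sub>E (carrier G) U"
    if y: "y \<in> carrier G \<rightarrow>\<^sub>E {..<2}" "\<forall>b\<in>{i \<in> carrier G. U i \<noteq> {..<2}}. y b = x b" for y
  proof -
    have "y i \<in> U i" if "i \<in> carrier G" for i
      using that y U(2) by (cases "U i = {..<2}") (auto simp: PiE_iff)
    then show ?thesis using y by (auto simp: PiE_iff)
  qed
  then have "{y \<in> Cantor. \<forall>b\<in>{i \<in> carrier G. U i \<noteq> {..<2}}. y b = x b} \<subseteq> A"
    using U(3) unfolding topspace_two_pow by blast
  then show ?thesis
    using U(1) by (intro exI[of _ "{i \<in> carrier G. U i \<noteq> {..<2}}"]) auto
qed

lemma topspace_Free: "topspace (Free_two_pow G) = free_points G"
  by (auto simp: Free_two_pow_def free_points_def)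

lemma free_points_subset: "free_points G \<subseteq> Cantor"
  by (auto simp: free_points_def)

lemma continuous_Free_local:
  assumes f: "continuous_map (Free_two_pow G) (discrete_topology {..<k}) f"
    and x: "x \<in> free_points G"
  shows "\<exists>W. finite W \<and> W \<subseteq> carrier G \<and>
    (\<forall>y\<in>free_points G. (\<forall>w\<in>W. y w = x w) \<longrightarrow> f y = f x)"
proof -
  have "f x \<in> {..<k}" using f x by (auto simp: continuous_map_def topspace_Free)
  then have "openin (Free_two_pow G) {y \<in> free_points G. f y \<in> {f x}}"
    using openin_continuous_map_preimage[OF f, of "{f x}"] by (simp add: topspace_Free)
  then obtain A where A: "openin (two_pow G) A" "{y \<in> free_points G. f y \<in> {f x}} = A \<inter> free_points G"
    unfolding Free_two_pow_def openin_subtopology by blast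
  have "x \<in> A" using A(2) x by blast
  then obtain W where W: "finite W" "W \<subseteq> carrier G" "{y \<in> Cantor. \<forall>b\<in>W. y b = x b} \<subseteq> A"
    using cylinder_base[OF A(1)] by blast
  have "f y = f x" if y: "y \<in> free_points G" "\<forall>w\<in>W. y w = x w" for y
  proof -
    have "y \<in> A" using y W(3) free_points_subset by blast
    then show ?thesis using A(2) y(1) by blast
  qed
  then show ?thesis using W(1,2) by (intro exI[of _ W] conjI ballI impI)
qed

lemma shift_apply:
  "x \<in> Cantor \<Longrightarrow> d \<in> carrier G \<Longrightarrow> shift G g x d = x (d \<otimes> g)"
  by (simp add: shift_def)

lemma shift_closed:
  "x \<in> Cantor \<Longrightarrow> g \<in> carrier G \<Longrightarrow> shift G g x \<in> Cantor"
  by (auto simp: shift_def topspace_two_pow PiE_iff)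

lemma shift_one: "x \<in> Cantor \<Longrightarrow> shift G \<one> x = x"
  by (auto simp: shift_def topspace_two_pow fun_eq_iff PiE_iff extensional_def)

text \<open>Separation at position \<one> already exhibits a coordinate where \<open>x\<close> and
  its shift by \<open>h\<close> differ.\<close>

lemma separated_imp_free:
  assumes x: "x \<in> Cantor"
    and sep: "\<And>h. h \<in> carrier G \<Longrightarrow> h \<noteq> \<one> \<Longrightarrow> \<exists>T\<subseteq>carrier G. separates T h x"
  shows "x \<in> free_points G"
proof -
  have "h = \<one>" if h: "h \<in> carrier G" "shift G h x = x" for h
  proof (rule ccontr)
    assume "h \<noteq> \<one>"
    then obtain T where T: "T \<subseteq> carrier G" "separates T h x" using sep h by blast
    then obtain t where "t \<in> T" "x (t \<otimes> \<one>) \<noteq> x (t \<otimes> (h \<otimes> \<one>))" unfolding separates_def by blast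
    moreover from this have "t \<in> carrier G" using T by blast
    ultimately show False using shift_apply[OF x, of t h] h by simp
  qed
  moreover have "shift G \<one> x = x" using x by (rule shift_one)
  ultimately show ?thesis using x by (auto simp: free_points_def stabilizer_def)
qed

abbreviation avoiding_rule :: "(nat \<Rightarrow> 'a set) \<Rightarrow> (nat \<Rightarrow> 'a) \<Rightarrow> nat \<Rightarrow> ('a \<rightharpoonup> nat) set \<Rightarrow>
    nat \<Rightarrow> 'a set \<Rightarrow> (('a \<Rightarrow> bool) \<Rightarrow> 'a \<Rightarrow> nat) \<Rightarrow> bool" where
  "avoiding_rule T \<gamma> k P m W \<Phi> \<equiv> finite W \<and> W \<subseteq> carrier G \<and> local_rule W \<Phi> \<and>
     (\<forall>x g. \<Phi> x g < k) \<and>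
     (\<forall>x. (\<forall>j<m. separates (T j) (\<gamma> j) x) \<longrightarrow>
        (\<forall>p\<in>P. \<forall>g\<in>carrier G. \<exists>d\<in>dom p. p d \<noteq> Some (\<Phi> x (d \<otimes> g))))"

text \<open>Compactness is used twice: continuity of \<open>f\<close> on \<Omega> becomes a uniform
  window \<open>W\<close>, and a configuration obeying the first \<open>m\<close> conditions agrees
  with a true point of \<Omega> on the window \<open>B\<close> of all patterns. The rule reads
  \<open>f\<close> at such points, so a pattern in its output would occur in
  \<open>f\<close>.\<close>

lemma coloring_rule_from_Free:
  fixes \<gamma> :: "nat \<Rightarrow> 'a"
  assumes \<gamma>: "range \<gamma> = carrier G - {\<one>}" and T: "\<And>j. finite (T j) \<and> T j \<subseteq> carrier G"
    and P: "finite P" "\<And>p. p \<in> P \<Longrightarrow> is_pattern G k p" and k: "k \<ge> 1"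
    and adm: "admits_continuous_avoiding_coloring (Free_two_pow G) (free_shift G) k P"
  shows "\<exists>m W. \<exists>\<Phi> :: ('a \<Rightarrow> bool) \<Rightarrow> 'a \<Rightarrow> nat. avoiding_rule T \<gamma> k P m W \<Phi>"
proof -
  note top = topspace_Free
  obtain f where f: "continuous_map (Free_two_pow G) (discrete_topology {..<k}) f"
    and avoid: "\<And>p. p \<in> P \<Longrightarrow> \<not> occurs_in_space (Free_two_pow G) (free_shift G) p f"
    using adm unfolding admits_continuous_avoiding_coloring_def by blast
  have fk: "f x < k" if "x \<in> free_points G" for x using f that top by (auto simp: continuous_map_def)
  have \<gamma>c: "\<gamma> j \<in> carrier G" for j using \<gamma> by blast
  define \<Omega> where "\<Omega> = {x \<in> Cantor. \<forall>j. separates (T j) (\<gamma> j) x}"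
  have \<Omega>_free: "x \<in> free_points G" if "x \<in> \<Omega>" for x
  proof (rule separated_imp_free)
    show "x \<in> Cantor" using that by (simp add: \<Omega>_def)
    fix h assume "h \<in> carrier G" "h \<noteq> \<one>"
    then obtain j where "h = \<gamma> j" using \<gamma> by blast
    then show "\<exists>T\<subseteq>carrier G. separates T h x" using that T by (auto simp: \<Omega>_def)
  qed
  have sep_shift: "separates (T j) (\<gamma> j) (shift G g x)"
    if x: "x \<in> Cantor" and sep: "separates (T j) (\<gamma> j) x" and g: "g \<in> carrier G" for j x g
    unfolding separates_def
  proof
    fix h assume h: "h \<in> carrier G"
    then obtain t where t: "t \<in> T j" "x (t \<otimes> (h \<otimes> g)) \<noteq> x (t \<otimes> (\<gamma> j \<otimes> (h \<otimes> g)))"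
      using bspec[OF sep[unfolded separates_def], of "h \<otimes> g"] g h by blast
    have "t \<in> carrier G" using t T by blast
    then show "\<exists>t\<in>T j. shift G g x (t \<otimes> h) \<noteq> shift G g x (t \<otimes> (\<gamma> j \<otimes> h))"
      using t g h \<gamma>c x by (intro bexI[of _ t]) (simp_all add: shift_apply m_assoc)
  qed
  have \<Omega>_shift: "shift G g x \<in> \<Omega>" if "x \<in> \<Omega>" "g \<in> carrier G" for x g
    using that sep_shift shift_closed by (auto simp: \<Omega>_def)
  \<comment> \<open>A condition that fails does so at some \<open>g\<close> on finitely many
    coordinates, hence on a whole cylinder; in particular \<Omega> is closed.\<close>
  define bad where "bad x B \<longleftrightarrow> finite B \<and> B \<subseteq> carrier G \<and>
    (\<exists>j. \<forall>y\<in>Cantor. (\<forall>b\<in>B. y b = x b) \<longrightarrow> \<not> separates (T j) (\<gamma> j) y)" for x B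
  have bad: "\<exists>B. bad x B" if x: "x \<in> Cantor" "x \<notin> \<Omega>" for x
  proof -
    obtain j where "\<not> separates (T j) (\<gamma> j) x" using x by (auto simp: \<Omega>_def)
    then obtain g where g: "g \<in> carrier G" "\<And>t. t \<in> T j \<Longrightarrow> x (t \<otimes> g) = x (t \<otimes> (\<gamma> j \<otimes> g))"
      unfolding separates_def by auto
    define B where "B = (\<lambda>t. t \<otimes> g) ` T j \<union> (\<lambda>t. t \<otimes> (\<gamma> j \<otimes> g)) ` T j"
    have "finite B" "B \<subseteq> carrier G" using T[of j] g \<gamma>c by (auto simp: B_def subset_iff)
    moreover have "\<not> separates (T j) (\<gamma> j) y" if y: "\<forall>b\<in>B. y b = x b" for y
    proof -
      have "y (t \<otimes> g) = y (t \<otimes> (\<gamma> j \<otimes> g))" if "t \<in> T j" for t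
        using y g(2)[OF that] that by (simp add: B_def ball_Un)
      then show ?thesis using g(1) by (auto simp: separates_def)
    qed
    ultimately show ?thesis unfolding bad_def by blast
  qed
  have cover: "\<exists>m D. finite D \<and> D \<subseteq> \<Omega> \<and>
      (\<forall>x\<in>Cantor. (\<forall>j<m. separates (T j) (\<gamma> j) x) \<longrightarrow> (\<exists>d\<in>D. \<forall>b\<in>B d. x b = d b))"
    if B: "\<And>x. x \<in> \<Omega> \<Longrightarrow> finite (B x) \<and> B x \<subseteq> carrier G" for B
  proof -
    \<comment> \<open>The given windows inside \<Omega> and windows witnessing a failure outside
      together give a cylinder cover of the whole compact space.\<close>
    define B' where "B' x = (if x \<in> \<Omega> then B x else SOME B. bad x B)" for x
    have B': "bad x (B' x)" if "x \<in> Cantor" "x \<notin> \<Omega>" for x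
      using someI_ex[OF bad[OF that]] that by (simp add: B'_def)
    have "finite (B' x) \<and> B' x \<subseteq> carrier G" if "x \<in> Cantor" for x
      using B[of x] B'[OF that] by (cases "x \<in> \<Omega>") (auto simp: B'_def bad_def)
    then obtain D where D: "finite D" "D \<subseteq> Cantor"
      "\<And>x. x \<in> Cantor \<Longrightarrow> \<exists>d\<in>D. \<forall>b\<in>B' d. x b = d b"
      using finite_cylinder_cover[of B'] by blast
    have "\<forall>d\<in>D - \<Omega>. \<exists>j. \<forall>y\<in>Cantor. (\<forall>b\<in>B' d. y b = d b) \<longrightarrow> \<not> separates (T j) (\<gamma> j) y"
      using B' D(2) unfolding bad_def by blast
    then obtain J where J: "\<And>d y. d \<in> D - \<Omega> \<Longrightarrow> y \<in> Cantor \<Longrightarrow>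
        (\<forall>b\<in>B' d. y b = d b) \<Longrightarrow> \<not> separates (T (J d)) (\<gamma> (J d)) y" by metis
    \<comment> \<open>\<open>m\<close> exceeds the conditions that fail at the finitely many centers
      outside \<Omega>, so nothing obeying the first \<open>m\<close> conditions lies in their
      cylinders.\<close>
    obtain m where m: "\<And>d. d \<in> D \<Longrightarrow> J d < m"
      using D(1) finite_nat_set_iff_bounded[of "J ` D"] by auto
    have "\<exists>d\<in>D \<inter> \<Omega>. \<forall>b\<in>B d. x b = d b"
      if x: "x \<in> Cantor" "\<forall>j<m. separates (T j) (\<gamma> j) x" for x
    proof -
      obtain d where d: "d \<in> D" "\<forall>b\<in>B' d. x b = d b" using D(3)[OF x(1)] by blast
      have "d \<in> \<Omega>" using J[of d x] d x m[OF d(1)] by blast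
      then show ?thesis using d by (auto simp: B'_def)
    qed
    then show ?thesis using D(1) by (intro exI[of _ m] exI[of _ "D \<inter> \<Omega>"]) auto
  qed
  have "\<forall>x\<in>\<Omega>. \<exists>W. finite W \<and> W \<subseteq> carrier G \<and> (\<forall>y\<in>\<Omega>. (\<forall>w\<in>W. y w = x w) \<longrightarrow> f y = f x)"
  proof
    fix x assume "x \<in> \<Omega>"
    from continuous_Free_local[OF f \<Omega>_free[OF this]] obtain W where
      W: "finite W \<and> W \<subseteq> carrier G \<and> (\<forall>y\<in>free_points G. (\<forall>w\<in>W. y w = x w) \<longrightarrow> f y = f x)" ..
    then show "\<exists>W. finite W \<and> W \<subseteq> carrier G \<and> (\<forall>y\<in>\<Omega>. (\<forall>w\<in>W. y w = x w) \<longrightarrow> f y = f x)"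
      using \<Omega>_free by (intro exI[of _ W]) auto
  qed
  from bchoice[OF this] obtain W' where W'_all: "\<forall>x\<in>\<Omega>. finite (W' x) \<and> W' x \<subseteq> carrier G \<and>
      (\<forall>y\<in>\<Omega>. (\<forall>w\<in>W' x. y w = x w) \<longrightarrow> f y = f x)" ..
  have W': "finite (W' x) \<and> W' x \<subseteq> carrier G" "\<And>y. y \<in> \<Omega> \<Longrightarrow> (\<forall>w\<in>W' x. y w = x w) \<Longrightarrow> f y = f x"
    if "x \<in> \<Omega>" for x
    using bspec[OF W'_all that] by simp_all
  have "\<exists>m D. finite D \<and> D \<subseteq> \<Omega> \<and>
      (\<forall>x\<in>Cantor. (\<forall>j<m. separates (T j) (\<gamma> j) x) \<longrightarrow> (\<exists>d\<in>D. \<forall>b\<in>W' d. x b = d b))"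
    by (rule cover) (rule W'(1))
  then obtain m' D where D0: "finite D \<and> D \<subseteq> \<Omega> \<and>
      (\<forall>x\<in>Cantor. (\<forall>j<m'. separates (T j) (\<gamma> j) x) \<longrightarrow> (\<exists>d\<in>D. \<forall>b\<in>W' d. x b = d b))"
    by (elim exE) (rule that)
  then have D: "finite D" "D \<subseteq> \<Omega>" by simp_all
  have D_cover: "\<exists>d\<in>D. \<forall>b\<in>W' d. x b = d b" if "x \<in> \<Omega>" for x
    using conjunct2[OF conjunct2[OF D0], rule_format, of x] that by (simp add: \<Omega>_def)
  define W where "W = (\<Union>d\<in>D. W' d)"
  have W: "finite W" "W \<subseteq> carrier G" using D W'(1) by (auto simp: W_def)
  have unif: "f x = f y" if xy: "x \<in> \<Omega>" "y \<in> \<Omega>" "\<And>w. w \<in> W \<Longrightarrow> x w = y w" for x y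
  proof -
    obtain d where d: "d \<in> D" "\<forall>b\<in>W' d. x b = d b" using D_cover[OF xy(1)] by blast
    then have "\<forall>b\<in>W' d. y b = d b" using xy(3) by (metis UN_I W_def)
    then show ?thesis using W'(2)[of d x] W'(2)[of d y] d D(2) xy by auto
  qed
  \<comment> \<open>The rule at the place \<open>d\<close> of a pattern reads \<open>W\<close>
    around \<open>d\<close>, so \<open>W <#> dom p\<close> controls a whole occurrence.\<close>
  define B where "B = (\<Union>p\<in>P. W <#> dom p)"
  have Pd: "finite (dom p)" "dom p \<subseteq> carrier G" if "p \<in> P" for p using P(2)[OF that] by (auto simp: is_pattern_def)
  have B: "finite B" "B \<subseteq> carrier G"
    using P(1) Pd W by (auto simp: B_def finite_set_mult dest: subsetD[OF set_mult_closed[OF W(2)]])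
  from cover[of "\<lambda>_. B", OF conjI[OF B]] obtain m E where E0: "finite E \<and> E \<subseteq> \<Omega> \<and>
      (\<forall>x\<in>Cantor. (\<forall>j<m. separates (T j) (\<gamma> j) x) \<longrightarrow> (\<exists>d\<in>E. \<forall>b\<in>B. x b = d b))"
    by (elim exE) (rule that)
  have E: "\<exists>d\<in>\<Omega>. \<forall>b\<in>B. x b = d b"
    if "x \<in> Cantor" "\<And>j. j < m \<Longrightarrow> separates (T j) (\<gamma> j) x" for x
    using conjunct2[OF conjunct2[OF E0], rule_format, OF that] E0 by blast
  define cands where "cands x g = {\<omega> \<in> \<Omega>. \<forall>w\<in>W. \<omega> w = of_bool (x (w \<otimes> g))}" for x :: "'a \<Rightarrow> bool" and g
  \<comment> \<open>Where no point of \<Omega> matches, the value is 0, which is a color since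
    \<open>k \<ge> 1\<close>; otherwise \<open>unif\<close> makes the value independent of the
    candidate picked.\<close>
  define \<Phi> where "\<Phi> x g = (if cands x g = {} then 0 else f (SOME \<omega>. \<omega> \<in> cands x g))" for x g
  have cand_some: "(SOME \<omega>. \<omega> \<in> cands x g) \<in> cands x g" if "cands x g \<noteq> {}" for x g
    using that by (simp add: some_in_eq)
  show ?thesis
  proof (rule exI[of _ m], rule exI[of _ W], rule exI[of _ \<Phi>], intro conjI W allI ballI impI)
    show "local_rule W \<Phi>"
      unfolding local_rule_def
    proof (intro allI ballI impI)
      fix c c' :: "'a \<Rightarrow> bool" and g g' assume "\<forall>u\<in>W. c (u \<otimes> g) = c' (u \<otimes> g')"
      then have "cands c g = cands c' g'" by (auto simp: cands_def)
      then show "\<Phi> c g = \<Phi> c' g'" by (simp add: \<Phi>_def)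
    qed
    show "\<Phi> x g < k" for x g
      using k fk \<Omega>_free cand_some[of x g] by (auto simp: \<Phi>_def cands_def)
    fix x :: "'a \<Rightarrow> bool" and p g
    assume x: "\<forall>j<m. separates (T j) (\<gamma> j) x" and p: "p \<in> P" and g: "g \<in> carrier G"
    \<comment> \<open>The configuration \<open>x\<close> recentered at \<open>g\<close>, with truth
      values turned into 0 and 1.\<close>
    define \<omega> where "\<omega> = (\<lambda>d\<in>carrier G. of_bool (x (d \<otimes> g)) :: nat)"
    have \<omega>t: "\<omega> \<in> Cantor" by (auto simp: \<omega>_def topspace_two_pow)
    have "separates (T j) (\<gamma> j) \<omega>" if j: "j < m" for j
      unfolding separates_def
    proof
      fix h assume h: "h \<in> carrier G"
      then obtain t where t: "t \<in> T j" "x (t \<otimes> (h \<otimes> g)) \<noteq> x (t \<otimes> (\<gamma> j \<otimes> (h \<otimes> g)))"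
        using bspec[OF x[rule_format, OF j, unfolded separates_def], of "h \<otimes> g"] g h by blast
      have "t \<in> carrier G" using t T by blast
      then show "\<exists>t\<in>T j. \<omega> (t \<otimes> h) \<noteq> \<omega> (t \<otimes> (\<gamma> j \<otimes> h))"
        using t g h \<gamma>c by (intro bexI[of _ t]) (simp_all add: \<omega>_def m_assoc)
    qed
    then obtain \<omega>' where \<omega>': "\<omega>' \<in> \<Omega>" "\<And>b. b \<in> B \<Longrightarrow> \<omega> b = \<omega>' b" using E[OF \<omega>t] by blast
    show "\<exists>d\<in>dom p. p d \<noteq> Some (\<Phi> x (d \<otimes> g))"
    proof (rule ccontr)
      assume "\<not> ?thesis"
      then have all: "p d = Some (\<Phi> x (d \<otimes> g))" if "d \<in> dom p" for d using that by blast
      have "p d = Some (f (free_shift G d \<omega>'))" if d: "d \<in> dom p" for d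
      proof -
        have dc: "d \<in> carrier G" using Pd[OF p] d by blast
        have fs: "free_shift G d \<omega>' = shift G d \<omega>'" using \<Omega>_free[OF \<omega>'(1)] by (simp add: free_shift_def)
        have sh: "shift G d \<omega>' \<in> \<Omega>" using \<Omega>_shift[OF \<omega>'(1) dc] .
        have "shift G d \<omega>' w = of_bool (x (w \<otimes> (d \<otimes> g)))" if w: "w \<in> W" for w
        proof -
          have wc: "w \<in> carrier G" using w W by blast
          have "w \<otimes> d \<in> B" using w d p by (auto simp: B_def set_mult_def)
          then have "\<omega>' (w \<otimes> d) = of_bool (x (w \<otimes> d \<otimes> g))" using \<omega>'(2)[of "w \<otimes> d"] wc dc by (simp add: \<omega>_def)
          then show ?thesis using \<omega>'(1) wc dc g by (simp add: shift_apply \<Omega>_def m_assoc)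
        qed
        then have sc: "shift G d \<omega>' \<in> cands x (d \<otimes> g)" using sh by (simp add: cands_def)
        then have ne: "cands x (d \<otimes> g) \<noteq> {}" by blast
        have "f (SOME \<omega>. \<omega> \<in> cands x (d \<otimes> g)) = f (shift G d \<omega>')"
          using sc cand_some[OF ne] by (intro unif) (auto simp: cands_def)
        then show ?thesis using all[OF d] ne fs by (simp add: \<Phi>_def)
      qed
      then have "occurs_in_space (Free_two_pow G) (free_shift G) p f"
        unfolding occurs_in_space_def top using \<Omega>_free[OF \<omega>'(1)] by blast
      then show False using avoid[OF p] by blast
    qed
  qed
qed

end

section \<open>Greedy colorings\<close>

text \<open>Balls of radius \<open>1 / Suc i\<close> around a countable dense set form a base. It
  will provide the Lindelof property, and so countable clopen covers.\<close>

lemma metrizable_separable_imp_second_countable: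
  assumes "metrizable_space X" "separable_space X"
  shows "second_countable X"
proof -
  obtain M d where "Metric_space M d" and X: "X = Metric_space.mtopology M d"
    using assms(1) unfolding metrizable_space_def by blast
  interpret Metric_space M d by fact
  obtain C where C: "countable C" "C \<subseteq> M" "mtopology closure_of C = M"
    using assms(2) unfolding X separable_space_def by auto
  define \<B> where "\<B> = (\<lambda>(s, i). mball s (1 / real (Suc i))) ` (C \<times> UNIV)"
  have "\<exists>V\<in>\<B>. x \<in> V \<and> V \<subseteq> U" if U: "openin mtopology U" "x \<in> U" for U x
  proof -
    obtain r where r: "r > 0" "mball x r \<subseteq> U" and x: "x \<in> M" using U unfolding openin_mtopology by blast
    obtain i where i: "1 / real (Suc i) < r / 2" using r(1) nat_approx_posE[of "r / 2"] by auto
    have "x \<in> mtopology closure_of C" using C(3) x by simp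
    then have dense: "\<forall>r>0. \<exists>y\<in>C. y \<in> mball x r" unfolding metric_closure_of by simp
    obtain s where s: "s \<in> C" "s \<in> mball x (1 / real (Suc i))"
      using dense[rule_format, of "1 / real (Suc i)"] by auto
    have "x \<in> mball s (1 / real (Suc i))" using s(2) by (simp add: commute)
    moreover have "mball s (1 / real (Suc i)) \<subseteq> mball x r"
    proof
      fix y assume y: "y \<in> mball s (1 / real (Suc i))"
      then have "d x y \<le> d x s + d s y" using s x by (intro triangle) auto
      also have "\<dots> < r" using y s(2) i by simp
      finally show "y \<in> mball x r" using y x by simp
    qed
    ultimately show ?thesis using s(1) r(2) by (intro bexI[of _ "mball s (1 / real (Suc i))"]) (auto simp: \<B>_def)
  qed
  moreover have "countable \<B>" using C(1) by (simp add: \<B>_def)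
  moreover have "\<forall>V\<in>\<B>. openin mtopology V" by (auto simp: \<B>_def)
  ultimately show ?thesis unfolding second_countable_def X by blast
qed

text \<open>Well-founded recursion along the rank \<open>r\<close>, with colors prescribed at rank
  0. On the group, rank 0 will be the domain of a given injection; on a space, all ranks will be
  positive.\<close>

lemma greedy_recursion:
  fixes r :: "'x \<Rightarrow> nat" and act :: "'i \<Rightarrow> 'x \<Rightarrow> 'x" and c0 :: "'x \<Rightarrow> nat"
  shows "\<exists>c :: 'x \<Rightarrow> nat. \<forall>y. c y =
    (if r y = 0 then c0 y else LEAST i. i \<notin> {c (act \<nu> y) |\<nu>. \<nu> \<in> N \<and> r (act \<nu> y) < r y})"
proof -
  define H where "H f y = (if r y = 0 then c0 y else LEAST i. i \<notin> {f (act \<nu> y) |\<nu>. \<nu> \<in> N \<and> r (act \<nu> y) < r y})"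
    for f :: "'x \<Rightarrow> nat" and y
  define c where "c = wfrec (Wellfounded.measure r) H"
  have "c y = H c y" for y
  proof -
    have "c y = H (cut c (Wellfounded.measure r) y) y" unfolding c_def by (rule wfrec) simp
    moreover have "{cut c (Wellfounded.measure r) y (act \<nu> y) |\<nu>. \<nu> \<in> N \<and> r (act \<nu> y) < r y} =
        {c (act \<nu> y) |\<nu>. \<nu> \<in> N \<and> r (act \<nu> y) < r y}"
      by (intro Collect_cong arg_cong[where f = Ex] ext) (auto simp: cut_apply)
    ultimately show ?thesis by (simp add: H_def)
  qed
  then show ?thesis unfolding H_def by (intro exI[of _ c] allI)
qed

lemma Least_notin_finite:
  assumes "finite A" "card A < n"
  shows "(LEAST i. i \<notin> A) \<notin> A" and "(LEAST i. i \<notin> A) < (n::nat)"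
proof -
  have "\<exists>i<n. i \<notin> A"
  proof (rule ccontr)
    assume "\<not> ?thesis"
    then have "{..<n} \<subseteq> A" by auto
    then have "card {..<n} \<le> card A" by (rule card_mono[OF assms(1)])
    then show False using assms(2) by simp
  qed
  then obtain i where i: "i < n" "i \<notin> A" by blast
  show "(LEAST i. i \<notin> A) \<notin> A" using i(2) by (rule LeastI)
  have "(LEAST i. i \<notin> A) \<le> i" using i(2) by (rule Least_le)
  then show "(LEAST i. i \<notin> A) < n" using i(1) by linarith
qed

lemma greedy_coloring:
  fixes r :: "'x \<Rightarrow> nat" and act :: "'i \<Rightarrow> 'x \<Rightarrow> 'x"
  assumes N: "finite N" "card N < n"
    and c: "\<And>y. c y = (if r y = 0 then c0 y else LEAST i. i \<notin> {c (act \<nu> y) |\<nu>. \<nu> \<in> N \<and> r (act \<nu> y) < r y})"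
  shows "r y \<noteq> 0 \<Longrightarrow> c y < n"
    and "\<nu> \<in> N \<Longrightarrow> r (act \<nu> y) < r y \<Longrightarrow> c (act \<nu> y) \<noteq> c y"
proof -
  define A where "A = {c (act \<nu> y) |\<nu>. \<nu> \<in> N \<and> r (act \<nu> y) < r y}"
  have A_sub: "A \<subseteq> (\<lambda>\<nu>. c (act \<nu> y)) ` N" by (auto simp: A_def)
  have A: "finite A" using A_sub N(1) finite_surj by blast
  have "card A \<le> card N" using A_sub N(1) by (meson card_image_le card_mono finite_imageI le_trans)
  then have cA: "card A < n" using N(2) by linarith
  have cy: "c y = (LEAST i. i \<notin> A)" if "r y \<noteq> 0" using c[of y] that by (simp add: A_def)
  show "c y < n" if "r y \<noteq> 0" using cy[OF that] Least_notin_finite(2)[OF A cA] by simp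
  show "c (act \<nu> y) \<noteq> c y" if "\<nu> \<in> N" "r (act \<nu> y) < r y"
  proof -
    have "c (act \<nu> y) \<in> A" using that by (auto simp: A_def)
    then show ?thesis using cy Least_notin_finite(1)[OF A cA] that(2) by auto
  qed
qed

context group
begin

text \<open>A coloring is injective on all translates of \<open>D\<close> if it separates points
  that differ by a quotient in \<open>N\<close>. Dropping the diagonal pairs makes the count
  strictly less than \<open>card D ^ 2\<close>, so that this many colors suffice greedily.\<close>

lemma card_quotients:
  assumes D: "finite D" "D \<subseteq> carrier G" "D \<noteq> {}"
  defines "N \<equiv> {\<delta>' \<otimes> inv \<delta> |\<delta> \<delta>'. \<delta> \<in> D \<and> \<delta>' \<in> D \<and> \<delta> \<noteq> \<delta>'}"
  shows "finite N" "N \<subseteq> carrier G" "card N < card D ^ 2" "\<And>\<nu>. \<nu> \<in> N \<Longrightarrow> inv \<nu> \<in> N" "\<one> \<notin> N"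
proof -
  have N: "N = (\<lambda>(\<delta>, \<delta>'). \<delta>' \<otimes> inv \<delta>) ` (D \<times> D - Id)" by (auto simp: N_def)
  show "finite N" using D(1) by (simp add: N)
  show "N \<subseteq> carrier G" using D(2) by (auto simp: N_def)
  have "card N \<le> card (D \<times> D - Id)" unfolding N using D(1) by (intro card_image_le) simp
  also have "\<dots> < card (D \<times> D)"
    using D by (intro psubset_card_mono) auto
  finally show "card N < card D ^ 2" by (simp add: card_cartesian_product power2_eq_square)
  show "inv \<nu> \<in> N" if \<nu>: "\<nu> \<in> N" for \<nu>
  proof -
    obtain \<delta> \<delta>' where d: "\<delta> \<in> D" "\<delta>' \<in> D" "\<delta> \<noteq> \<delta>'" "\<nu> = \<delta>' \<otimes> inv \<delta>" using \<nu> by (auto simp: N_def)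
    then have "inv \<nu> = \<delta> \<otimes> inv \<delta>'" using D(2) by (auto simp: inv_mult_group subset_iff)
    then show ?thesis using d by (auto simp: N_def)
  qed
  show "\<one> \<notin> N"
  proof
    assume "\<one> \<in> N"
    then obtain \<delta> \<delta>' where d: "\<delta> \<in> D" "\<delta>' \<in> D" "\<delta> \<noteq> \<delta>'" "\<one> = \<delta>' \<otimes> inv \<delta>" by (auto simp: N_def)
    then have "\<delta> = \<delta>' \<otimes> inv \<delta> \<otimes> \<delta>" using D(2) by (metis l_one subsetD)
    also have "\<dots> = \<delta>'" using d(1,2) D(2) by (simp add: m_assoc subset_iff)
    finally have "\<delta>' = \<delta>" ..
    then show False using d(3) by simp
  qed
qed

text \<open>With rank 0 on \<open>D\<close> and distinct positive ranks elsewhere, the greedy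
  coloring respects the prescribed injection; symmetry of \<open>N\<close> covers neighbours of
  larger rank.\<close>

lemma extend_injective_coloring:
  assumes cnt: "countable (carrier G)" and D: "finite D" "D \<subseteq> carrier G" "\<one> \<in> D"
    and n: "card D ^ 2 \<le> n" and q: "q \<in> Inj D n"
  obtains c where "\<And>d. d \<in> D \<Longrightarrow> c d = q d" "proper D n c"
proof -
  define N where "N = {\<delta>' \<otimes> inv \<delta> |\<delta> \<delta>'. \<delta> \<in> D \<and> \<delta>' \<in> D \<and> \<delta> \<noteq> \<delta>'}"
  have "D \<noteq> {}" using D by blast
  note N = card_quotients[OF D(1,2) this, folded N_def]
  define r where "r g = (if g \<in> D then 0 else Suc (to_nat_on (carrier G) g))" for g
  from greedy_recursion[where r = r and ?c0.0 = q and N = N and act = "(\<otimes>)"]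
  obtain c :: "_ \<Rightarrow> nat" where c_all: "\<forall>y.  c y = (if r y = 0 then q y else LEAST i. i \<notin> {c (\<nu> \<otimes> y) |\<nu>. \<nu> \<in> N \<and> r (\<nu> \<otimes> y) < r y})" ..
  note c = spec[OF c_all]
  have cardN: "card N < n" using N(3) n by linarith
  note g = greedy_coloring[where act = "(\<otimes>)" and r = r and c = c and ?c0.0 = q, OF N(1) cardN c]
  have cD: "c d = q d" if "d \<in> D" for d using c[of d] that by (simp add: r_def)
  have "proper D n c"
    unfolding proper_def
  proof (intro ballI conjI impI)
    fix y assume y: "y \<in> carrier G"
    show "c y < n"
    proof (cases "y \<in> D")
      case True
      then show ?thesis using cD q by (auto simp: Inj_def)
    next
      case False
      then show ?thesis using g(1)[of y] by (simp add: r_def)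
    qed
    fix \<kappa> assume \<kappa>: "\<kappa> \<in> D" "\<kappa> \<noteq> \<one>"
    have \<kappa>c: "\<kappa> \<in> carrier G" using \<kappa> D by blast
    have \<kappa>N: "\<kappa> \<in> N" using \<kappa> D(3) \<kappa>c unfolding N_def by (intro CollectI exI[of _ \<one>] exI[of _ \<kappa>]) simp
    have ne: "\<kappa> \<otimes> y \<noteq> y" using \<kappa> \<kappa>c y by (metis l_cancel_one r_cancel_one)
    have \<kappa>y: "\<kappa> \<otimes> y \<in> carrier G" using \<kappa>c y by simp
    consider "r (\<kappa> \<otimes> y) < r y" | "r y < r (\<kappa> \<otimes> y)" | "r (\<kappa> \<otimes> y) = r y" by linarith
    then show "c (\<kappa> \<otimes> y) \<noteq> c y"
    proof cases
      case 1
      then show ?thesis using g(2)[OF \<kappa>N] by simp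
    next
      case 2
      have "inv \<kappa> \<otimes> (\<kappa> \<otimes> y) = y" using \<kappa>c y by (simp flip: m_assoc)
      then show ?thesis using g(2)[OF N(4)[OF \<kappa>N], of "\<kappa> \<otimes> y"] 2 by simp
    next
      \<comment> \<open>Positive ranks are distinct, so equal ranks put both points into
        \<open>D\<close>, where injectivity of \<open>q\<close> applies.\<close>
      case 3
      have "\<kappa> \<otimes> y \<in> D \<and> y \<in> D"
      proof (rule ccontr)
        assume "\<not> ?thesis"
        then have "\<kappa> \<otimes> y \<notin> D" "y \<notin> D" using 3 by (auto simp: r_def split: if_splits)
        then have "to_nat_on (carrier G) (\<kappa> \<otimes> y) = to_nat_on (carrier G) y" using 3 by (simp add: r_def)
        then show False using ne inj_on_to_nat_on[OF cnt] \<kappa>y y by (meson inj_onD)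
      qed
      then show ?thesis using cD ne q by (auto simp: Inj_def inj_on_def)
    qed
  qed
  then show ?thesis using that cD by blast
qed

lemma Gamma_space_action:
  assumes "Gamma_space G X \<phi>"
  shows "\<And>g x. g \<in> carrier G \<Longrightarrow> x \<in> topspace X \<Longrightarrow> \<phi> g x \<in> topspace X"
    and "\<And>g h x. g \<in> carrier G \<Longrightarrow> h \<in> carrier G \<Longrightarrow> x \<in> topspace X \<Longrightarrow> \<phi> g (\<phi> h x) = \<phi> (g \<otimes> h) x"
    and "\<And>x. x \<in> topspace X \<Longrightarrow> \<phi> \<one> x = x"
    and "\<And>g. g \<in> carrier G \<Longrightarrow> continuous_map X X (\<phi> g)"
proof -
  interpret group_action G "topspace X" \<phi> using assms by (simp add: Gamma_space_def)
  show "\<phi> g x \<in> topspace X" if "g \<in> carrier G" "x \<in> topspace X" for g x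
    using element_image[OF that] by simp
  show "\<phi> g (\<phi> h x) = \<phi> (g \<otimes> h) x" if "g \<in> carrier G" "h \<in> carrier G" "x \<in> topspace X" for g h x
    using composition_rule[OF that(3,1,2)] by simp
  show "\<phi> \<one> x = x" if "x \<in> topspace X" for x
    using that by (simp flip: id_eq_one)
  show "continuous_map X X (\<phi> g)" if g: "g \<in> carrier G" for g
  proof -
    have "continuous_map X (prod_topology (discrete_topology (carrier G)) X) (\<lambda>x. (g, x))"
      using g by (simp add: continuous_map_pairedI)
    moreover have "continuous_map (prod_topology (discrete_topology (carrier G)) X) X (\<lambda>(g, x). \<phi> g x)"
      using assms by (simp add: Gamma_space_def)
    ultimately have "continuous_map X X ((\<lambda>(g, x). \<phi> g x) \<circ> (\<lambda>x. (g, x)))"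
      by (rule continuous_map_compose)
    then show ?thesis by (simp add: comp_def)
  qed
qed

text \<open>By freeness, each point has a clopen neighbourhood that is disjoint from its translates
  by \<open>N\<close>. Points related by \<open>N\<close> therefore never share their first set in a
  countable cover of this kind; the index of that set is a locally constant rank that orients all
  conflicts.\<close>

lemma continuous_injective_coloring:
  assumes free: "free_Gamma_space G X \<phi>" and zd: "zero_dimensional X" and pol: "polish X"
    and D: "finite D" "D \<subseteq> carrier G" "D \<noteq> {}" and n: "card D ^ 2 \<le> n"
  obtains c where "continuous_map X (discrete_topology {..<n}) c"
    "\<And>x. x \<in> topspace X \<Longrightarrow> inj_on (\<lambda>d. c (\<phi> d x)) D"
proof -
  define N where "N = {\<delta>' \<otimes> inv \<delta> |\<delta> \<delta>'. \<delta> \<in> D \<and> \<delta>' \<in> D \<and> \<delta> \<noteq> \<delta>'}"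
  note N = card_quotients[OF D, folded N_def]
  have Gs: "Gamma_space G X \<phi>" using free by (simp add: free_Gamma_space_def)
  note act = Gamma_space_action[OF Gs]
  have metr: "metrizable_space X" using pol by (simp add: polish_def completely_metrizable_imp_metrizable_space)
  have haus: "Hausdorff_space X" using metr by (rule metrizable_imp_Hausdorff_space)
  have Lind: "Lindelof_space X"
    using pol metr by (simp add: polish_def metrizable_separable_imp_second_countable second_countable_imp_Lindelof_space)
  obtain \<B> where \<B>: "(\<forall>B\<in>\<B>. openin X B \<and> closedin X B) \<and>
      (\<forall>U x. openin X U \<and> x \<in> U \<longrightarrow> (\<exists>B\<in>\<B>. x \<in> B \<and> B \<subseteq> U))"
    using zd unfolding zero_dimensional_def ..
  have \<B>_clopen: "openin X B \<and> closedin X B" if "B \<in> \<B>" for B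
    using \<B> that by blast
  have \<B>_base: "\<exists>B\<in>\<B>. x \<in> B \<and> B \<subseteq> U" if "openin X U" "x \<in> U" for U x
    using conjunct2[OF \<B>] that by blast
  have pre: "openin X {y \<in> topspace X. \<phi> g y \<in> A}" if "g \<in> carrier G" "openin X A" for g A
    using act(4)[OF that(1)] that(2) by (rule openin_continuous_map_preimage)
  have "\<exists>U. openin X U \<and> closedin X U \<and> x \<in> U \<and> (\<forall>y\<in>U. \<forall>\<nu>\<in>N. \<phi> \<nu> y \<notin> U)"
    if x: "x \<in> topspace X" for x
  proof -
    have "\<exists>A. openin X A \<and> x \<in> A \<and> (\<forall>y\<in>A. \<phi> \<nu> y \<notin> A)" if \<nu>: "\<nu> \<in> N" for \<nu>
    proof -
      have \<nu>c: "\<nu> \<in> carrier G" using \<nu> N(2) by blast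
      have "\<phi> \<nu> x \<noteq> x"
      proof
        assume "\<phi> \<nu> x = x"
        then have "\<nu> \<in> stabilizer G \<phi> x" using \<nu>c by (simp add: stabilizer_def)
        then show False using free x \<nu> N(5) by (simp add: free_Gamma_space_def)
      qed
      then obtain A B where AB: "openin X A" "openin X B" "x \<in> A" "\<phi> \<nu> x \<in> B" "disjnt A B"
        using haus x act(1)[OF \<nu>c x] unfolding Hausdorff_space_def by metis
      have "openin X (A \<inter> {y \<in> topspace X. \<phi> \<nu> y \<in> B})" using AB pre[OF \<nu>c] by blast
      moreover have "x \<in> A \<inter> {y \<in> topspace X. \<phi> \<nu> y \<in> B}" using AB x by simp
      moreover have "\<forall>y\<in>A \<inter> {y \<in> topspace X. \<phi> \<nu> y \<in> B}. \<phi> \<nu> y \<notin> A \<inter> {y \<in> topspace X. \<phi> \<nu> y \<in> B}"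
        using AB(5) by (auto simp: disjnt_def)
      ultimately show ?thesis by blast
    qed
    then obtain A where A: "\<And>\<nu>. \<nu> \<in> N \<Longrightarrow> openin X (A \<nu>) \<and> x \<in> A \<nu> \<and> (\<forall>y\<in>A \<nu>. \<phi> \<nu> y \<notin> A \<nu>)" by metis
    have "openin X ((\<Inter>\<nu>\<in>N. A \<nu>) \<inter> topspace X)" using N(1) A by (intro openin_INT) auto
    moreover have "x \<in> (\<Inter>\<nu>\<in>N. A \<nu>) \<inter> topspace X" using x A by blast
    ultimately obtain U where "openin X U" "closedin X U" "x \<in> U" "U \<subseteq> (\<Inter>\<nu>\<in>N. A \<nu>) \<inter> topspace X"
      using \<B>_clopen \<B>_base by metis
    then show ?thesis using A by (intro exI[of _ U]) blast
  qed
  then obtain U0 where U0: "\<And>x. x \<in> topspace X \<Longrightarrow> openin X (U0 x) \<and> closedin X (U0 x) \<and> x \<in> U0 x \<and>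
      (\<forall>y\<in>U0 x. \<forall>\<nu>\<in>N. \<phi> \<nu> y \<notin> U0 x)" by metis
  have "\<exists>\<V>. countable \<V> \<and> \<V> \<subseteq> U0 ` topspace X \<and> topspace X \<subseteq> \<Union>\<V>"
    by (rule Lind[unfolded Lindelof_space_alt, rule_format]) (use U0 in blast)
  then obtain \<V> where \<V>: "countable \<V>" "\<V> \<subseteq> U0 ` topspace X" "topspace X \<subseteq> \<Union>\<V>" by blast
  \<comment> \<open>Inserting the empty set makes the family nonempty, as the enumeration
    requires.\<close>
  define U where "U = from_nat_into (insert {} \<V>)"
  have rU: "range U = insert {} \<V>" unfolding U_def using \<V>(1) by (intro range_from_nat_into) auto
  have U: "openin X (U i)" "closedin X (U i)" "\<And>y \<nu>. y \<in> U i \<Longrightarrow> \<nu> \<in> N \<Longrightarrow> \<phi> \<nu> y \<notin> U i" for i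
  proof -
    have "U i \<in> insert {} \<V>" using rU by blast
    then have "U i = {} \<or> (\<exists>x\<in>topspace X. U i = U0 x)" using \<V>(2) by blast
    then have "openin X (U i) \<and> closedin X (U i) \<and> (\<forall>y\<in>U i. \<forall>\<nu>\<in>N. \<phi> \<nu> y \<notin> U i)"
    proof (elim disjE bexE)
      fix x assume x: "x \<in> topspace X" and eq: "U i = U0 x"
      show ?thesis using U0[OF x] unfolding eq by simp
    qed simp
    then show "openin X (U i)" "closedin X (U i)" "\<And>y \<nu>. y \<in> U i \<Longrightarrow> \<nu> \<in> N \<Longrightarrow> \<phi> \<nu> y \<notin> U i"
      by simp_all
  qed
  have cov: "\<exists>i. x \<in> U i" if x: "x \<in> topspace X" for x
  proof -
    obtain A where "A \<in> \<V>" "x \<in> A" using x \<V>(3) by blast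
    then have "A \<in> range U" using rU by simp
    then show ?thesis using \<open>x \<in> A\<close> by blast
  qed
  define r where "r x = Suc (LEAST i. x \<in> U i)" for x
  have r_le: "r x \<le> Suc i" if "x \<in> U i" for x i using that by (simp add: r_def Least_le)
  have r_mem: "x \<in> U (r x - 1)" if "x \<in> topspace X" for x
    using LeastI_ex[OF cov[OF that]] by (simp add: r_def)
  have r_ge: "t \<le> r x \<longleftrightarrow> (\<forall>j. Suc j < t \<longrightarrow> x \<notin> U j)" if x: "x \<in> topspace X" for x t
  proof
    assume "t \<le> r x"
    then show "\<forall>j. Suc j < t \<longrightarrow> x \<notin> U j" using r_le[of x] by (meson leD le_less_trans less_le_trans)
  next
    assume "\<forall>j. Suc j < t \<longrightarrow> x \<notin> U j"
    then have "\<not> Suc (r x - 1) < t" using r_mem[OF x] by blast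
    then show "t \<le> r x" by (simp add: r_def)
  qed
  have open_ge: "openin X {x \<in> topspace X. t \<le> r x}" for t
  proof -
    have "{x \<in> topspace X. t \<le> r x} = (\<Inter>j\<in>{j. Suc j < t}. topspace X - U j) \<inter> topspace X"
      using r_ge by auto
    moreover have "finite {j. Suc j < t}" by (rule finite_subset[of _ "{..<t}"]) auto
    moreover have "openin X (topspace X - U j)" for j using U(2) by (simp add: closedin_def)
    ultimately show ?thesis by (simp only: openin_INT)
  qed
  have open_eq: "openin X {x \<in> topspace X. r x = t}" for t
  proof (cases t)
    case 0
    then show ?thesis by (simp add: r_def)
  next
    case (Suc i)
    have "{x \<in> topspace X. r x = t} = {x \<in> topspace X. t \<le> r x} \<inter> U i"
    proof (intro equalityI subsetI)
      fix x assume "x \<in> {x \<in> topspace X. r x = t}"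
      then show "x \<in> {x \<in> topspace X. t \<le> r x} \<inter> U i" using r_mem[of x] Suc by simp
    next
      fix x assume "x \<in> {x \<in> topspace X. t \<le> r x} \<inter> U i"
      then show "x \<in> {x \<in> topspace X. r x = t}" using r_le[of x i] Suc by simp
    qed
    then show ?thesis using open_ge U(1) by (simp add: openin_Int)
  qed
  from greedy_recursion[where r = r and ?c0.0 = "\<lambda>_. 0" and N = N and act = \<phi>]
  obtain c :: "_ \<Rightarrow> nat" where c_all: "\<forall>y.  c y = (if r y = 0 then 0 else LEAST i. i \<notin> {c (\<phi> \<nu> y) |\<nu>. \<nu> \<in> N \<and> r (\<phi> \<nu> y) < r y})" ..
  note c = spec[OF c_all]
  have cardN: "card N < n" using N(3) n by linarith
  note g = greedy_coloring[where act = \<phi> and r = r and c = c and ?c0.0 = "\<lambda>_. 0", OF N(1) cardN c]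
  have open_c: "openin X {x \<in> topspace X. r x = t \<and> c x = i}" for t i
  proof (induction t arbitrary: i rule: less_induct)
    case (less t)
    have "\<exists>T. openin X T \<and> x \<in> T \<and> T \<subseteq> {x \<in> topspace X. r x = t \<and> c x = i}"
      if x: "x \<in> topspace X" "r x = t" "c x = i" for x
    proof -
      \<comment> \<open>Neighbours of smaller rank are to keep rank and color, an open condition by
        induction; the others need only keep rank at least \<open>t\<close>.\<close>
      define A where "A \<nu> = (if r (\<phi> \<nu> x) < t then {z \<in> topspace X. r z = r (\<phi> \<nu> x) \<and> c z = c (\<phi> \<nu> x)}
        else {z \<in> topspace X. t \<le> r z})" for \<nu>
      have A: "openin X (A \<nu>)" for \<nu> using less open_ge by (simp add: A_def)
      define T where "T = {y \<in> topspace X. r y = t} \<inter> ((\<Inter>\<nu>\<in>N. {y \<in> topspace X. \<phi> \<nu> y \<in> A \<nu>}) \<inter> topspace X)"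
      have "openin X T"
        unfolding T_def using N(1,2) A by (intro openin_Int open_eq openin_INT) (auto intro!: pre)
      moreover have "x \<in> T" using x act(1) N(2) by (auto simp: T_def A_def)
      moreover have "c y = i" if y: "y \<in> T" for y
      proof -
        have ry: "r y = t" using y by (simp add: T_def)
        have *: "(r (\<phi> \<nu> y) < t \<longleftrightarrow> r (\<phi> \<nu> x) < t) \<and> (r (\<phi> \<nu> x) < t \<longrightarrow> c (\<phi> \<nu> y) = c (\<phi> \<nu> x))"
          if "\<nu> \<in> N" for \<nu>
        proof -
          have "\<phi> \<nu> y \<in> A \<nu>" using y that by (simp add: T_def)
          then show ?thesis by (auto simp: A_def split: if_splits)
        qed
        then have "{c (\<phi> \<nu> y) |\<nu>. \<nu> \<in> N \<and> r (\<phi> \<nu> y) < t} = {c (\<phi> \<nu> x) |\<nu>. \<nu> \<in> N \<and> r (\<phi> \<nu> x) < t}"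
          by (metis (no_types, lifting))
        then show ?thesis using c[of y] c[of x] ry x by simp
      qed
      ultimately show ?thesis by (intro exI[of _ T]) (auto simp: T_def)
    qed
    then show ?case by (subst openin_subopen) blast
  qed
  have "continuous_map X (discrete_topology {..<n}) c"
    unfolding continuous_map_def
  proof (intro conjI allI impI)
    show "c \<in> topspace X \<rightarrow> topspace (discrete_topology {..<n})" using g(1) by (simp add: r_def)
    fix A :: "nat set"
    have "{x \<in> topspace X. c x \<in> A} = (\<Union>t. \<Union>i\<in>A. {x \<in> topspace X. r x = t \<and> c x = i})" by auto
    also have "openin X \<dots>" using open_c by blast
    finally show "openin X {x \<in> topspace X. c x \<in> A}" .
  qed
  moreover have "inj_on (\<lambda>d. c (\<phi> d x)) D" if x: "x \<in> topspace X" for x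
  proof (rule inj_onI, rule ccontr)
    fix d d' assume d: "d \<in> D" "d' \<in> D" "c (\<phi> d x) = c (\<phi> d' x)" "d \<noteq> d'"
    have dc: "d \<in> carrier G" "d' \<in> carrier G" using d D by auto
    define \<nu> where "\<nu> = d' \<otimes> inv d"
    have "\<nu> \<in> N" using d by (auto simp: N_def \<nu>_def)
    then have \<nu>: "\<nu> \<in> N" "inv \<nu> \<in> N" using N(4) by auto
    define y y' where "y = \<phi> d x" and "y' = \<phi> d' x"
    have yt: "y \<in> topspace X" "y' \<in> topspace X" using act(1) dc x by (auto simp: y_def y'_def)
    have yy: "\<phi> \<nu> y = y'" using act(2)[of \<nu> d x] dc x by (simp add: y_def y'_def \<nu>_def m_assoc)
    have yy': "\<phi> (inv \<nu>) y' = y"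
      using act(2)[of "inv \<nu>" d' x] dc x by (simp add: y_def y'_def \<nu>_def m_assoc inv_mult_group)
    have "r y \<noteq> r y'" using r_mem[OF yt(1)] r_mem[OF yt(2)] U(3)[OF r_mem[OF yt(1)] \<nu>(1)] yy by metis
    then consider "r y' < r y" | "r y < r y'" by linarith
    then show False
    proof cases
      case 1
      then show ?thesis using g(2)[OF \<nu>(1), of y] yy d(3) by (simp add: y_def y'_def)
    next
      case 2
      then show ?thesis using g(2)[OF \<nu>(2), of y'] yy' d(3) by (simp add: y_def y'_def)
    qed
  qed
  ultimately show ?thesis using that by blast
qed

lemma H_graph_label:
  assumes S: "S \<subseteq> carrier G" "S \<union> set_inv S \<union> {\<one>} \<subseteq> D" and q: "q \<in> Inj D n" "H_edge G S D \<sigma> q q'"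
  shows "label (H_graph G S D n) q q' = \<sigma>"
  unfolding H_graph_def lgraph.simps
  using q(2) by (rule the_equality) (rule H_edge_unique[OF S q(1) _ q(2)])

text \<open>A point is sent to the colors seen on its \<open>D\<close>-translates. Moving the point
  by \<sigma> moves this picture by \<sigma>, so orbits map homomorphically to the graph, and a
  pattern in the pulled back coloring would occur there.\<close>

lemma coloring_of_space_from_H:
  assumes free: "free_Gamma_space G X \<phi>" and zd: "zero_dimensional X" and pol: "polish X"
    and S: "S \<subseteq> carrier G" and D: "finite D" "D \<subseteq> carrier G" "S \<union> set_inv S \<union> {\<one>} \<subseteq> D"
    and n: "card D ^ 2 \<le> n" and P: "\<And>p. p \<in> P \<Longrightarrow> dom p \<subseteq> carrier G"
    and adm: "admits_avoiding_coloring G S (H_graph G S D n) k P"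
  shows "admits_continuous_avoiding_coloring X \<phi> k P"
proof -
  have Gs: "Gamma_space G X \<phi>" using free by (simp add: free_Gamma_space_def)
  note act = Gamma_space_action[OF Gs]
  obtain f where f: "f \<in> Inj D n \<rightarrow> {..<k}" and avoid: "\<And>p. p \<in> P \<Longrightarrow> \<not> occurs_in_graph G S (H_graph G S D n) p f"
    using adm by (auto simp: admits_avoiding_coloring_def H_graph_def)
  have "D \<noteq> {}" using D(3) by blast
  then obtain c where c: "continuous_map X (discrete_topology {..<n}) c"
    and inj: "\<And>x. x \<in> topspace X \<Longrightarrow> inj_on (\<lambda>d. c (\<phi> d x)) D"
    using continuous_injective_coloring[OF free zd pol D(1,2) _ n] by blast
  define q where "q x = (\<lambda>d\<in>D. c (\<phi> d x))" for x
  have cn: "c x < n" if "x \<in> topspace X" for x using c that by (auto simp: continuous_map_def)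
  have q: "q x \<in> Inj D n" if x: "x \<in> topspace X" for x
  proof -
    have "c (\<phi> d x) < n" if "d \<in> D" for d using cn act(1) that D(2) x by blast
    moreover have "inj_on (q x) D" using inj[OF x] by (simp add: q_def inj_on_restrict_eq)
    ultimately show ?thesis by (auto simp: Inj_def q_def)
  qed
  have open_q: "openin X {x \<in> topspace X. f (q x) \<in> A}" for A
  proof (subst openin_subopen, intro ballI)
    fix x assume "x \<in> {x \<in> topspace X. f (q x) \<in> A}"
    then have x: "x \<in> topspace X" "f (q x) \<in> A" by auto
    define T where "T = (\<Inter>d\<in>D. {y \<in> topspace X. c (\<phi> d y) \<in> {c (\<phi> d x)}}) \<inter> topspace X"
    have "openin X {y \<in> topspace X. c (\<phi> d y) \<in> {c (\<phi> d x)}}" if d: "d \<in> D" for d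
    proof -
      have dc: "d \<in> carrier G" using d D by blast
      have "continuous_map X (discrete_topology {..<n}) (c \<circ> \<phi> d)"
        by (rule continuous_map_compose[OF act(4)[OF dc] c])
      from openin_continuous_map_preimage[OF this, of "{c (\<phi> d x)}"]
      show ?thesis using cn[OF act(1)[OF dc x(1)]] by simp
    qed
    then have "openin X T" unfolding T_def using D(1) by (intro openin_INT) auto
    moreover have "x \<in> T" using x by (simp add: T_def)
    moreover have "q y = q x" if "y \<in> T" for y
      using that by (auto simp: T_def q_def fun_eq_iff)
    then have "T \<subseteq> {x \<in> topspace X. f (q x) \<in> A}" using x(2) by (auto simp: T_def)
    ultimately show "\<exists>T. openin X T \<and> x \<in> T \<and> T \<subseteq> {x \<in> topspace X. f (q x) \<in> A}" by blast
  qed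
  have "continuous_map X (discrete_topology {..<k}) (\<lambda>x. f (q x))"
    unfolding continuous_map_def using open_q f q by auto
  moreover have "\<not> occurs_in_space X \<phi> p (\<lambda>x. f (q x))" if p: "p \<in> P" for p
  proof
    assume "occurs_in_space X \<phi> p (\<lambda>x. f (q x))"
    then obtain x where x: "x \<in> topspace X" "\<And>g. g \<in> dom p \<Longrightarrow> p g = Some (f (q (\<phi> g x)))"
      by (auto simp: occurs_in_space_def)
    define h where "h g = q (\<phi> g x)" for g
    have hI: "h g \<in> Inj D n" if "g \<in> dom p" for g using q act(1) x(1) P[OF p] that by (auto simp: h_def)
    have "lgraph_hom (induced_lgraph (cayley_graph G S) (dom p)) (H_graph G S D n) h"
      unfolding lgraph_hom_def
    proof (intro conjI allI impI)
      show "h \<in> vertices (induced_lgraph (cayley_graph G S) (dom p)) \<rightarrow> vertices (H_graph G S D n)"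
        using hI by (simp add: induced_lgraph_def H_graph_def)
      fix a b assume "adj (induced_lgraph (cayley_graph G S) (dom p)) a b"
      then obtain \<sigma> where ab: "a \<in> dom p" "b \<in> dom p" "a \<noteq> b" "\<sigma> \<in> S \<union> set_inv S" "b = \<sigma> \<otimes> a"
        and ac: "a \<in> carrier G" by (auto simp: induced_lgraph_def cayley_graph_def)
      have \<sigma>c: "\<sigma> \<in> carrier G" using ab(4) set_inv_closed[OF S] by blast
      have "h a d = h b d'" if d: "d \<in> D" "d' \<in> D" "d = d' \<otimes> \<sigma>" for d d'
      proof -
        have dc: "d \<in> carrier G" "d' \<in> carrier G" using d D by auto
        have "h a d = c (\<phi> (d \<otimes> a) x)" using d(1) dc ac x(1) act(2) by (simp add: h_def q_def)
        moreover have "h b d' = c (\<phi> (d' \<otimes> b) x)" using d(2) dc ac \<sigma>c x(1) act(2) ab(5) by (simp add: h_def q_def)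
        moreover have "d \<otimes> a = d' \<otimes> b" using dc \<sigma>c ac d(3) ab(5) by (simp add: m_assoc)
        ultimately show ?thesis by simp
      qed
      then have edge: "H_edge G S D \<sigma> (h a) (h b)" using ab(4) unfolding H_edge_def by blast
      \<comment> \<open>Equality would give \<open>h a\<close> the same value at \<sigma> and at
        \<one>, both in \<open>D\<close>, against injectivity.\<close>
      have "h a \<noteq> h b"
      proof
        assume eq: "h a = h b"
        have "\<sigma> \<in> D" "\<one> \<in> D" using ab(4) D(3) by auto
        moreover from this have "h a \<sigma> = h b \<one>" using edge l_one[OF \<sigma>c] unfolding H_edge_def by metis
        ultimately have "\<sigma> = \<one>" using hI[OF ab(1)] eq by (auto simp: Inj_def inj_on_def)
        then show False using ab(3,5) ac by simp
      qed
      then show "adj (H_graph G S D n) (h a) (h b)" using edge hI ab by (auto simp: H_graph_def)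
      show "label (H_graph G S D n) (h a) (h b) = label (induced_lgraph (cayley_graph G S) (dom p)) a b"
        using H_graph_label[OF S D(3) hI[OF ab(1)] edge] cayley_label[OF S ac ab(4,5)]
        by (simp add: induced_lgraph_def)
    qed
    then have "occurs_in_graph G S (H_graph G S D n) p f"
      unfolding occurs_in_graph_def using x(2) by (intro exI[of _ h]) (auto simp: h_def)
    then show False using avoid[OF p] by blast
  qed
  ultimately show ?thesis unfolding admits_continuous_avoiding_coloring_def by blast
qed

end

section \<open>The free part of the shift\<close>

context group
begin

lemma group_actionI:
  assumes ext: "\<And>g. g \<in> carrier G \<Longrightarrow> \<phi> g \<in> extensional E"
    and closed: "\<And>g x. g \<in> carrier G \<Longrightarrow> x \<in> E \<Longrightarrow> \<phi> g x \<in> E"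
    and comp: "\<And>g h x. g \<in> carrier G \<Longrightarrow> h \<in> carrier G \<Longrightarrow> x \<in> E \<Longrightarrow> \<phi> g (\<phi> h x) = \<phi> (g \<otimes> h) x"
    and one: "\<And>x. x \<in> E \<Longrightarrow> \<phi> \<one> x = x"
  shows "group_action G E \<phi>"
proof -
  have Bij: "\<phi> g \<in> Bij E" if g: "g \<in> carrier G" for g
  proof -
    have "bij_betw (\<phi> g) E E"
      by (rule bij_betw_byWitness[where f' = "\<phi> (inv g)"]) (use g closed comp one in auto)
    then show ?thesis using ext[OF g] by (simp add: Bij_def)
  qed
  have "\<phi> (g \<otimes> h) = compose E (\<phi> g) (\<phi> h)" if "g \<in> carrier G" "h \<in> carrier G" for g h
  proof (rule extensionalityI[of _ E])
    show "\<phi> (g \<otimes> h) \<in> extensional E" using ext that by simp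
    show "compose E (\<phi> g) (\<phi> h) \<in> extensional E" by (simp add: compose_extensional)
    show "\<phi> (g \<otimes> h) x = compose E (\<phi> g) (\<phi> h) x" if "x \<in> E" for x
      using comp \<open>g \<in> carrier G\<close> \<open>h \<in> carrier G\<close> that by (simp add: compose_eq)
  qed
  then have "\<phi> \<in> hom G (BijGroup E)"
    using Bij by (auto simp: hom_def BijGroup_def)
  then show ?thesis
    using group_BijGroup group_axioms
    by (simp add: group_action_def group_hom_def group_hom_axioms_def)
qed

text \<open>The group is discrete, so joint continuity reduces to continuity of the single
  maps.\<close>

lemma Gamma_spaceI:
  assumes act: "group_action G (topspace X) \<phi>" and cont: "\<And>g. g \<in> carrier G \<Longrightarrow> continuous_map X X (\<phi> g)"
  shows "Gamma_space G X \<phi>"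
proof -
  let ?D = "discrete_topology (carrier G)"
  have "openin (prod_topology ?D X) {z \<in> topspace (prod_topology ?D X). (case z of (g, x) \<Rightarrow> \<phi> g x) \<in> U}"
    if U: "openin X U" for U
  proof -
    have "{z \<in> topspace (prod_topology ?D X). (case z of (g, x) \<Rightarrow> \<phi> g x) \<in> U} =
        (\<Union>g\<in>carrier G. {g} \<times> {x \<in> topspace X. \<phi> g x \<in> U})" by auto
    moreover have "openin (prod_topology ?D X) ({g} \<times> {x \<in> topspace X. \<phi> g x \<in> U})" if "g \<in> carrier G" for g
      using openin_continuous_map_preimage[OF cont[OF that] U] that by (simp add: openin_prod_Times_iff)
    ultimately show ?thesis by auto
  qed
  moreover have "\<phi> g x \<in> topspace X" if "g \<in> carrier G" "x \<in> topspace X" for g x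
    using cont[OF that(1)] that(2) by (auto simp: continuous_map_def)
  ultimately show ?thesis
    using act by (auto simp: Gamma_space_def continuous_map_def)
qed

section \<open>Topology of the free part\<close>

lemma closedin_cylinder:
  assumes "finite B" "B \<subseteq> carrier G"
  shows "closedin (two_pow G) {y \<in> Cantor. \<forall>b\<in>B. y b = v b}"
proof -
  have "openin (two_pow G) (Cantor - {y \<in> Cantor. \<forall>b\<in>B. y b = v b})"
  proof (subst openin_subopen, intro ballI)
    fix x assume x: "x \<in> Cantor - {y \<in> Cantor. \<forall>b\<in>B. y b = v b}"
    show "\<exists>T. openin (two_pow G) T \<and> x \<in> T \<and>
        T \<subseteq> Cantor - {y \<in> Cantor. \<forall>b\<in>B. y b = v b}"
      by (rule exI[of _ "{y \<in> Cantor. \<forall>b\<in>B. y b = x b}"])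
        (use x openin_cylinder[OF assms, of x] in auto)
  qed
  then show ?thesis unfolding closedin_def by blast
qed

text \<open>A cylinder is coded by its window \<open>B\<close> and the set \<open>A\<close> of
  coordinates with value 1, both finite.\<close>

lemma second_countable_two_pow:
  assumes "countable (carrier G)"
  shows "second_countable (two_pow G)"
proof -
  define cyl where "cyl B A = {y \<in> Cantor. \<forall>b\<in>B. y b = of_bool (b \<in> A)}" for B A :: "'a set"
  define F where "F = {B. B \<subseteq> carrier G \<and> finite B}"
  define \<B> where "\<B> = (\<lambda>(B, A). cyl B A) ` (F \<times> F)"
  have "countable F" using assms unfolding F_def
    using countable_Collect_finite_subset[OF assms] by (simp add: conj_commute)
  then have "countable \<B>" by (simp add: \<B>_def)
  moreover have "\<forall>V\<in>\<B>. openin (two_pow G) V"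
  proof
    fix V assume "V \<in> \<B>"
    then obtain B A where V: "V = cyl B A" "finite B" "B \<subseteq> carrier G" by (auto simp: \<B>_def F_def)
    show "openin (two_pow G) V" unfolding V(1) cyl_def by (rule openin_cylinder[OF V(2,3)])
  qed
  moreover have "\<exists>V\<in>\<B>. x \<in> V \<and> V \<subseteq> U" if U: "openin (two_pow G) U" "x \<in> U" for U x
  proof -
    obtain B where B: "finite B" "B \<subseteq> carrier G" "{y \<in> Cantor. \<forall>b\<in>B. y b = x b} \<subseteq> U"
      using cylinder_base[OF U] by blast
    have x: "x \<in> Cantor" using U openin_subset by blast
    have "x b = of_bool (b \<in> {b \<in> B. x b = 1})" if "b \<in> B" for b
    proof -
      have "x b < 2" using x that B(2) by (auto simp: topspace_two_pow PiE_iff)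
      then show ?thesis using that by auto
    qed
    then have "cyl B {b \<in> B. x b = 1} = {y \<in> Cantor. \<forall>b\<in>B. y b = x b}"
      by (auto simp: cyl_def)
    moreover have "cyl B {b \<in> B. x b = 1} \<in> \<B>"
      using B by (auto simp: \<B>_def F_def intro!: image_eqI[of _ _ "(B, {b \<in> B. x b = 1})"])
    ultimately show ?thesis using B(3) x by (intro bexI[of _ "cyl B {b \<in> B. x b = 1}"]) auto
  qed
  ultimately show ?thesis unfolding second_countable_def by blast
qed

text \<open>Freeness is a countable intersection, over \<open>h \<noteq> \<one>\<close>, of the open
  conditions that \<open>h\<close> moves \<open>x\<close>; a G-delta set inherits complete
  metrizability.\<close>

lemma polish_Free:
  assumes cnt: "countable (carrier G)" and inf: "infinite (carrier G)"
  shows "polish (Free_two_pow G)"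
proof -
  have "completely_metrizable_space (two_pow G)"
    unfolding two_pow_def using cnt
    by (simp add: completely_metrizable_space_product_topology completely_metrizable_space_discrete_topology
        countable_subset[of "{i \<in> carrier G. _ i}" "carrier G"])
  moreover have "gdelta_in (two_pow G) (free_points G)"
  proof -
    define C where "C h = {x \<in> Cantor. shift G h x \<noteq> x}" for h
    have "openin (two_pow G) (C h)" if h: "h \<in> carrier G" for h
    proof (subst openin_subopen, intro ballI)
      fix x assume "x \<in> C h"
      then have x: "x \<in> Cantor" "shift G h x \<noteq> x" by (auto simp: C_def)
      then obtain d where d: "d \<in> carrier G" "shift G h x d \<noteq> x d"
        using shift_closed[OF x(1) h] unfolding topspace_two_pow by (metis PiE_ext)
      define T where "T = {y \<in> Cantor. \<forall>b\<in>{d, d \<otimes> h}. y b = x b}"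
      have "openin (two_pow G) T" unfolding T_def using d h by (intro openin_cylinder) auto
      moreover have "x \<in> T" using x by (simp add: T_def)
      moreover have "T \<subseteq> C h"
      proof
        fix y assume y: "y \<in> T"
        then have "shift G h y d \<noteq> y d"
          using d h x(1) shift_apply[of y d h] shift_apply[OF x(1) d(1), of h] by (simp add: T_def)
        then show "y \<in> C h" using y by (auto simp: C_def T_def)
      qed
      ultimately show "\<exists>T. openin (two_pow G) T \<and> x \<in> T \<and> T \<subseteq> C h" by blast
    qed
    then have "gdelta_in (two_pow G) (\<Inter>h\<in>carrier G - {\<one>}. C h)"
      using cnt inf by (intro gdelta_in_Inter) (auto intro: open_imp_gdelta_in dest: finite_subset[of _ "{\<one>}"])
    moreover have "(\<Inter>h\<in>carrier G - {\<one>}. C h) = free_points G"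
    proof (intro equalityI subsetI)
      fix x assume x: "x \<in> (\<Inter>h\<in>carrier G - {\<one>}. C h)"
      \<comment> \<open>A nontrivial \<open>h0\<close> exists by infinitude, so the intersection is
        over a nonempty family and \<open>x\<close> is a point of the Cantor space.\<close>
      obtain h0 where "h0 \<in> carrier G - {\<one>}" using inf by (metis finite.emptyI finite_Diff2 finite_insert ex_in_conv)
      then have xt: "x \<in> Cantor" using x by (auto simp: C_def)
      moreover have "shift G \<one> x = x" using xt by (rule shift_one)
      ultimately show "x \<in> free_points G" using x by (auto simp: free_points_def stabilizer_def C_def)
    next
      fix x assume "x \<in> free_points G"
      then show "x \<in> (\<Inter>h\<in>carrier G - {\<one>}. C h)" by (auto simp: free_points_def stabilizer_def C_def)
    qed
    ultimately show ?thesis by simp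
  qed
  ultimately have "completely_metrizable_space (Free_two_pow G)"
    unfolding Free_two_pow_def by (rule completely_metrizable_space_gdelta_in)
  moreover have "separable_space (Free_two_pow G)"
    unfolding Free_two_pow_def
    by (intro second_countable_imp_separable_space second_countable_subtopology second_countable_two_pow cnt)
  ultimately show ?thesis by (simp add: polish_def)
qed

lemma zero_dimensional_Free: "zero_dimensional (Free_two_pow G)"
proof -
  define \<B> where "\<B> = {{y \<in> Cantor. \<forall>b\<in>B. y b = v b} \<inter> free_points G |B v. finite B \<and> B \<subseteq> carrier G}"
  have "openin (Free_two_pow G) V \<and> closedin (Free_two_pow G) V" if V: "V \<in> \<B>" for V
  proof -
    obtain B v where "V = {y \<in> Cantor. \<forall>b\<in>B. y b = v b} \<inter> free_points G" "finite B" "B \<subseteq> carrier G"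
      using V by (auto simp: \<B>_def)
    then show ?thesis
      by (simp only: Free_two_pow_def openin_subtopology_Int2 openin_cylinder closedin_subtopology_Int_closed
          closedin_cylinder Int_commute simp_thms)
  qed
  moreover have "\<exists>V\<in>\<B>. x \<in> V \<and> V \<subseteq> U" if U: "openin (Free_two_pow G) U" "x \<in> U" for U x
  proof -
    obtain A where A: "openin (two_pow G) A" "U = A \<inter> free_points G"
      using U(1) unfolding Free_two_pow_def openin_subtopology by blast
    obtain B where B: "finite B" "B \<subseteq> carrier G" "{y \<in> Cantor. \<forall>b\<in>B. y b = x b} \<subseteq> A"
      using cylinder_base[OF A(1), of x] A(2) U(2) by blast
    have "x \<in> Cantor" using U(2) A(2) free_points_subset by blast
    then show ?thesis
      using A(2) B U(2)
      by (intro bexI[of _ "{y \<in> Cantor. \<forall>b\<in>B. y b = x b} \<inter> free_points G"])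
        (auto simp: \<B>_def)
  qed
  ultimately show ?thesis
    unfolding zero_dimensional_def by (intro exI[of _ \<B>] conjI ballI allI impI) (auto simp only:)
qed

lemma shift_shift:
  assumes "x \<in> Cantor" "g \<in> carrier G" "h \<in> carrier G"
  shows "shift G g (shift G h x) = shift G (g \<otimes> h) x"
  using assms shift_closed[OF assms(1,3)]
  by (auto simp: shift_def[of G g] shift_def[of G "g \<otimes> h"] shift_apply m_assoc fun_eq_iff restrict_def)

lemma stabilizer_free: "x \<in> free_points G \<Longrightarrow> h \<in> carrier G \<Longrightarrow> shift G h x = x \<Longrightarrow> h = \<one>"
  by (auto simp: free_points_def stabilizer_def)

lemma shift_free:
  assumes x: "x \<in> free_points G" and g: "g \<in> carrier G"
  shows "shift G g x \<in> free_points G"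
proof -
  have xt: "x \<in> Cantor" using x free_points_subset by blast
  have gx: "shift G g x \<in> Cantor" by (rule shift_closed[OF xt g])
  have "h = \<one>" if h: "h \<in> carrier G" "shift G h (shift G g x) = shift G g x" for h
  proof -
    have "shift G (inv g) (shift G (h \<otimes> g) x) = shift G (inv g) (shift G g x)"
      using h shift_shift[OF xt h(1) g] by simp
    then have "shift G (inv g \<otimes> (h \<otimes> g)) x = x"
      using xt g h(1) by (simp add: shift_shift shift_one)
    then have "inv g \<otimes> (h \<otimes> g) = \<one>" using stabilizer_free[OF x] g h(1) by simp
    then have "h \<otimes> g = \<one> \<otimes> g" using g h(1) inv_solve_left[of \<one> g "h \<otimes> g"] by simp
    then show ?thesis using g h(1) by simp
  qed
  then show ?thesis using gx shift_one[OF gx] by (auto simp: free_points_def stabilizer_def)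
qed

lemma free_Gamma_space_Free: "free_Gamma_space G (Free_two_pow G) (free_shift G)"
proof -
  have fs: "free_shift G g x = shift G g x" if "x \<in> free_points G" for g x
    using that by (simp add: free_shift_def)
  have act: "group_action G (topspace (Free_two_pow G)) (free_shift G)"
    unfolding topspace_Free
  proof (rule group_actionI)
    fix g h x assume "g \<in> carrier G" "h \<in> carrier G" "x \<in> free_points G"
    then show "free_shift G g (free_shift G h x) = free_shift G (g \<otimes> h) x"
      using shift_free shift_shift free_points_subset by (auto simp: fs)
  qed (use shift_free shift_one free_points_subset in \<open>auto simp: fs free_shift_def[of G]\<close>)
  have "continuous_map (Free_two_pow G) (Free_two_pow G) (free_shift G g)" if g: "g \<in> carrier G" for g
  proof -
    have "continuous_map (two_pow G) (two_pow G) (shift G g)"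
      unfolding continuous_map_def
    proof (intro conjI allI impI)
      show "shift G g \<in> Cantor \<rightarrow> Cantor" using shift_closed g by blast
      fix U assume U: "openin (two_pow G) U"
      show "openin (two_pow G) {x \<in> Cantor. shift G g x \<in> U}"
      proof (subst openin_subopen, intro ballI)
        fix x assume "x \<in> {x \<in> Cantor. shift G g x \<in> U}"
        then have x: "x \<in> Cantor" "shift G g x \<in> U" by auto
        obtain B where B: "finite B" "B \<subseteq> carrier G"
          "{y \<in> Cantor. \<forall>b\<in>B. y b = shift G g x b} \<subseteq> U"
          using cylinder_base[OF U x(2)] by blast
        define T where "T = {y \<in> Cantor. \<forall>b\<in>(\<lambda>b. b \<otimes> g) ` B. y b = x b}"
        have "openin (two_pow G) T" unfolding T_def using B g by (intro openin_cylinder) auto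
        moreover have "x \<in> T" using x by (simp add: T_def)
        moreover have "T \<subseteq> {x \<in> Cantor. shift G g x \<in> U}"
        proof
          fix y assume y: "y \<in> T"
          then have yt: "y \<in> Cantor" by (simp add: T_def)
          have "shift G g y b = shift G g x b" if "b \<in> B" for b
            using y that B(2) by (simp add: T_def shift_apply[OF yt] shift_apply[OF x(1)] subset_iff)
          then show "y \<in> {x \<in> Cantor. shift G g x \<in> U}"
            using B(3) shift_closed[OF yt g] yt by blast
        qed
        ultimately show "\<exists>T. openin (two_pow G) T \<and> x \<in> T \<and> T \<subseteq> {x \<in> Cantor. shift G g x \<in> U}"
          by blast
      qed
    qed
    then have "continuous_map (Free_two_pow G) (Free_two_pow G) (shift G g)"
      unfolding Free_two_pow_def
      using shift_free g by (intro continuous_map_into_subtopology continuous_map_from_subtopology) auto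
    then show ?thesis by (rule continuous_map_eq) (simp add: topspace_Free fs)
  qed
  then have "Gamma_space G (Free_two_pow G) (free_shift G)" by (rule Gamma_spaceI[OF act])
  moreover have "stabilizer G (free_shift G) x = {\<one>}" if "x \<in> free_points G" for x
    using that by (auto simp: stabilizer_def fs free_points_def shift_one)
  ultimately show ?thesis by (simp add: free_Gamma_space_def topspace_Free)
qed

text \<open>The copy of \<open>X\<close> on the image of an injection, with topology and action
  carried over, brings the free part of the shift into the range of statement (2).\<close>

lemma transport_space:
  fixes X :: "'x topology" and \<iota> :: "'x \<Rightarrow> 'y"
  assumes free: "free_Gamma_space G X \<phi>" and zd: "zero_dimensional X" and pol: "polish X"
    and inj: "inj_on \<iota> (topspace X)"
  shows "\<exists>(Y :: 'y topology) \<psi>. free_Gamma_space G Y \<psi> \<and> zero_dimensional Y \<and> polish Y \<and>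
    (\<forall>k P. admits_continuous_avoiding_coloring Y \<psi> k P \<longrightarrow> admits_continuous_avoiding_coloring X \<phi> k P)"
proof -
  have Gs: "Gamma_space G X \<phi>" using free by (simp add: free_Gamma_space_def)
  note act = Gamma_space_action[OF Gs]
  define E where "E = topspace X"
  define \<kappa> where "\<kappa> = inv_into E \<iota>"
  define Y where "Y = pullback_topology (\<iota> ` E) \<kappa> X"
  have \<kappa>\<iota>: "\<kappa> (\<iota> x) = x" if "x \<in> E" for x using that inj by (simp add: \<kappa>_def E_def)
  have openY: "openin Y V \<longleftrightarrow> (\<exists>U. openin X U \<and> V = \<iota> ` U)" for V
  proof -
    have "\<kappa> -` U \<inter> \<iota> ` E = \<iota> ` U" if "openin X U" for U
      using openin_subset[OF that] \<kappa>\<iota> by (force simp: E_def)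
    then have "openin X U \<and> V = \<kappa> -` U \<inter> \<iota> ` E \<longleftrightarrow> openin X U \<and> V = \<iota> ` U" for U
      by (simp cong: conj_cong)
    then show ?thesis unfolding Y_def openin_pullback_topology by (simp only:)
  qed
  have topY: "topspace Y = \<iota> ` E"
    unfolding Y_def topspace_pullback_topology using \<kappa>\<iota> by (auto simp: E_def)
  have cont\<iota>: "continuous_map X Y \<iota>"
    unfolding continuous_map_def
  proof (intro conjI allI impI)
    show "\<iota> \<in> topspace X \<rightarrow> topspace Y" by (auto simp: topY E_def)
    fix V assume "openin Y V"
    then obtain U where U: "openin X U" "V = \<iota> ` U" using openY by blast
    have "{x \<in> topspace X. \<iota> x \<in> V} = U"
      using U openin_subset[OF U(1)] inj by (auto simp: inj_on_def)
    then show "openin X {x \<in> topspace X. \<iota> x \<in> V}" using U by simp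
  qed
  have cont\<kappa>: "continuous_map Y X \<kappa>"
    unfolding continuous_map_def
  proof (intro conjI allI impI)
    show "\<kappa> \<in> topspace Y \<rightarrow> topspace X" using \<kappa>\<iota> by (auto simp: topY E_def)
    fix U assume U: "openin X U"
    have "{y \<in> topspace Y. \<kappa> y \<in> U} = \<iota> ` U"
      using openin_subset[OF U] \<kappa>\<iota> by (force simp: topY E_def)
    then show "openin Y {y \<in> topspace Y. \<kappa> y \<in> U}" using U openY by auto
  qed
  have homeo: "X homeomorphic_space Y"
    unfolding homeomorphic_space_def homeomorphic_maps_def
    using cont\<iota> cont\<kappa> \<kappa>\<iota> by (intro exI[of _ \<iota>] exI[of _ \<kappa>]) (auto simp: topY E_def)
  have "completely_metrizable_space Y"
    using homeomorphic_completely_metrizable_space[OF homeo] pol by (simp add: polish_def)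
  moreover have "separable_space Y"
  proof -
    have "second_countable X"
      using pol by (simp add: polish_def metrizable_separable_imp_second_countable completely_metrizable_imp_metrizable_space)
    then have "second_countable Y" using homeomorphic_space_second_countability[OF homeo] by simp
    then show ?thesis by (rule second_countable_imp_separable_space)
  qed
  ultimately have polY: "polish Y" by (simp add: polish_def)
  have zdY: "zero_dimensional Y"
  proof -
    obtain \<B> where \<B>: "(\<forall>B\<in>\<B>. openin X B \<and> closedin X B) \<and>
        (\<forall>U x. openin X U \<and> x \<in> U \<longrightarrow> (\<exists>B\<in>\<B>. x \<in> B \<and> B \<subseteq> U))"
      using zd unfolding zero_dimensional_def ..
    have "openin Y (\<iota> ` B) \<and> closedin Y (\<iota> ` B)" if B: "B \<in> \<B>" for B
    proof -
      have o: "openin X B" "openin X (topspace X - B)" "B \<subseteq> topspace X" using \<B> B by (auto simp: closedin_def)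
      have "topspace Y - \<iota> ` B = \<iota> ` (topspace X - B)"
        using o(3) inj by (auto simp: topY E_def inj_on_def)
      then have "openin Y (topspace Y - \<iota> ` B)" using openY o(2) by auto
      moreover have "openin Y (\<iota> ` B)" using openY o(1) by auto
      ultimately show ?thesis by (simp add: closedin_def openin_subset)
    qed
    moreover have "\<exists>B\<in>(\<lambda>B. \<iota> ` B) ` \<B>. y \<in> B \<and> B \<subseteq> V" if V: "openin Y V" "y \<in> V" for V y
    proof -
      obtain U x where U: "openin X U" "V = \<iota> ` U" "x \<in> U" "y = \<iota> x" using V openY by auto
      then obtain B where "B \<in> \<B>" "x \<in> B" "B \<subseteq> U" using \<B> by blast
      then show ?thesis using U by blast
    qed
    ultimately show ?thesis unfolding zero_dimensional_def by (intro exI[of _ "(\<lambda>B. \<iota> ` B) ` \<B>"] conjI ballI allI impI) (auto simp only:)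
  qed
  define \<psi> where "\<psi> g = (\<lambda>y\<in>\<iota> ` E. \<iota> (\<phi> g (\<kappa> y)))" for g
  have \<psi>: "\<psi> g (\<iota> x) = \<iota> (\<phi> g x)" if "x \<in> E" for g x using that \<kappa>\<iota> by (simp add: \<psi>_def)
  have actE: "\<phi> g x \<in> E" if "g \<in> carrier G" "x \<in> E" for g x using act(1) that by (simp add: E_def)
  have "group_action G (topspace Y) \<psi>"
    unfolding topY
  proof (rule group_actionI)
    show "\<psi> g \<in> extensional (\<iota> ` E)" for g by (simp add: \<psi>_def)
    fix g h y assume gh: "g \<in> carrier G" "h \<in> carrier G" and "y \<in> \<iota> ` E"
    then obtain x where x: "x \<in> E" "y = \<iota> x" by blast
    show "\<psi> g (\<psi> h y) = \<psi> (g \<otimes> h) y"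
      using x gh actE act(2)[OF gh, of x] by (simp add: \<psi> E_def)
  qed (use actE act(3) in \<open>auto simp: \<psi> E_def\<close>)
  moreover have "continuous_map Y Y (\<psi> g)" if g: "g \<in> carrier G" for g
  proof -
    have "continuous_map Y Y (\<iota> \<circ> (\<phi> g \<circ> \<kappa>))"
      by (intro continuous_map_compose[OF _ cont\<iota>] continuous_map_compose[OF cont\<kappa>] act(4) g)
    then show ?thesis by (rule continuous_map_eq) (auto simp: \<psi>_def topY)
  qed
  ultimately have GY: "Gamma_space G Y \<psi>" by (rule Gamma_spaceI)
  have "stabilizer G \<psi> y = {\<one>}" if y: "y \<in> topspace Y" for y
  proof -
    obtain x where x: "x \<in> E" "y = \<iota> x" using y topY by blast
    have "\<psi> g y = y \<longleftrightarrow> \<phi> g x = x" if "g \<in> carrier G" for g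
      using x actE[OF that x(1)] inj by (simp add: \<psi> E_def inj_on_eq_iff)
    then have "stabilizer G \<psi> y = stabilizer G \<phi> x" by (auto simp: stabilizer_def)
    then show ?thesis using free x(1) by (simp add: free_Gamma_space_def E_def)
  qed
  with GY have freeY: "free_Gamma_space G Y \<psi>" by (simp add: free_Gamma_space_def)
  have "admits_continuous_avoiding_coloring X \<phi> k P"
    if adm: "admits_continuous_avoiding_coloring Y \<psi> k P" for k and P :: "('a \<rightharpoonup> nat) set"
  proof -
    obtain f where "continuous_map Y (discrete_topology {..<k}) f \<and> (\<forall>p\<in>P. \<not> occurs_in_space Y \<psi> p f)"
      using adm unfolding admits_continuous_avoiding_coloring_def ..
    then have f: "continuous_map Y (discrete_topology {..<k}) f" "\<forall>p\<in>P. \<not> occurs_in_space Y \<psi> p f"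
      by simp_all
    have "continuous_map X (discrete_topology {..<k}) (f \<circ> \<iota>)"
      by (rule continuous_map_compose[OF cont\<iota> f(1)])
    moreover have "\<not> occurs_in_space X \<phi> p (f \<circ> \<iota>)" if p: "p \<in> P" for p
    proof
      assume "occurs_in_space X \<phi> p (f \<circ> \<iota>)"
      then obtain x where x: "x \<in> E" "\<forall>g\<in>dom p. p g = Some (f (\<iota> (\<phi> g x)))"
        by (auto simp: occurs_in_space_def E_def)
      then have "occurs_in_space Y \<psi> p f"
        unfolding occurs_in_space_def topY by (intro bexI[of _ "\<iota> x"]) (simp_all add: \<psi>)
      then show False using f(2) p by blast
    qed
    ultimately show ?thesis unfolding admits_continuous_avoiding_coloring_def by blast
  qed
  then show ?thesis
    using freeY zdY polY by (intro exI[of _ Y] exI[of _ \<psi>] conjI allI impI)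
qed

text \<open>A point is determined by its coordinates with value 1, hence by a set of naturals, hence
  by a real.\<close>

lemma two_pow_inj_real:
  assumes "countable (carrier G)"
  obtains \<iota> :: "('a \<Rightarrow> nat) \<Rightarrow> real" where "inj_on \<iota> (Cantor)"
proof -
  obtain b :: "nat set \<Rightarrow> real" where b: "bij_betw b UNIV UNIV"
    using nat_sets_eqpoll_reals unfolding eqpoll_def by blast
  define e where "e = to_nat_on (carrier G)"
  have e: "inj_on e (carrier G)" using assms unfolding e_def by (rule inj_on_to_nat_on)
  have "inj_on (\<lambda>x. b (e ` {d \<in> carrier G. x d = 1})) (Cantor)"
  proof (rule inj_onI)
    fix x y assume x: "x \<in> Cantor" and y: "y \<in> Cantor"
      and "b (e ` {d \<in> carrier G. x d = 1}) = b (e ` {d \<in> carrier G. y d = 1})"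
    then have "e ` {d \<in> carrier G. x d = 1} = e ` {d \<in> carrier G. y d = 1}"
      using inj_eq[OF bij_betw_imp_inj_on[OF b]] by simp
    then have eq: "{d \<in> carrier G. x d = 1} = {d \<in> carrier G. y d = 1}"
      using e by (subst (asm) inj_on_image_eq_iff[of _ "carrier G"]) auto
    have "x d = y d" if d: "d \<in> carrier G" for d
    proof -
      have "x d < 2" "y d < 2" using x y d by (auto simp: topspace_two_pow PiE_iff)
      moreover have "x d = 1 \<longleftrightarrow> y d = 1" using eq d by blast
      ultimately show ?thesis by auto
    qed
    then show "x = y" using x y unfolding topspace_two_pow by (metis PiE_ext)
  qed
  then show ?thesis by (rule that)
qed

end

section \<open>The equivalence\<close>

context group
begin

text \<open>An edge labeled \<sigma> from \<open>h x\<close> to \<open>h y\<close> identifies entry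
  \<open>d' \<otimes> \<sigma>\<close> of the first with entry \<open>d'\<close> of the second, and
  \<open>e \<otimes> inv x = e \<otimes> inv y \<otimes> \<sigma>\<close>. So the entry belonging to
  \<open>e\<close> is constant along paths in the pattern, as long as it stays in \<open>D\<close>:
  the vertices \<open>h x\<close> are windows into one partial coloring.\<close>

lemma hom_consistent:
  assumes S: "S \<subseteq> carrier G" and D: "D \<subseteq> carrier G" "S \<union> set_inv S \<union> {\<one>} \<subseteq> D"
    and F: "F \<subseteq> carrier G"
    and conn: "lgraph_connected (induced_lgraph (cayley_graph G S) F)"
    and hom: "lgraph_hom (induced_lgraph (cayley_graph G S) F) (H_graph G S D n) h"
    and a: "a \<in> F" and b: "b \<in> F"
    and e: "e \<in> carrier G" "\<And>d. d \<in> F \<Longrightarrow> e \<otimes> inv d \<in> D"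
  shows "h b (e \<otimes> inv b) = h a (e \<otimes> inv a)"
proof -
  let ?C = "induced_lgraph (cayley_graph G S) F"
  have "(adj ?C)\<^sup>*\<^sup>* a b" using conn a b by (simp add: lgraph_connected_def induced_lgraph_def)
  then show ?thesis
  proof (induction rule: rtranclp_induct)
    case (step x y)
    from step.hyps(2) obtain \<sigma> where xy: "x \<in> F" "y \<in> F" "\<sigma> \<in> S \<union> set_inv S" "y = \<sigma> \<otimes> x"
      by (auto simp: induced_lgraph_def cayley_graph_def)
    have c: "x \<in> carrier G" "y \<in> carrier G" "\<sigma> \<in> carrier G"
      using xy F set_inv_closed[OF S] by blast+
    have "adj (H_graph G S D n) (h x) (h y)"
      and lab: "label (H_graph G S D n) (h x) (h y) = label ?C x y"
      using hom step.hyps(2) unfolding lgraph_hom_def by blast+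
    then obtain \<tau> where \<tau>: "H_edge G S D \<tau> (h x) (h y)" "h x \<in> Inj D n" by (auto simp: H_graph_def)
    have "\<tau> = \<sigma>"
      using lab H_graph_label[OF S D(2) \<tau>(2,1)] cayley_label[OF S c(1) xy(3,4)] by (simp add: induced_lgraph_def)
    moreover have "e \<otimes> inv x = e \<otimes> inv y \<otimes> \<sigma>"
      using c e(1) unfolding xy(4) by (simp add: inv_mult_group m_assoc)
    ultimately have "h x (e \<otimes> inv x) = h y (e \<otimes> inv y)"
      using \<tau>(1) e(2)[OF xy(1)] e(2)[OF xy(2)] unfolding H_edge_def by blast
    then show ?case using step.IH by simp
  qed simp
qed

lemma Inj_nonempty:
  assumes "finite D" "card D \<le> n"
  shows "Inj D n \<noteq> {}"
proof -
  obtain f where f: "f ` D \<subseteq> {..<n}" "inj_on f D"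
    using card_le_inj[of D "{..<n}"] assms by auto
  then have "restrict f D \<in> Inj D n" by (auto simp: Inj_def inj_on_restrict_eq)
  then show ?thesis by blast
qed

text \<open>A vertex is colored by applying the rule to it at \<one>. An occurrence \<open>h\<close>
  of a pattern can be read off a single vertex \<open>h a\<close>; a proper coloring of the group
  extending it then shows the pattern at \<open>inv a\<close>, contrary to
  \<open>avoid\<close>.\<close>

lemma coloring_of_H_from_rule:
  assumes cnt: "countable (carrier G)" and S: "S \<subseteq> carrier G"
    and D: "finite D" "D \<subseteq> carrier G" "S \<union> set_inv S \<union> {\<one>} \<subseteq> D" and n: "card D ^ 2 \<le> n"
    and P: "\<And>p. p \<in> P \<Longrightarrow> dom p \<subseteq> carrier G \<and> S_connected G S p"
    and \<Theta>: "local_rule U \<Theta>" "U \<subseteq> carrier G"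
    and UD: "U \<subseteq> D" "\<And>u p a b. u \<in> U \<Longrightarrow> p \<in> P \<Longrightarrow> a \<in> dom p \<Longrightarrow> b \<in> dom p \<Longrightarrow> u \<otimes> (a \<otimes> inv b) \<in> D"
    and k: "\<And>c g. \<Theta> c g < k"
    and avoid: "\<And>c p g. proper D n c \<Longrightarrow> p \<in> P \<Longrightarrow> g \<in> carrier G \<Longrightarrow>
       \<exists>d\<in>dom p. p d \<noteq> Some (\<Theta> c (d \<otimes> g))"
  shows "admits_avoiding_coloring G S (H_graph G S D n) k P"
  unfolding admits_avoiding_coloring_def
proof (intro bexI ballI notI)
  show "(\<lambda>q. \<Theta> q \<one>) \<in> vertices (H_graph G S D n) \<rightarrow> {..<k}" using k by auto
  fix p assume p: "p \<in> P" and "occurs_in_graph G S (H_graph G S D n) p (\<lambda>q. \<Theta> q \<one>)"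
  then obtain h where hom: "lgraph_hom (induced_lgraph (cayley_graph G S) (dom p)) (H_graph G S D n) h"
    and ph: "\<And>g. g \<in> dom p \<Longrightarrow> p g = Some (\<Theta> (h g) \<one>)"
    unfolding occurs_in_graph_def by blast
  have dp: "dom p \<subseteq> carrier G" using P[OF p] by blast
  have conn: "lgraph_connected (induced_lgraph (cayley_graph G S) (dom p))"
    using P[OF p] by (simp add: S_connected_def)
  have D1: "\<one> \<in> D" using D(3) by blast
  \<comment> \<open>For a pattern with empty domain any vertex will do: its extension already
    contradicts \<open>avoid\<close>.\<close>
  have "\<exists>a q. a \<in> carrier G \<and> q \<in> Inj D n \<and> (dom p \<noteq> {} \<longrightarrow> a \<in> dom p \<and> q = h a)"
  proof (cases "dom p = {}")
    case True
    have "card D \<le> card D ^ 2" by (simp add: power2_eq_square)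
    then show ?thesis using Inj_nonempty[OF D(1), of n] n True by (intro exI[of _ \<one>]) auto
  next
    case False
    then obtain a where a: "a \<in> dom p" by blast
    then have "h a \<in> Inj D n" using hom by (auto simp: lgraph_hom_def induced_lgraph_def H_graph_def)
    then show ?thesis using a dp by blast
  qed
  then obtain a q where a: "a \<in> carrier G" and q: "q \<in> Inj D n" and aq: "dom p \<noteq> {} \<Longrightarrow> a \<in> dom p \<and> q = h a"
    by blast
  obtain c where c: "\<And>d. d \<in> D \<Longrightarrow> c d = q d" "proper D n c"
    using extend_injective_coloring[OF cnt D(1,2) D1 n q] by metis
  have "p d = Some (\<Theta> c (d \<otimes> inv a))" if d: "d \<in> dom p" for d
  proof -
    have dc: "d \<in> carrier G" using d dp by blast
    have ad: "a \<in> dom p" "q = h a" using aq d by auto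
    have "\<Theta> (h d) \<one> = \<Theta> c (d \<otimes> inv a)"
    proof (rule local_ruleD[OF \<Theta>(1)])
      fix u assume u: "u \<in> U"
      have uc: "u \<in> carrier G" using u \<Theta>(2) by blast
      have "h d (u \<otimes> d \<otimes> inv d) = h a (u \<otimes> d \<otimes> inv a)"
      proof (rule hom_consistent[OF S D(2,3) dp conn hom ad(1) d])
        show "u \<otimes> d \<otimes> inv b \<in> D" if "b \<in> dom p" for b
          using UD(2)[OF u p d that] uc dc that dp by (simp add: m_assoc subset_iff)
      qed (use uc dc in simp)
      moreover have "u \<otimes> d \<otimes> inv a = u \<otimes> (d \<otimes> inv a)" using uc dc a by (simp add: m_assoc)
      moreover have "u \<otimes> d \<otimes> inv d = u" using uc dc by (simp add: m_assoc)
      ultimately show "h d (u \<otimes> \<one>) = c (u \<otimes> (d \<otimes> inv a))"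
        using c(1)[OF UD(2)[OF u p d ad(1)]] ad(2) uc by simp
    qed (use dc a in auto)
    then show ?thesis using ph[OF d] by simp
  qed
  then show False using avoid[OF c(2) p, of "inv a"] a by auto
qed

text \<open>The rule reads within the power \<open>2 * L + 2\<close> of \<open>A\<close>, and
  passing between two places of a pattern adds one factor. As \<open>L \<ge> 1\<close>, all this
  lies in the power \<open>5 * L\<close> of \<open>A\<close>, that is in the \<open>L\<close>-th
  power of \<open>B\<close>, and so in \<open>D\<close> once \<open>F i\<close> contains the fixed
  finite set \<open>B\<close>.\<close>

lemma eventually_coloring_of_H:
  fixes F :: "nat \<Rightarrow> 'a set"
  assumes cnt: "countable (carrier G)" and inf: "infinite (carrier G)"
    and S: "S \<subseteq> carrier G" and F0: "S \<union> set_inv S \<union> {\<one>} \<subseteq> F 0"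
    and F: "mono F" "\<And>i. finite (F i)" "(\<Union>i. F i) = carrier G"
    and n: "\<And>i. n i \<ge> 2" "\<And>i. n i \<ge> card (F i) ^ (2 * log_star (n i))" and k: "k \<ge> 1"
    and P: "finite P" "\<And>p. p \<in> P \<Longrightarrow> is_pattern G k p \<and> S_connected G S p"
    and adm: "admits_continuous_avoiding_coloring (Free_two_pow G) (free_shift G) k P"
  shows "finite {i. \<not> admits_avoiding_coloring G S (H_graph G S (set_pow G (F i) (log_star (n i))) (n i)) k P}"
proof -
  have "countable (carrier G - {\<one>})" "carrier G - {\<one>} \<noteq> {}"
    using cnt inf by (auto dest: finite_subset[of _ "{\<one>}"])
  then obtain \<gamma> :: "nat \<Rightarrow> 'a" where \<gamma>: "range \<gamma> = carrier G - {\<one>}"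
    by (metis range_from_nat_into)
  have \<gamma>': "\<gamma> j \<in> carrier G" "\<gamma> j \<noteq> \<one>" for j using \<gamma> by blast+
  from separating_rules[of \<gamma>, OF inf \<gamma>'] obtain T where T0: "(\<forall>j. finite (T j) \<and> T j \<subseteq> carrier G) \<and>
    (\<forall>m. separating_window T \<gamma> m)" ..
  then have T: "finite (T j) \<and> T j \<subseteq> carrier G" for j by blast
  have pat: "is_pattern G k p" if "p \<in> P" for p using P(2)[OF that] by blast
  have "\<exists>m W. \<exists>\<Phi> :: ('a \<Rightarrow> bool) \<Rightarrow> 'a \<Rightarrow> nat. avoiding_rule T \<gamma> k P m W \<Phi>"
    by (rule coloring_rule_from_Free[OF \<gamma> T P(1) _ k adm]) (rule pat)
  then obtain m W and \<Phi> :: "('a \<Rightarrow> bool) \<Rightarrow> 'a \<Rightarrow> nat" where "avoiding_rule T \<gamma> k P m W \<Phi>"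
    by (elim exE) (rule that)
  then have W: "finite W" "W \<subseteq> carrier G" "local_rule W \<Phi>" and \<Phi>k: "\<And>x g. \<Phi> x g < k"
    and \<Phi>: "\<And>x p g. \<forall>j<m. separates (T j) (\<gamma> j) x \<Longrightarrow> p \<in> P \<Longrightarrow> g \<in> carrier G \<Longrightarrow>
      \<exists>d\<in>dom p. p d \<noteq> Some (\<Phi> x (d \<otimes> g))"
    by simp_all
  from T0 have "separating_window T \<gamma> m" by blast
  then obtain U K where U: "finite U" "U \<subseteq> carrier G" and K: "finite K" "K \<subseteq> carrier G"
    and \<Theta>: "\<forall>n. separating_rule T \<gamma> m U K n"
    by (elim exE conjE) (rule that)
  define A where "A = insert \<one> (K \<union> U \<union> W \<union> (\<Union>p\<in>P. (\<lambda>(a, b). a \<otimes> inv b) ` (dom p \<times> dom p)))"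
  have dp: "finite (dom p)" "dom p \<subseteq> carrier G" if "p \<in> P" for p using pat[OF that] by (auto simp: is_pattern_def)
  have A: "finite A" "\<one> \<in> A"
    using K U W P(1) dp by (auto simp: A_def)
  have "a \<otimes> inv b \<in> carrier G" if "p \<in> P" "a \<in> dom p" "b \<in> dom p" for p a b
    using subsetD[OF dp(2)[OF that(1)]] that(2,3) by simp
  then have Ac: "A \<subseteq> carrier G"
    using K U W by (auto simp only: A_def split_paired_all prod.case one_closed)
  note A = A(1) Ac A(2)
  define B where "B = set_pow G A 5"
  have B: "finite B" "B \<subseteq> carrier G" using A by (simp_all add: B_def finite_set_pow set_pow_closed)
  obtain i0 where i0: "B \<subseteq> F i0"
  proof -
    have "\<forall>b\<in>B. \<exists>i. b \<in> F i" using B(2) F(3) by blast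
    then obtain j where j: "\<forall>b\<in>B. b \<in> F (j b)" by metis
    have "b \<in> F (Max (j ` B))" if b: "b \<in> B" for b
    proof -
      have "j b \<le> Max (j ` B)" using b B(1) by simp
      then show ?thesis using j b F(1) by (meson monoD subsetD)
    qed
    then show ?thesis using that[of "Max (j ` B)"] by blast
  qed
  have "admits_avoiding_coloring G S (H_graph G S (set_pow G (F i) (log_star (n i))) (n i)) k P"
    if i: "i0 \<le> i" for i
  proof -
    define L where "L = log_star (n i)"
    have L: "L \<ge> 1" using log_star_pos[OF n(1)] by (simp add: L_def)
    define D where "D = set_pow G (F i) L"
    have Fi: "F i \<subseteq> carrier G" using F(3) by blast
    have SF: "S \<union> set_inv S \<union> {\<one>} \<subseteq> F i" using F0 monoD[OF F(1), of 0 i] by auto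
    have BF: "B \<subseteq> F i" using i0 monoD[OF F(1) i] by blast
    have FD: "F i \<subseteq> D"
      unfolding D_def using set_pow_mono_exp[OF Fi _ L] SF set_pow_one[OF Fi] by auto
    have AD: "set_pow G A t \<subseteq> D" if "t \<le> 2 * L + 3" for t
    proof -
      have "set_pow G A t \<subseteq> set_pow G A (5 * L)" using that L by (intro set_pow_mono_exp A) auto
      also have "\<dots> = set_pow G B L" unfolding B_def using set_pow_mult[OF A(2), of 5 L] by simp
      also have "\<dots> \<subseteq> D" unfolding D_def by (rule set_pow_mono[OF BF])
      finally show ?thesis .
    qed
    from spec[OF \<Theta>, of "n i"]
    obtain \<Theta>0 :: "('a \<Rightarrow> nat) \<Rightarrow> 'a \<Rightarrow> bool" where \<Theta>0_all: "local_rule (set_pow G (insert \<one> K) (2 * log_star (n i)) <#> U) \<Theta>0 \<and>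
        (\<forall>c. proper K (n i) c \<longrightarrow> (\<forall>j<m. separates (T j) (\<gamma> j) (\<Theta>0 c)))" ..
    have \<Theta>0: "local_rule (set_pow G (insert \<one> K) (2 * L) <#> U) \<Theta>0"
      "\<And>c. proper K (n i) c \<Longrightarrow> \<forall>j<m. separates (T j) (\<gamma> j) (\<Theta>0 c)"
      using \<Theta>0_all by (simp_all add: L_def)
    define V where "V = (set_pow G (insert \<one> K) (2 * L) <#> U) <#> W"
    have Kc: "insert \<one> K \<subseteq> carrier G" using K by simp
    have rule: "local_rule V (\<lambda>c. \<Phi> (\<Theta>0 c))"
      unfolding V_def by (intro local_rule_comp \<Theta>0(1) W set_mult_closed set_pow_closed Kc U)
    have Vc: "V \<subseteq> carrier G"
      unfolding V_def by (intro set_mult_closed set_pow_closed Kc U W)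
    have VA: "V \<subseteq> set_pow G A (2 * L + 2)"
    proof
      fix v assume "v \<in> V"
      then obtain x u w where v: "v = x \<otimes> u \<otimes> w" "x \<in> set_pow G (insert \<one> K) (2 * L)" "u \<in> U" "w \<in> W"
        by (auto simp: V_def set_mult_def)
      have "x \<in> set_pow G A (2 * L)" using v(2) set_pow_mono[of "insert \<one> K" A] by (auto simp: A_def)
      moreover have "u \<in> set_pow G A 1" "w \<in> set_pow G A 1" using v(3,4) set_pow_one[OF A(2)] by (auto simp: A_def)
      ultimately have "x \<otimes> u \<otimes> w \<in> set_pow G A (2 * L + 1 + 1)" by (intro set_pow_in_mult A(2))
      then show "v \<in> set_pow G A (2 * L + 2)" by (simp add: v(1) del: set_pow.simps)
    qed
    have "admits_avoiding_coloring G S (H_graph G S D (n i)) k P"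
    proof (rule coloring_of_H_from_rule[OF cnt S _ _ _ _ _ rule Vc])
      show "finite D" unfolding D_def by (rule finite_set_pow[OF F(2)])
      show "D \<subseteq> carrier G" unfolding D_def by (rule set_pow_closed[OF Fi])
      show "S \<union> set_inv S \<union> {\<one>} \<subseteq> D" using SF FD by blast
      have "card D ^ 2 \<le> (card (F i) ^ L) ^ 2"
        unfolding D_def by (intro power_mono card_set_pow_le F(2)) simp
      also have "\<dots> \<le> n i" using n(2)[of i] by (simp add: L_def power_mult[symmetric] mult.commute)
      finally show "card D ^ 2 \<le> n i" .
      show "dom p \<subseteq> carrier G \<and> S_connected G S p" if "p \<in> P" for p using dp P(2) that by blast
      show "V \<subseteq> D" using VA AD[of "2 * L + 2"] by auto
      show "u \<otimes> (a \<otimes> inv b) \<in> D" if "u \<in> V" "p \<in> P" "a \<in> dom p" "b \<in> dom p" for u p a b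
      proof -
        have "(a, b) \<in> dom p \<times> dom p" using that(3,4) by simp
        then have "a \<otimes> inv b \<in> (\<lambda>(a, b). a \<otimes> inv b) ` (dom p \<times> dom p)"
          by (rule image_eqI[rotated]) simp
        then have "a \<otimes> inv b \<in> A" unfolding A_def using that(2) by blast
        then have "a \<otimes> inv b \<in> set_pow G A 1" using set_pow_one[OF A(2)] by simp
        then have "u \<otimes> (a \<otimes> inv b) \<in> set_pow G A (2 * L + 2 + 1)"
          using VA that(1) by (intro set_pow_in_mult A(2)) auto
        then show ?thesis using AD[of "2 * L + 2 + 1"] by auto
      qed
      show "\<Phi> (\<Theta>0 c) g < k" for c g by (rule \<Phi>k)
      fix c p g assume c: "proper D (n i) c" and p: "p \<in> P" and g: "g \<in> carrier G"
      have "K \<subseteq> D" using AD[of 1] set_pow_one[OF A(2)] by (auto simp: A_def)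
      then have "proper K (n i) c" using proper_mono[OF c] by simp
      then show "\<exists>d\<in>dom p. p d \<noteq> Some (\<Phi> (\<Theta>0 c) (d \<otimes> g))" using \<Phi>[OF \<Theta>0(2) p g] by blast
    qed
    then show ?thesis by (simp add: D_def L_def)
  qed
  then have "{i. \<not> admits_avoiding_coloring G S (H_graph G S (set_pow G (F i) (log_star (n i))) (n i)) k P} \<subseteq> {..<i0}"
    by (auto simp: not_le[symmetric])
  then show ?thesis by (rule finite_subset) simp
qed

end

(* HOL cannot quantify over types inside a formula.  Statement (2) therefore ranges over spaces whose
   points are real numbers (every Polish space is homeomorphic to such a space); the last conjunct
   adds that (1) implies (2) for spaces over an arbitrary type 'x. *)
theorem theorem1p14:
  fixes \<Gamma> :: "('g, 'm) monoid_scheme" (structure)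
    and S :: "'g set"
    and F :: "nat \<Rightarrow> 'g set"
    and n :: "nat \<Rightarrow> nat"
    and k :: nat
    and P :: "('g \<rightharpoonup> nat) set"
  assumes "group \<Gamma>" and "countable (carrier \<Gamma>)" and "infinite (carrier \<Gamma>)"
    and "S \<subseteq> carrier \<Gamma>" and "finite S"
    and "S \<union> set_inv S \<union> {\<one>} \<subseteq> F 0"
    and "strict_mono F"
    and "\<And>i. finite (F i)"
    and "(\<Union>i. F i) = carrier \<Gamma>"
    and "\<And>i. n i \<ge> 2"
    and "\<And>i. n i \<ge> card (F i) ^ (2 * log_star (n i))"
    and "k \<ge> 1"
    and "finite P"
    and "\<And>p. p \<in> P \<Longrightarrow> is_pattern \<Gamma> k p \<and> S_connected \<Gamma> S p"
  shows "let
      H = (\<lambda>i. H_graph \<Gamma> S (set_pow \<Gamma> (F i) (log_star (n i))) (n i));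
      stmt1 = admits_continuous_avoiding_coloring (Free_two_pow \<Gamma>) (free_shift \<Gamma>) k P;
      stmt2 = (\<forall>(X :: real topology) \<phi>.
        free_Gamma_space \<Gamma> X \<phi> \<and> zero_dimensional X \<and> polish X \<longrightarrow>
        admits_continuous_avoiding_coloring X \<phi> k P);
      stmt2_any_type = (\<forall>(X :: 'x topology) \<phi>.
        free_Gamma_space \<Gamma> X \<phi> \<and> zero_dimensional X \<and> polish X \<longrightarrow>
        admits_continuous_avoiding_coloring X \<phi> k P);
      stmt3 = (\<exists>i. admits_avoiding_coloring \<Gamma> S (H i) k P);
      stmt4 = finite {i. \<not> admits_avoiding_coloring \<Gamma> S (H i) k P}
    in (stmt1 \<longleftrightarrow> stmt2) \<and> (stmt1 \<longleftrightarrow> stmt3) \<and> (stmt1 \<longleftrightarrow> stmt4) \<and> (stmt1 \<longrightarrow> stmt2_any_type)"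
proof -
  interpret group \<Gamma> by fact
  define H where "H = (\<lambda>i. H_graph \<Gamma> S (set_pow \<Gamma> (F i) (log_star (n i))) (n i))"
  define stmt1 where "stmt1 \<longleftrightarrow> admits_continuous_avoiding_coloring (Free_two_pow \<Gamma>) (free_shift \<Gamma>) k P"
  have F: "mono F" using \<open>strict_mono F\<close> by (rule strict_mono_mono)
  have Fi: "F i \<subseteq> carrier \<Gamma>" for i using assms(9) by blast
  have fin4: "finite {i. \<not> admits_avoiding_coloring \<Gamma> S (H i) k P}" if stmt1
    unfolding H_def
    by (rule eventually_coloring_of_H[OF assms(2,3,4,6) F assms(8-14) that[unfolded stmt1_def]])
  have from_H: "admits_continuous_avoiding_coloring X \<phi> k P"
    if adm: "admits_avoiding_coloring \<Gamma> S (H i) k P"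
      and X: "free_Gamma_space \<Gamma> X \<phi>" "zero_dimensional X" "polish X" for i X \<phi>
  proof (rule coloring_of_space_from_H[OF X assms(4)])
    let ?D = "set_pow \<Gamma> (F i) (log_star (n i))"
    show "finite ?D" by (rule finite_set_pow[OF assms(8)])
    show "?D \<subseteq> carrier \<Gamma>" by (rule set_pow_closed[OF Fi])
    have SF: "S \<union> set_inv S \<union> {\<one>} \<subseteq> F i" using assms(6) monoD[OF F, of 0 i] by auto
    moreover have "F i \<subseteq> ?D"
      using set_pow_mono_exp[OF Fi _ log_star_pos[OF assms(10)]] SF set_pow_one[OF Fi] by auto
    ultimately show "S \<union> set_inv S \<union> {\<one>} \<subseteq> ?D" by blast
    have "card ?D ^ 2 \<le> (card (F i) ^ log_star (n i)) ^ 2"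
      by (intro power_mono card_set_pow_le assms(8)) simp
    also have "\<dots> \<le> n i" using assms(11)[of i] by (simp add: power_mult[symmetric] mult.commute)
    finally show "card ?D ^ 2 \<le> n i" .
    show "dom p \<subseteq> carrier \<Gamma>" if "p \<in> P" for p using assms(14)[OF that] by (simp add: is_pattern_def)
    show "admits_avoiding_coloring \<Gamma> S (H_graph \<Gamma> S ?D (n i)) k P" using adm by (simp add: H_def)
  qed
  have one_iff_three: "stmt1 \<longleftrightarrow> (\<exists>i. admits_avoiding_coloring \<Gamma> S (H i) k P)"
  proof
    assume stmt1
    then have "{i. \<not> admits_avoiding_coloring \<Gamma> S (H i) k P} \<noteq> UNIV"
      using fin4 infinite_UNIV_nat by metis
    then show "\<exists>i. admits_avoiding_coloring \<Gamma> S (H i) k P" by blast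
  next
    assume "\<exists>i. admits_avoiding_coloring \<Gamma> S (H i) k P"
    then show stmt1
      unfolding stmt1_def
      using from_H free_Gamma_space_Free zero_dimensional_Free polish_Free[OF assms(2,3)] by blast
  qed
  have one_four: "stmt1 \<longleftrightarrow> finite {i. \<not> admits_avoiding_coloring \<Gamma> S (H i) k P}"
  proof
    assume "finite {i. \<not> admits_avoiding_coloring \<Gamma> S (H i) k P}"
    then have "{i. \<not> admits_avoiding_coloring \<Gamma> S (H i) k P} \<noteq> UNIV"
      using infinite_UNIV_nat by metis
    then show stmt1 using one_iff_three by blast
  qed (rule fin4)
  have one_two_real: "\<forall>(X :: real topology) \<phi>. free_Gamma_space \<Gamma> X \<phi> \<and> zero_dimensional X \<and> polish X \<longrightarrow>
      admits_continuous_avoiding_coloring X \<phi> k P" if stmt1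
    using that one_iff_three from_H by blast
  have one_two_any: "\<forall>(X :: 'x topology) \<phi>. free_Gamma_space \<Gamma> X \<phi> \<and> zero_dimensional X \<and> polish X \<longrightarrow>
      admits_continuous_avoiding_coloring X \<phi> k P" if stmt1
    using that one_iff_three from_H by blast
  have two_one: stmt1
    if two: "\<forall>(X :: real topology) \<phi>. free_Gamma_space \<Gamma> X \<phi> \<and> zero_dimensional X \<and> polish X \<longrightarrow>
      admits_continuous_avoiding_coloring X \<phi> k P"
  proof -
    \<comment> \<open>The free part itself is copied to the reals, and its coloring is pulled back
      along \<iota>.\<close>
    obtain \<iota> :: "('g \<Rightarrow> nat) \<Rightarrow> real" where "inj_on \<iota> (topspace (two_pow \<Gamma>))"
      using two_pow_inj_real[OF assms(2)] by blast
    then have inj: "inj_on \<iota> (topspace (Free_two_pow \<Gamma>))"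
      using free_points_subset by (simp add: topspace_Free inj_on_subset)
    from transport_space[OF free_Gamma_space_Free zero_dimensional_Free polish_Free[OF assms(2,3)] inj]
    show ?thesis unfolding stmt1_def using two by blast
  qed
  show ?thesis
    unfolding Let_def H_def[symmetric] stmt1_def[symmetric]
    using one_iff_three one_four one_two_real one_two_any two_one by (intro conjI iffI) blast+
qed

end
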